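(* There is at most one entropy solution of the problem $\partial_t u+\nabla\cdot\mathbf{f}(u)=\sum_{i,j}\partial^2_{x_ix_j}\mathbf{A}_{ij}(u)$ on $(0,\infty)\times\mathcal{G}_d$, $u(0,\cdot)=u_0\in L^\infty(\mathcal{G}_d)$. More specifically, if $u,v$ are entropy solutions with initial data $u_0,v_0\in L^\infty(\mathcal{G}_d)$, then for a.e. $t>0$, $$\int_{\mathcal{G}_d}|u(t,\omega)-v(t,\omega)|\,d\mathfrak{m}(\omega)\le\int_{\mathcal{G}_d}|u_0(\omega)-v_0(\omega)|\,d\mathfrak{m}(\omega).$$
   Context: Standing setting: $\mathbf{f}:\mathbb{R}\to\mathbb{R}^d$ smooth; $\mathbf{A}(u)=(\mathbf{A}_{ij}(u))$ smooth symmetric with derivative $A(u)=(a_{ij}(u))$ nonnegative definite; smooth $\sigma_{ik}$ with $a_{ij}=\sum_k\sigma_{ik}\sigma_{jk}$; $\beta_{ik}(u)=\int^u\sigma_{ik}$. $\mathcal{G}_d$ is the Bohr compactification of $\mathbb{R}^d$ (compact abelian group containing $\mathbb{R}^d$ densely; $C(\mathcal{G}_d)\cong\mathrm{AP}(\mathbb{R}^d)$, the sup-norm closure of trigonometric polynomials), with normalized Haar measure $\mathfrak{m}$. Partial derivatives on $\mathcal{G}_d$: $\partial_{x_i}f(\omega)=\lim_{h\to0}(f(\omega+he_i)-f(\omega))/h$ with $e_i\in\mathbb{R}^d\subset\mathcal{G}_d$; test functions $C_0^\infty((0,\infty)\times\mathcal{G}_d)$ are compactly supported with all iterated derivatives continuous;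 distributional derivatives and inequalities are defined by integration by parts against them w.r.t. $dt\,d\mathfrak{m}$. An entropy solution with initial datum $w_0$ is $w\in L^\infty((0,\infty)\times\mathcal{G}_d)$ with: (i) $\sum_i\partial_{x_i}\beta_{ik}(w)\in L^2((0,\infty)\times\mathcal{G}_d)$; (ii) for $\psi\in C(\mathbb{R})$, $\sum_i\partial_{x_i}\beta^\psi_{ik}(w)=\psi(w)\sum_i\partial_{x_i}\beta_{ik}(w)\in L^2$, $(\beta^\psi_{ik})'=\psi\beta'_{ik}$; (iii) for every convex $C^2$ $\eta$, with $\mathbf{q}'=\eta'\mathbf{f}'$, $r'_{ij}=\eta'a_{ij}$: $\partial_t\eta(w)+\nabla_x\cdot\mathbf{q}(w)-\sum\partial^2_{x_ix_j}r_{ij}(w)\le-\eta''(w)\sum_k(\sum_i\partial_{x_i}\beta_{ik}(w))^2$ in distributions; (iv) $\int_{\mathcal{G}_d}|w(t)-w_0|d\mathfrak{m}\to0$ as $t\to0^+$. *)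

theory Defs
  imports "HOL-Analysis.Analysis"
begin

text \<open>Bohr compactification of R^d, realised as the Pontryagin dual of the discrete
  group R^d (frequencies): all homomorphisms from (R^d,+) to the unit circle, with the
  topology of pointwise convergence (product topology on functions).  A point x of R^d
  is the character (lambda xi. exp(i xi.x)); the group law is pointwise multiplication.\<close>

type_synonym 'd bohr_pt = "real^'d \<Rightarrow> complex"

definition bohr :: "'d::finite bohr_pt set" where
  "bohr = {c. (\<forall>x y. c (x + y) = c x * c y) \<and> (\<forall>x. cmod (c x) = 1)}"

definition xshift :: "'d::finite bohr_pt \<Rightarrow> 'd \<Rightarrow> real \<Rightarrow> 'd bohr_pt" where
  "xshift \<omega> i h = (\<lambda>\<xi>. \<omega> \<xi> * cis (h * \<xi> $ i))"

definition haar_measure :: "'d::finite bohr_pt measure \<Rightarrow> bool" where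
  "haar_measure m \<longleftrightarrow>
     space m = bohr \<and> sets m = sets (restrict_space borel bohr) \<and> emeasure m (space m) = 1 \<and>
     (\<forall>g\<in>bohr. \<forall>A\<in>sets m.
        emeasure m ((\<lambda>\<omega>. (\<lambda>\<xi>. g \<xi> * \<omega> \<xi>)) -` A \<inter> bohr) = emeasure m A) \<and>
     (\<forall>A\<in>sets m. emeasure m A = (SUP K\<in>{K. compact K \<and> K \<subseteq> A}. emeasure m K))"

datatype 'd dir = Dt | Dx 'd

fun Dop :: "'d::finite dir list \<Rightarrow> (real \<Rightarrow> 'd bohr_pt \<Rightarrow> real) \<Rightarrow> real \<Rightarrow> 'd bohr_pt \<Rightarrow> real" where
  "Dop [] \<phi> = \<phi>"
| "Dop (Dt # ds) \<phi> = (\<lambda>t \<omega>. deriv (\<lambda>s. Dop ds \<phi> s \<omega>) t)"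
| "Dop (Dx i # ds) \<phi> = (\<lambda>t \<omega>. deriv (\<lambda>h. Dop ds \<phi> t (xshift \<omega> i h)) 0)"

definition test_fun :: "(real \<Rightarrow> 'd::finite bohr_pt \<Rightarrow> real) \<Rightarrow> bool" where
  "test_fun \<phi> \<longleftrightarrow>
     (\<exists>a b. 0 < a \<and> a \<le> b \<and> (\<forall>t. \<forall>\<omega>\<in>bohr. t \<notin> {a..b} \<longrightarrow> \<phi> t \<omega> = 0)) \<and>
     (\<forall>ds. continuous_on ({0<..} \<times> bohr) (\<lambda>(t,\<omega>). Dop ds \<phi> t \<omega>) \<and>
        (\<forall>t>0. \<forall>\<omega>\<in>bohr. (\<lambda>s. Dop ds \<phi> s \<omega>) differentiable (at t) \<and>
           (\<forall>i. (\<lambda>h. Dop ds \<phi> t (xshift \<omega> i h)) differentiable (at 0))))"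

definition tG :: "'d::finite bohr_pt measure \<Rightarrow> (real \<times> 'd bohr_pt) measure" where
  "tG m = restrict_space lborel {0<..} \<Otimes>\<^sub>M m"

definition Linf :: "'a measure \<Rightarrow> ('a \<Rightarrow> real) \<Rightarrow> bool" where
  "Linf M f \<longleftrightarrow> f \<in> borel_measurable M \<and> (\<exists>C. AE x in M. \<bar>f x\<bar> \<le> C)"

definition L2 :: "'a measure \<Rightarrow> ('a \<Rightarrow> real) \<Rightarrow> bool" where
  "L2 M f \<longleftrightarrow> f \<in> borel_measurable M \<and> integrable M (\<lambda>x. (f x)^2)"

definition prim :: "(real \<Rightarrow> real) \<Rightarrow> real \<Rightarrow> real" where
  "prim g u = (if 0 \<le> u then integral {0..u} g else - integral {u..0} g)"

definition smooth_fun :: "(real \<Rightarrow> real) \<Rightarrow> bool" where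
  "smooth_fun g \<longleftrightarrow> (\<forall>n x. ((deriv ^^ n) g) differentiable (at x))"

definition C2_fun :: "(real \<Rightarrow> real) \<Rightarrow> bool" where
  "C2_fun \<eta> \<longleftrightarrow> (\<forall>x. \<eta> differentiable (at x)) \<and> (\<forall>x. deriv \<eta> differentiable (at x)) \<and>
                 continuous_on UNIV (deriv (deriv \<eta>))"

text \<open>Entropy solution (conditions (i)-(iv)); g k is the L^2 function
  sum_i d_{x_i} beta_ik(w), beta_ik(u) = int_0^u sigma_ik.\<close>
definition entropy_solution ::
  "'d::finite bohr_pt measure \<Rightarrow> (real \<Rightarrow> real^'d) \<Rightarrow> (real \<Rightarrow> real^'d^'d) \<Rightarrow>
   (real \<Rightarrow> real^'k::finite^'d) \<Rightarrow> (real \<Rightarrow> 'd bohr_pt \<Rightarrow> real) \<Rightarrow> ('d bohr_pt \<Rightarrow> real) \<Rightarrow> bool" where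
  "entropy_solution m F a \<sigma> w w0 \<longleftrightarrow>
     Linf (tG m) (\<lambda>(t,\<omega>). w t \<omega>) \<and>
     (\<exists>g :: 'k \<Rightarrow> real \<times> 'd bohr_pt \<Rightarrow> real.
        \<comment> \<open>(i)\<close>
        (\<forall>k. L2 (tG m) (g k)) \<and>
        (\<forall>k \<phi>. test_fun \<phi> \<longrightarrow>
           (\<integral>x. g k x * \<phi> (fst x) (snd x) \<partial>tG m) =
           - (\<integral>x. (\<Sum>i\<in>UNIV. prim (\<lambda>s. \<sigma> s $ i $ k) (w (fst x) (snd x))
                               * Dop [Dx i] \<phi> (fst x) (snd x)) \<partial>tG m)) \<and>
        \<comment> \<open>(ii)\<close>
        (\<forall>\<psi>. continuous_on UNIV \<psi> \<longrightarrow>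
           (\<forall>k. L2 (tG m) (\<lambda>x. \<psi> (w (fst x) (snd x)) * g k x)) \<and>
           (\<forall>k \<phi>. test_fun \<phi> \<longrightarrow>
             (\<integral>x. \<psi> (w (fst x) (snd x)) * g k x * \<phi> (fst x) (snd x) \<partial>tG m) =
             - (\<integral>x. (\<Sum>i\<in>UNIV. prim (\<lambda>s. \<psi> s * \<sigma> s $ i $ k) (w (fst x) (snd x))
                                 * Dop [Dx i] \<phi> (fst x) (snd x)) \<partial>tG m))) \<and>
        \<comment> \<open>(iii)\<close>
        (\<forall>\<eta>. convex_on UNIV \<eta> \<and> C2_fun \<eta> \<longrightarrow>
           (\<forall>\<phi>. test_fun \<phi> \<and> (\<forall>t. \<forall>\<omega>\<in>bohr. 0 \<le> \<phi> t \<omega>) \<longrightarrow>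
             (\<integral>x. deriv (deriv \<eta>) (w (fst x) (snd x)) * (\<Sum>k\<in>UNIV. (g k x)^2)
                    * \<phi> (fst x) (snd x) \<partial>tG m)
             \<le> (\<integral>x. \<eta> (w (fst x) (snd x)) * Dop [Dt] \<phi> (fst x) (snd x)
                    + (\<Sum>j\<in>UNIV. prim (\<lambda>s. deriv \<eta> s * deriv (\<lambda>r. F r $ j) s) (w (fst x) (snd x))
                                  * Dop [Dx j] \<phi> (fst x) (snd x))
                    + (\<Sum>i\<in>UNIV. \<Sum>j\<in>UNIV. prim (\<lambda>s. deriv \<eta> s * a s $ i $ j) (w (fst x) (snd x))
                                  * Dop [Dx i, Dx j] \<phi> (fst x) (snd x)) \<partial>tG m)))) \<and>
     \<comment> \<open>(iv), as an essential limit\<close>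
     (\<forall>\<epsilon>>0. \<exists>\<delta>>0. AE t in lborel. 0 < t \<and> t < \<delta> \<longrightarrow>
                    (\<integral>\<omega>. \<bar>w t \<omega> - w0 \<omega>\<bar> \<partial>m) < \<epsilon>)"

end

theory Submission
  imports Defs
begin

text \<open>
  Kruzhkov's doubling of variables.  Let \<open>u(t, x)\<close> and \<open>v(s, y)\<close> be entropy solutions and let \<open>K\<close> be
  a nonnegative trigonometric polynomial of mean \<open>1\<close>.  The entropy inequalities for the convex entropies
  \<open>\<eta>(w - c)\<close>, \<open>\<eta>(z) = sqrt (z\<^sup>2 + \<delta>\<^sup>2)\<close>, with \<open>c\<close> the value of the other solution, are tested
  with \<open>\<theta>(t) \<kappa>(s - t) K(x y\<^sup>-\<^sup>1)\<close> and added; the two dissipation terms are bounded below by twice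
  the mixed term, which the chain rule (ii), used once in \<open>x\<close> and once in \<open>y\<close>, turns into a second order
  flux.  Because \<open>K(x y\<^sup>-\<^sup>1)\<close> depends on \<open>x y\<^sup>-\<^sup>1\<close> only and all its derivatives have mean zero, every flux
  term cancels as \<open>\<delta> \<longrightarrow> 0\<close>, for a fixed \<open>K\<close>.  What remains is
  \<open>0 \<le> \<integral>\<integral> \<bar>u(t, x) - v(s, y)\<bar> \<theta>'(t) \<kappa>(s - t) K(x y\<^sup>-\<^sup>1)\<close>.

  Choosing \<open>\<theta>'\<close> as a bump near \<open>0\<close> minus a bump \<open>b\<close>, and \<open>K\<close> so concentrated that
  \<open>\<integral>\<integral> \<bar>v\<^sub>0(x) - v\<^sub>0(y)\<bar> K(x y\<^sup>-\<^sup>1)\<close> is small, bounds the part carried by \<open>b\<close> by the initial data.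
  The diagonal is reached without any continuity of \<open>v\<close> in time: the same inequality for the pair
  \<open>(v, v)\<close> makes \<open>v(t, x) - v(s, y)\<close> small in mean, and
  \<open>\<bar>u(t, x) - v(t, x)\<bar> \<le> \<bar>u(t, x) - v(s, y)\<bar> + \<bar>v(t, x) - v(s, y)\<bar>\<close>.
\<close>

subsection \<open>Smooth functions and bumps\<close>

text \<open>The group has no countable neighbourhood base at the identity, so no sequence of kernels
  concentrates there: each kernel is chosen for one function and one \<epsilon>, and \<delta>
  \<longrightarrow> 0 is taken with that kernel fixed. Borel sets of the square need not be
  generated by rectangles, whereas Fubini lives on \<open>m \<Otimes>\<^sub>M m\<close>; a
  trigonometric polynomial in x y^-1 is a finite expression in coordinate evaluations and therefore
  measurable there. The same choice makes all iterated derivatives explicit, gives an admissible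
  test function in each variable separately, and lets Stone-Weierstrass supply positivity and
  concentration. The derivatives of a fixed kernel may be huge, but they do not depend on \<delta>,
  and they multiply an error of order \<open>sqrt \<delta>\<close>. This rate comes from
  \<bar>z\<bar> \<eta>''(z), which is not uniformly small and becomes so only after integration,
  because \<eta>'' carries mass at most 2 whatever \<delta> is.\<close>

primrec times_differentiable :: "nat \<Rightarrow> (real \<Rightarrow> real) \<Rightarrow> bool" where
  "times_differentiable 0 f \<longleftrightarrow> True"
| "times_differentiable (Suc n) f \<longleftrightarrow>
     (\<exists>f'. (\<forall>x. (f has_real_derivative f' x) (at x)) \<and> times_differentiable n f')"

lemma times_differentiable_SucD:
  "times_differentiable (Suc n) f \<Longrightarrow> times_differentiable n f"
proof (induction n arbitrary: f)
  case (Suc n)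
  then obtain f' where "\<And>x. (f has_real_derivative f' x) (at x)" "times_differentiable (Suc n) f'"
    by (metis times_differentiable.simps(2))
  with Suc.IH[of f'] show ?case by (auto simp del: times_differentiable.simps intro!: times_differentiable.simps(2)[THEN iffD2])
qed simp

lemma times_differentiable_Suc_iff:
  "times_differentiable (Suc n) f \<longleftrightarrow>
     (\<forall>x. f differentiable (at x)) \<and> times_differentiable n (deriv f)"
proof
  assume "times_differentiable (Suc n) f"
  then obtain f' where f': "\<And>x. (f has_real_derivative f' x) (at x)" "times_differentiable n f'"
    by auto
  then have "deriv f = f'" by (auto intro!: DERIV_imp_deriv)
  with f' show "(\<forall>x. f differentiable (at x)) \<and> times_differentiable n (deriv f)"
    by (auto simp: real_differentiable_def)
next
  assume "(\<forall>x. f differentiable (at x)) \<and> times_differentiable n (deriv f)"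
  then show "times_differentiable (Suc n) f"
    by (auto simp: DERIV_deriv_iff_real_differentiable intro!: exI[of _ "deriv f"])
qed

text \<open>Smoothness is handled through \<open>times_differentiable\<close>, whose clause asks for
  some derivative instead of naming \<open>deriv\<close>: sums, products and affine substitutions
  then go by induction on the order, with the derivative written down, and no iterate of
  \<open>deriv\<close> is ever computed.\<close>

lemma smooth_fun_iff: "smooth_fun f \<longleftrightarrow> (\<forall>n. times_differentiable n f)"
proof -
  have "(\<forall>k<n. \<forall>x. ((deriv ^^ k) f) differentiable (at x)) \<longleftrightarrow> times_differentiable n f" for n
  proof (induction n arbitrary: f)
    case (Suc n)
    have "(\<forall>k<Suc n. \<forall>x. ((deriv ^^ k) f) differentiable (at x)) \<longleftrightarrow>
      (\<forall>x. f differentiable (at x)) \<and> (\<forall>k<n. \<forall>x. ((deriv ^^ k) (deriv f)) differentiable (at x))"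
      unfolding All_less_Suc2 funpow_Suc_right o_apply by simp
    then show ?case
      unfolding times_differentiable_Suc_iff Suc[of "deriv f"] .
  qed simp
  then show ?thesis unfolding smooth_fun_def by blast
qed

lemma smooth_fun_DERIV: "smooth_fun f \<Longrightarrow> (f has_real_derivative deriv f x) (at x)"
  unfolding smooth_fun_def using DERIV_deriv_iff_real_differentiable[of f x]
  by (auto dest: spec[of _ 0])

lemma smooth_fun_deriv: "smooth_fun f \<Longrightarrow> smooth_fun (deriv f)"
  unfolding smooth_fun_iff using times_differentiable_Suc_iff by blast

text \<open>Serves the time cut-offs, which are built by prescribing their derivative.\<close>

lemma smooth_fun_antideriv:
  assumes "\<And>x. (f has_real_derivative g x) (at x)" "smooth_fun g"
  shows "smooth_fun f"
  unfolding smooth_fun_iff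
proof
  fix n show "times_differentiable n f"
    using assms by (cases n) (auto simp: smooth_fun_iff)
qed

lemma smooth_fun_continuous: "smooth_fun f \<Longrightarrow> continuous_on A f"
  by (meson DERIV_isCont continuous_at_imp_continuous_on smooth_fun_DERIV)

lemma smooth_fun_const: "smooth_fun (\<lambda>x. c)"
proof -
  have "times_differentiable n (\<lambda>x. c)" for n c
    by (induction n arbitrary: c) (auto intro!: exI[of _ "\<lambda>x. 0"])
  then show ?thesis by (auto simp: smooth_fun_iff)
qed

lemma times_differentiable_add:
  "times_differentiable n f \<Longrightarrow> times_differentiable n g \<Longrightarrow> times_differentiable n (\<lambda>x. f x + g x)"
proof (induction n arbitrary: f g)
  case (Suc n)
  then obtain f' g' where
    "\<And>x. (f has_real_derivative f' x) (at x)" "times_differentiable n f'"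
    "\<And>x. (g has_real_derivative g' x) (at x)" "times_differentiable n g'"
    by auto
  then show ?case using Suc.IH[of f' g']
    by (auto intro!: exI[of _ "\<lambda>x. f' x + g' x"] derivative_intros)
qed simp

lemma times_differentiable_mult:
  "times_differentiable n f \<Longrightarrow> times_differentiable n g \<Longrightarrow> times_differentiable n (\<lambda>x. f x * g x)"
proof (induction n arbitrary: f g)
  case (Suc n)
  then obtain f' g' where D:
    "\<And>x. (f has_real_derivative f' x) (at x)" "times_differentiable n f'"
    "\<And>x. (g has_real_derivative g' x) (at x)" "times_differentiable n g'"
    by auto
  have "((\<lambda>x. f x * g x) has_real_derivative f' x * g x + f x * g' x) (at x)" for x
    by (rule derivative_eq_intros D | simp)+
  then show ?case
    using times_differentiable_add[OF Suc.IH[OF D(2) times_differentiable_SucD[OF Suc.prems(2)]]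
      Suc.IH[OF times_differentiable_SucD[OF Suc.prems(1)] D(4)]]
    by (auto intro!: exI[of _ "\<lambda>x. f' x * g x + f x * g' x"])
qed simp

lemma smooth_fun_add: "smooth_fun f \<Longrightarrow> smooth_fun g \<Longrightarrow> smooth_fun (\<lambda>x. f x + g x)"
  by (simp add: smooth_fun_iff times_differentiable_add)

lemma smooth_fun_mult: "smooth_fun f \<Longrightarrow> smooth_fun g \<Longrightarrow> smooth_fun (\<lambda>x. f x * g x)"
  by (simp add: smooth_fun_iff times_differentiable_mult)

lemma smooth_fun_diff:
  "smooth_fun f \<Longrightarrow> smooth_fun g \<Longrightarrow> smooth_fun (\<lambda>x. f x - g x)"
  using smooth_fun_add[of f "\<lambda>x. (-1) * g x"] smooth_fun_mult[OF smooth_fun_const, of g "-1"]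
  by simp

lemma smooth_fun_power: "smooth_fun f \<Longrightarrow> smooth_fun (\<lambda>x. f x ^ n)"
  by (induction n) (auto intro: smooth_fun_const smooth_fun_mult)

lemma smooth_fun_affine:
  assumes "smooth_fun f" shows "smooth_fun (\<lambda>x. f (a * x + b))"
proof -
  have "times_differentiable n f \<Longrightarrow> times_differentiable n (\<lambda>x. c * f (a * x + b))" for n c
  proof (induction n arbitrary: f c)
    case (Suc n)
    then obtain f' where D: "\<And>x. (f has_real_derivative f' x) (at x)" "times_differentiable n f'"
      by auto
    have "((\<lambda>x. c * f (a * x + b)) has_real_derivative c * a * f' (a * x + b)) (at x)" for x
      by (rule derivative_eq_intros DERIV_chain2[OF D(1)] | simp)+
    then show ?case using Suc.IH[OF D(2), of "c * a"]
      by (auto intro!: exI[of _ "\<lambda>x. c * a * f' (a * x + b)"])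
  qed simp
  then have "smooth_fun (\<lambda>x. 1 * f (a * x + b))"
    using assms unfolding smooth_fun_iff by blast
  then show ?thesis by simp
qed

section \<open>Smooth functions that are flat at the origin\<close>

definition flat_exp :: "real poly \<Rightarrow> real \<Rightarrow> real" where
  "flat_exp p x = (if 0 < x then poly p (1 / x) * exp (- (1 / x)) else 0)"

lemma poly_times_exp_minus_tendsto_0:
  "((\<lambda>y. poly p y * exp (- y)) \<longlongrightarrow> 0) at_top" for p :: "real poly"
proof -
  have "((\<lambda>y. \<Sum>i\<le>degree p. coeff p i * (y ^ i / exp y)) \<longlongrightarrow> (\<Sum>i\<le>degree p. coeff p i * 0)) at_top"
    by (intro tendsto_intros tendsto_power_div_exp_0)
  then show ?thesis
    by (simp add: poly_altdef exp_minus sum_distrib_right divide_inverse mult.assoc)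
qed

text \<open>The family p(1/x) exp(-1/x) is closed under differentiation: as (1/x)' = -(1/x)^2, the
  polynomial becomes (p - p') X^2, with \<open>[:0, 0, 1:]\<close> for X^2. Passing from p = 1 to
  all p is what lets the induction on the order run.\<close>

lemma flat_exp_DERIV:
  "(flat_exp p has_real_derivative flat_exp ((p - pderiv p) * [:0, 0, 1:]) x) (at x)"
proof -
  consider "x < 0" | "x = 0" | "0 < x" by linarith
  then show ?thesis
  proof cases
    case 1
    have "((\<lambda>x. 0) has_real_derivative 0) (at x)" by simp
    moreover have "\<forall>\<^sub>F y in nhds x. flat_exp p y = 0"
      using 1 eventually_nhds_in_open[of "{..<0}" x]
      by (auto simp: flat_exp_def elim!: eventually_mono)
    ultimately show ?thesis
      using 1 DERIV_cong_ev[of x x "flat_exp p" "\<lambda>x. 0" 0 0] by (simp add: flat_exp_def)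
  next
    case 3
    have "((\<lambda>x. poly p (1 / x) * exp (- (1 / x))) has_real_derivative
        (poly (pderiv p) (1 / x) * (- 1 / x^2)) * exp (- (1 / x))
        + poly p (1 / x) * (exp (- (1 / x)) * (1 / x^2))) (at x)"
      using 3 by (auto intro!: derivative_eq_intros DERIV_chain2[OF poly_DERIV] simp: power2_eq_square)
    moreover have "\<forall>\<^sub>F y in nhds x. flat_exp p y = poly p (1 / y) * exp (- (1 / y))"
      using 3 eventually_nhds_in_open[of "{0<..}" x]
      by (auto simp: flat_exp_def elim!: eventually_mono)
    moreover have "flat_exp ((p - pderiv p) * [:0, 0, 1:]) x =
        (poly (pderiv p) (1 / x) * (- 1 / x^2)) * exp (- (1 / x))
        + poly p (1 / x) * (exp (- (1 / x)) * (1 / x^2))"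
      using 3 by (simp add: flat_exp_def field_simps power2_eq_square)
    ultimately show ?thesis
      using DERIV_cong_ev by metis
  next
    case 2
    \<comment> \<open>At 0 the difference quotient is of the same type with p multiplied by X, and
      it decays because the exponential beats every polynomial in 1/h.\<close>
    have lim: "((\<lambda>h. poly (p * [:0, 1:]) (1 / h) * exp (- (1 / h))) \<longlongrightarrow> 0) (at_right (0::real))"
      using filterlim_compose[OF poly_times_exp_minus_tendsto_0[of "p * [:0, 1:]"]
          filterlim_inverse_at_top_right]
      by (simp only: divide_inverse mult_1)
    have "((\<lambda>h. flat_exp p h / h) \<longlongrightarrow> 0) (at_right 0)"
    proof (rule Lim_transform_eventually[OF lim])
      show "\<forall>\<^sub>F h in at_right 0. poly (p * [:0, 1:]) (1 / h) * exp (- (1 / h)) = flat_exp p h / h"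
        using eventually_at_right_less[of "0::real"]
        by eventually_elim (auto simp: flat_exp_def field_simps)
    qed
    moreover have "((\<lambda>h. flat_exp p h / h) \<longlongrightarrow> 0) (at_left 0)"
      by (rule tendsto_eventually) (auto simp: flat_exp_def eventually_at_filter)
    ultimately have "((\<lambda>h. flat_exp p h / h) \<longlongrightarrow> 0) (at 0)"
      by (simp add: filterlim_at_split)
    then show ?thesis using 2 by (simp add: DERIV_def flat_exp_def)
  qed
qed

lemma smooth_fun_flat_exp: "smooth_fun (flat_exp p)"
proof -
  have "times_differentiable n (flat_exp p)" for n p
    by (induction n arbitrary: p) (auto intro!: exI flat_exp_DERIV)
  then show ?thesis by (simp add: smooth_fun_iff)
qed

text \<open>The exact positivity set is recorded, not merely a support: it allows open sets of times
  to be described by bumps. For b \<le> a the function is identically 0.\<close>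

lemma smooth_bump:
  fixes a b :: real
  obtains f where "smooth_fun f" "\<And>x. 0 \<le> f x" "\<And>x. f x \<le> 1"
    "\<And>x. 0 < f x \<longleftrightarrow> a < x \<and> x < b"
proof
  let ?e = "flat_exp 1"
  let ?f = "\<lambda>x. ?e (x - a) * ?e (b - x)"
  show "smooth_fun ?f"
    using smooth_fun_mult[OF smooth_fun_affine[OF smooth_fun_flat_exp, of 1 1 "-a"]
        smooth_fun_affine[OF smooth_fun_flat_exp, of 1 "-1" b]] by simp
  have e: "0 \<le> ?e x" "?e x \<le> 1" "0 < ?e x \<longleftrightarrow> 0 < x" for x
    by (auto simp: flat_exp_def)
  show "0 \<le> ?f x" "?f x \<le> 1" for x using e by (auto intro!: mult_le_one)
  show "0 < ?f x \<longleftrightarrow> a < x \<and> x < b" for x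
    using e(1,3)[of "x - a"] e(1,3)[of "b - x"] by (auto simp: zero_less_mult_iff)
qed

subsection \<open>Products of integrable functions\<close>

lemma (in pair_sigma_finite) integrable_pair_times:
  fixes f :: "'a \<Rightarrow> real" and g :: "'b \<Rightarrow> real"
  assumes f: "integrable M1 f" and g: "integrable M2 g"
  shows "integrable (M1 \<Otimes>\<^sub>M M2) (\<lambda>z. f (fst z) * g (snd z))"
proof -
  have [measurable]: "f \<in> borel_measurable M1" "g \<in> borel_measurable M2"
    using f g by auto
  have "integrable (M1 \<Otimes>\<^sub>M M2) (\<lambda>(x, y). f x * g y)"
  proof (rule Fubini_integrable)
    show "(\<lambda>(x, y). f x * g y) \<in> borel_measurable (M1 \<Otimes>\<^sub>M M2)" by measurable
    show "integrable M1 (\<lambda>x. \<integral>y. norm (case (x, y) of (x, y) \<Rightarrow> f x * g y) \<partial>M2)"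
      using f by (simp add: abs_mult)
    show "AE x in M1. integrable M2 (\<lambda>y. case (x, y) of (x, y) \<Rightarrow> f x * g y)"
      using g by simp
  qed
  then show ?thesis by (simp add: case_prod_unfold)
qed

lemma (in pair_sigma_finite) integral_pair_times:
  fixes f :: "'a \<Rightarrow> real" and g :: "'b \<Rightarrow> real"
  assumes f: "integrable M1 f" and g: "integrable M2 g"
  shows "(\<integral>z. f (fst z) * g (snd z) \<partial>(M1 \<Otimes>\<^sub>M M2)) = (\<integral>x. f x \<partial>M1) * (\<integral>y. g y \<partial>M2)"
  using integral_fst'[OF integrable_pair_times[OF f g]] by simp

subsection \<open>Trigonometric polynomials on the Bohr compactification\<close>

lemma bohr_add: "c \<in> bohr \<Longrightarrow> c (x + y) = c x * c y"
  by (simp add: bohr_def)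

lemma bohr_norm: "c \<in> bohr \<Longrightarrow> cmod (c x) = 1"
  by (simp add: bohr_def)

lemma bohr_zero: assumes "c \<in> bohr" shows "c 0 = 1"
proof -
  have "c 0 * c 0 = c 0" using bohr_add[OF assms, of 0 0] by simp
  moreover have "c 0 \<noteq> 0" using bohr_norm[OF assms, of 0] by auto
  ultimately show ?thesis by simp
qed

lemma bohr_mult_cnj: "c \<in> bohr \<Longrightarrow> c x * cnj (c x) = 1"
  using bohr_norm[of c x] by (simp add: complex_norm_square[symmetric])

lemma bohr_uminus: assumes "c \<in> bohr" shows "c (- x) = cnj (c x)"
proof -
  have "c (- x) * c x = 1" using bohr_add[OF assms, of "- x" x] bohr_zero[OF assms] by simp
  then have "c (- x) * (c x * cnj (c x)) = cnj (c x)" by (simp add: mult.assoc[symmetric])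
  then show ?thesis using bohr_mult_cnj[OF assms] by simp
qed

lemma bohr_mult: "c \<in> bohr \<Longrightarrow> c' \<in> bohr \<Longrightarrow> (\<lambda>\<xi>. c \<xi> * c' \<xi>) \<in> bohr"
  by (simp add: bohr_def norm_mult)

lemma bohr_cnj: "c \<in> bohr \<Longrightarrow> (\<lambda>\<xi>. cnj (c \<xi>)) \<in> bohr"
  by (simp add: bohr_def)

lemma bohr_one: "(\<lambda>\<xi>. 1) \<in> bohr"
  by (simp add: bohr_def)

lemma bohr_point: "(\<lambda>\<xi>. cis (\<xi> \<bullet> z)) \<in> bohr"
  by (simp add: bohr_def inner_add_left cis_mult)

section \<open>The Bohr group as a compact Hausdorff space\<close>

lemma compact_bohr: "compact (bohr :: 'd::finite bohr_pt set)"
proof -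
  let ?P = "PiE UNIV (\<lambda>_. sphere 0 1) :: 'd bohr_pt set"
  \<comment> \<open>Tychonoff for a product of circles; the homomorphism equations then cut out a
    closed subset, since each of them involves only three coordinates.\<close>
  have "compactin (product_topology (\<lambda>_. euclidean) UNIV) ?P"
    by (simp add: compactin_PiE)
  then have "compact ?P"
    by (simp add: euclidean_product_topology)
  moreover have "closed {c :: 'd bohr_pt. \<forall>x y. c (x + y) = c x * c y}"
    by (intro closed_Collect_all closed_Collect_eq continuous_intros continuous_on_product_coordinates)
  ultimately have "compact (?P \<inter> {c. \<forall>x y. c (x + y) = c x * c y})"
    by (rule compact_Int_closed)
  moreover have "bohr = ?P \<inter> {c. \<forall>x y. c (x + y) = c x * c y}"
    by (auto simp: bohr_def PiE_def)
  ultimately show ?thesis by metis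
qed

text \<open>The arities for \<open>t0_space\<close> and \<open>t1_space\<close> have to come first: the library only has them for
  countable index types, through \<open>metric_space\<close>, and a more general arity for \<open>t2_space\<close> alone would clash.\<close>

instance "fun" :: (type, t0_space) t0_space
proof
  fix f g :: "'a \<Rightarrow> 'b" assume "f \<noteq> g"
  then obtain x where x: "f x \<noteq> g x" by auto
  then obtain U where U: "open U" "(f x \<in> U) \<noteq> (g x \<in> U)"
    using t0_space_class.t0_space[OF x] by auto
  have "open ((\<lambda>h::'a \<Rightarrow> 'b. h x) -` U)"
    using U by (auto intro!: open_vimage continuous_on_product_coordinates)
  with U show "\<exists>U. open U \<and> \<not> (f \<in> U \<longleftrightarrow> g \<in> U)"
    by (intro exI[of _ "(\<lambda>h. h x) -` U"]) auto
qed

instance "fun" :: (type, t1_space) t1_space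
proof
  fix f g :: "'a \<Rightarrow> 'b" assume "f \<noteq> g"
  then obtain x where x: "f x \<noteq> g x" by auto
  then obtain U where U: "open U" "f x \<in> U" "g x \<notin> U"
    using t1_space_class.t1_space[OF x] by auto
  have "open ((\<lambda>h::'a \<Rightarrow> 'b. h x) -` U)"
    using U by (auto intro!: open_vimage continuous_on_product_coordinates)
  with U show "\<exists>U. open U \<and> f \<in> U \<and> g \<notin> U"
    by (intro exI[of _ "(\<lambda>h. h x) -` U"]) auto
qed

instance "fun" :: (type, t2_space) t2_space
proof
  fix f g :: "'a \<Rightarrow> 'b" assume "f \<noteq> g"
  then obtain x where x: "f x \<noteq> g x" by auto
  then obtain U V where UV: "open U" "open V" "f x \<in> U" "g x \<in> V" "U \<inter> V = {}"
    using hausdorff[OF x] by auto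
  have "open ((\<lambda>h::'a \<Rightarrow> 'b. h x) -` U)" "open ((\<lambda>h::'a \<Rightarrow> 'b. h x) -` V)"
    using UV by (auto intro!: open_vimage continuous_on_product_coordinates)
  with UV show "\<exists>U V. open U \<and> open V \<and> f \<in> U \<and> g \<in> V \<and> U \<inter> V = {}"
    by (intro exI[of _ "(\<lambda>h. h x) -` U"] exI[of _ "(\<lambda>h. h x) -` V"]) auto
qed

section \<open>Real trigonometric polynomials and their derivatives\<close>

definition trig :: "(real^'d) set \<Rightarrow> (real^'d \<Rightarrow> complex) \<Rightarrow> 'd::finite bohr_pt \<Rightarrow> real" where
  "trig S c \<omega> = (\<Sum>\<xi>\<in>S. Re (c \<xi> * \<omega> \<xi>))"

lemma continuous_on_trig [continuous_intros]:
  assumes "continuous_on A f" shows "continuous_on A (\<lambda>x. trig S c (f x))"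
proof -
  have "continuous_on A (\<lambda>x. f x \<xi>)" for \<xi>
    using assms by (rule continuous_on_product_then_coordinatewise)
  then show ?thesis unfolding trig_def by (intro continuous_intros)
qed

lemma continuous_on_coord: "continuous_on A (\<lambda>\<omega>. \<omega> \<xi>)"
  by (rule continuous_on_product_then_coordinatewise[OF continuous_on_id])

text \<open>Moving along e_i multiplies the value of the character at \<xi> by
  \<open>cis (h * \<xi> $ i)\<close>, so differentiating multiplies the coefficient by \<i> \<xi>_i.
  The slope at h = 0 is the one that \<open>Dop\<close> uses.\<close>

lemma trig_xshift_DERIV:
  "((\<lambda>h. trig S c (xshift \<omega> i h)) has_real_derivative trig S (\<lambda>\<xi>. c \<xi> * (\<i> * \<xi> $ i)) \<omega>) (at 0)"
proof -
  have eq: "Re (c \<xi> * (\<omega> \<xi> * cis (h * \<xi> $ i))) =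
      Re (c \<xi> * \<omega> \<xi>) * cos (h * \<xi> $ i) - Im (c \<xi> * \<omega> \<xi>) * sin (h * \<xi> $ i)" for \<xi> h
    by (simp add: algebra_simps)
  have "((\<lambda>h. \<Sum>\<xi>\<in>S. Re (c \<xi> * \<omega> \<xi>) * cos (h * \<xi> $ i) - Im (c \<xi> * \<omega> \<xi>) * sin (h * \<xi> $ i))
      has_real_derivative (\<Sum>\<xi>\<in>S. - (Im (c \<xi> * \<omega> \<xi>) * \<xi> $ i))) (at 0)"
    by (intro DERIV_sum) (auto intro!: derivative_eq_intros)
  moreover have "Re (c \<xi> * (\<i> * complex_of_real (\<xi> $ i)) * \<omega> \<xi>) = - (Im (c \<xi> * \<omega> \<xi>) * \<xi> $ i)" for \<xi>
    by (simp add: algebra_simps)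
  ultimately show ?thesis unfolding trig_def xshift_def eq by simp
qed

lemma Dop_Dt_trig:
  "smooth_fun \<theta> \<Longrightarrow> Dop (Dt # ds) \<phi> = (\<lambda>t \<omega>. deriv \<theta> t * trig S c \<omega>)"
  if "Dop ds \<phi> = (\<lambda>t \<omega>. \<theta> t * trig S c \<omega>)"
  using that by (auto intro!: ext DERIV_imp_deriv derivative_eq_intros smooth_fun_DERIV)

lemma Dop_Dx_trig:
  "Dop (Dx i # ds) \<phi> = (\<lambda>t \<omega>. \<theta> t * trig S (\<lambda>\<xi>. c \<xi> * (\<i> * \<xi> $ i)) \<omega>)"
  if "Dop ds \<phi> = (\<lambda>t \<omega>. \<theta> t * trig S c \<omega>)"
  using that by (auto intro!: ext DERIV_imp_deriv DERIV_cmult trig_xshift_DERIV)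

text \<open>Separated products are stable under every \<open>Dop\<close>: time derivatives act on
  \<theta>, space derivatives on the coefficients. The demands of \<open>test_fun\<close> on all
  iterated derivatives thus reduce to one function of this shape.\<close>

lemma Dop_trig_form:
  assumes "smooth_fun \<theta>"
  shows "\<exists>\<theta>' c'. smooth_fun \<theta>' \<and> Dop ds (\<lambda>t \<omega>. \<theta> t * trig S c \<omega>) = (\<lambda>t \<omega>. \<theta>' t * trig S c' \<omega>)"
proof (induction ds)
  case Nil
  then show ?case using assms by auto
next
  case (Cons d ds)
  then obtain \<theta>' c' where *: "smooth_fun \<theta>'"
    "Dop ds (\<lambda>t \<omega>. \<theta> t * trig S c \<omega>) = (\<lambda>t \<omega>. \<theta>' t * trig S c' \<omega>)" by blast
  show ?case
  proof (cases d)
    case Dt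
    show ?thesis unfolding Dt Dop_Dt_trig[OF *(2,1)] using smooth_fun_deriv[OF *(1)] by blast
  next
    case (Dx i)
    show ?thesis unfolding Dx Dop_Dx_trig[OF *(2)] using *(1) by blast
  qed
qed

lemma test_fun_trig:
  assumes "smooth_fun \<theta>" "0 < a" "\<And>t. t \<notin> {a..b} \<Longrightarrow> \<theta> t = 0"
  shows "test_fun (\<lambda>t \<omega>. \<theta> t * trig S c \<omega>)"
  unfolding test_fun_def
proof (intro conjI allI)
  show "\<exists>a b. 0 < a \<and> a \<le> b \<and> (\<forall>t. \<forall>\<omega>\<in>bohr. t \<notin> {a..b} \<longrightarrow> \<theta> t * trig S c \<omega> = 0)"
  \<comment> \<open>\<open>max a b\<close> covers b < a, where \<theta> vanishes identically but
    \<open>test_fun\<close> still asks for an ordered interval.\<close>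
  proof (rule exI[of _ a], rule exI[of _ "max a b"], intro conjI allI ballI impI)
    show "\<theta> t * trig S c \<omega> = 0" if "t \<notin> {a..max a b}" for t \<omega>
    proof -
      have "t \<notin> {a..b}" using that by auto
      then show ?thesis using assms(3) by simp
    qed
  qed (use assms(2) in auto)
  fix ds
  obtain \<theta>' c' where *: "smooth_fun \<theta>'"
    "Dop ds (\<lambda>t \<omega>. \<theta> t * trig S c \<omega>) = (\<lambda>t \<omega>. \<theta>' t * trig S c' \<omega>)"
    using Dop_trig_form[OF assms(1)] by blast
  have "continuous_on ({0<..} \<times> bohr) (\<lambda>x. \<theta>' (fst x) * trig S c' (snd x))"
    by (intro continuous_intros continuous_on_compose2[OF smooth_fun_continuous[OF *(1), of UNIV]]) auto
  then show "continuous_on ({0<..} \<times> bohr) (\<lambda>(t, \<omega>). Dop ds (\<lambda>t \<omega>. \<theta> t * trig S c \<omega>) t \<omega>)"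
    by (simp add: *(2) case_prod_beta)
  show "0 < t \<longrightarrow> (\<forall>\<omega>\<in>bohr.
      (\<lambda>s. Dop ds (\<lambda>t \<omega>. \<theta> t * trig S c \<omega>) s \<omega>) differentiable (at t) \<and>
      (\<forall>i. (\<lambda>h. Dop ds (\<lambda>t \<omega>. \<theta> t * trig S c \<omega>) t (xshift \<omega> i h)) differentiable (at 0)))" for t
    unfolding *(2) real_differentiable_def
    by (auto intro!: exI DERIV_cmult DERIV_cmult_right trig_xshift_DERIV smooth_fun_DERIV[OF *(1)])
qed

text \<open>Agreement is asked on \<open>bohr\<close> only: products collapse to single frequencies
  by the homomorphism law, which fails for arbitrary functions.\<close>

definition trig_poly :: "('d::finite bohr_pt \<Rightarrow> real) set" where
  "trig_poly = {f. \<exists>S c. finite S \<and> (\<forall>\<omega>\<in>bohr. f \<omega> = trig S c \<omega>)}"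

lemma trig_poly_single: "(\<lambda>\<omega>. Re (c * \<omega> \<xi>)) \<in> trig_poly"
  unfolding trig_poly_def trig_def by (auto intro!: exI[of _ "{\<xi>}"] exI[of _ "\<lambda>_. c"])

lemma trig_poly_add:
  assumes "f \<in> trig_poly" "g \<in> trig_poly" shows "(\<lambda>\<omega>. f \<omega> + g \<omega>) \<in> trig_poly"
proof -
  obtain S c S' c' where *: "finite S" "\<forall>\<omega>\<in>bohr. f \<omega> = trig S c \<omega>"
    "finite S'" "\<forall>\<omega>\<in>bohr. g \<omega> = trig S' c' \<omega>"
    using assms by (auto simp: trig_poly_def)
  have "trig S c \<omega> + trig S' c' \<omega> = trig (S \<union> S')
      (\<lambda>\<xi>. (if \<xi> \<in> S then c \<xi> else 0) + (if \<xi> \<in> S' then c' \<xi> else 0)) \<omega>" for \<omega>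
  proof -
    have "(\<Sum>\<xi>\<in>S. Re (c \<xi> * \<omega> \<xi>)) = (\<Sum>\<xi>\<in>S \<union> S'. Re ((if \<xi> \<in> S then c \<xi> else 0) * \<omega> \<xi>))"
      "(\<Sum>\<xi>\<in>S'. Re (c' \<xi> * \<omega> \<xi>)) = (\<Sum>\<xi>\<in>S \<union> S'. Re ((if \<xi> \<in> S' then c' \<xi> else 0) * \<omega> \<xi>))"
      using *(1,3) by (auto intro!: sum.mono_neutral_cong_left)
    then show ?thesis
      unfolding trig_def by (simp only: sum.distrib[symmetric] plus_complex.simps(1)[symmetric] distrib_right)
  qed
  with * show ?thesis unfolding trig_poly_def mem_Collect_eq
    by (intro exI[of _ "S \<union> S'"]
        exI[of _ "\<lambda>\<xi>. (if \<xi> \<in> S then c \<xi> else 0) + (if \<xi> \<in> S' then c' \<xi> else 0)"]) simp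
qed

lemma trig_poly_cong: "f \<in> trig_poly \<Longrightarrow> (\<And>\<omega>. \<omega> \<in> bohr \<Longrightarrow> f \<omega> = g \<omega>) \<Longrightarrow> g \<in> trig_poly"
  unfolding trig_poly_def by auto

lemma trig_poly_const: "(\<lambda>\<omega>. c) \<in> trig_poly"
  by (rule trig_poly_cong[OF trig_poly_single[of "of_real c" 0]]) (simp add: bohr_zero)

lemma trig_poly_sum:
  "(\<And>i. i \<in> I \<Longrightarrow> f i \<in> trig_poly) \<Longrightarrow> (\<lambda>\<omega>. \<Sum>i\<in>I. f i \<omega>) \<in> trig_poly"
  by (induction I rule: infinite_finite_induct) (auto intro: trig_poly_add trig_poly_const)

text \<open>Product-to-sum formula: Re z Re w = Re (z w / 2) + Re (z cnj w / 2), where conjugating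
  the value of a character means passing to the opposite frequency.\<close>

lemma trig_poly_mult:
  assumes "f \<in> trig_poly" "g \<in> trig_poly" shows "(\<lambda>\<omega>. f \<omega> * g \<omega>) \<in> trig_poly"
proof -
  obtain S c S' c' where *: "\<forall>\<omega>\<in>bohr. f \<omega> = trig S c \<omega>" "\<forall>\<omega>\<in>bohr. g \<omega> = trig S' c' \<omega>"
    using assms by (auto simp: trig_poly_def)
  have "(\<lambda>\<omega>. \<Sum>\<xi>\<in>S. \<Sum>\<eta>\<in>S'. Re ((c \<xi> * c' \<eta> / 2) * \<omega> (\<xi> + \<eta>)) + Re ((c \<xi> * cnj (c' \<eta>) / 2) * \<omega> (\<xi> + - \<eta>)))
      \<in> trig_poly"
    by (intro trig_poly_sum trig_poly_add trig_poly_single)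
  then show ?thesis
  proof (rule trig_poly_cong)
    fix \<omega> :: "'a bohr_pt" assume \<omega>: "\<omega> \<in> bohr"
    have prod: "Re (z * w / 2) + Re (z * cnj w / 2) = Re z * Re w" for z w
      by (simp add: field_simps)
    have "Re ((c \<xi> * c' \<eta> / 2) * \<omega> (\<xi> + \<eta>)) + Re ((c \<xi> * cnj (c' \<eta>) / 2) * \<omega> (\<xi> + - \<eta>))
        = Re (c \<xi> * \<omega> \<xi>) * Re (c' \<eta> * \<omega> \<eta>)" for \<xi> \<eta>
      unfolding prod[symmetric] bohr_add[OF \<omega>] bohr_uminus[OF \<omega>]
      by (simp add: mult_ac)
    then show "(\<Sum>\<xi>\<in>S. \<Sum>\<eta>\<in>S'. Re ((c \<xi> * c' \<eta> / 2) * \<omega> (\<xi> + \<eta>)) +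
        Re ((c \<xi> * cnj (c' \<eta>) / 2) * \<omega> (\<xi> + - \<eta>))) = f \<omega> * g \<omega>"
      using * \<omega> by (simp add: trig_def sum_product)
  qed
qed

text \<open>This is the setting of the Stone-Weierstrass theorem. The consequence used below is
  \<open>trig_ring.two\<close>: for disjoint closed sets A and B there is a trigonometric polynomial
  with values in [0, 1] that lies below e on A and above 1 - e on B.\<close>

interpretation trig_ring: function_ring_on trig_poly bohr
proof
  show "continuous_on bohr f" if f: "f \<in> trig_poly" for f :: "'a bohr_pt \<Rightarrow> real"
  proof -
    obtain S c where *: "\<forall>\<omega>\<in>bohr. f \<omega> = trig S c \<omega>" using f unfolding trig_poly_def mem_Collect_eq by blast
    have "continuous_on bohr (trig S c)" using continuous_on_trig[OF continuous_on_id] by simp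
    then show ?thesis using * by (simp cong: continuous_on_cong)
  qed
  show "\<exists>f\<in>trig_poly. f x \<noteq> f y" if xy: "x \<noteq> y" for x y :: "'a bohr_pt"
  proof -
    obtain \<xi> where \<xi>: "x \<xi> \<noteq> y \<xi>" using xy by auto
    show ?thesis
    proof (cases "Re (x \<xi>) = Re (y \<xi>)")
      case False
      then show ?thesis using trig_poly_single[of 1 \<xi>] by (intro bexI) auto
    next
      case True
      \<comment> \<open>The coefficient - \<i> turns the real part into the imaginary part.\<close>
      then show ?thesis using \<xi> trig_poly_single[of "- \<i>" \<xi>]
        by (intro bexI[of _ "\<lambda>\<omega>. Re (- \<i> * \<omega> \<xi>)"]) (auto simp: complex_eq_iff)
    qed
  qed
qed (auto intro: compact_bohr trig_poly_add trig_poly_mult trig_poly_const)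

section \<open>Kernels that depend on x y^-1 only\<close>

definition kern :: "(real^'d) set \<Rightarrow> (real^'d \<Rightarrow> complex) \<Rightarrow> 'd::finite bohr_pt \<Rightarrow> 'd bohr_pt \<Rightarrow> real" where
  "kern S k x y = (\<Sum>\<xi>\<in>S. Re (k \<xi> * x \<xi> * cnj (y \<xi>)))"

lemma kern_eq_trig: "kern S k x y = trig S k (\<lambda>\<xi>. x \<xi> * cnj (y \<xi>))"
  by (simp add: kern_def trig_def mult.assoc)

text \<open>Freezing either variable, here y and in the next lemma x, leaves a trigonometric
  polynomial in the other one; this is what makes the kernel admissible as a test function for each
  solution.\<close>

lemma kern_eq_trig_fst: "kern S k x y = trig S (\<lambda>\<xi>. k \<xi> * cnj (y \<xi>)) x"
  by (simp add: kern_def trig_def mult_ac)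

lemma kern_eq_trig_snd: "kern S k x y = trig S (\<lambda>\<xi>. cnj (k \<xi> * x \<xi>)) y"
  unfolding kern_def trig_def by (intro sum.cong refl) (simp add: algebra_simps)

lemma kern_bound:
  assumes "x \<in> bohr" "y \<in> bohr" shows "\<bar>kern S k x y\<bar> \<le> (\<Sum>\<xi>\<in>S. cmod (k \<xi>))"
  unfolding kern_def
proof (rule order_trans[OF sum_abs], rule sum_mono)
  show "\<bar>Re (k \<xi> * x \<xi> * cnj (y \<xi>))\<bar> \<le> cmod (k \<xi>)" for \<xi>
    using abs_Re_le_cmod[of "k \<xi> * x \<xi> * cnj (y \<xi>)"] assms by (simp add: norm_mult bohr_norm)
qed

subsection \<open>Haar measure on the Bohr compactification\<close>

context
  fixes m :: "'d::finite bohr_pt measure"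
  assumes haar: "haar_measure m"
begin

lemma haar_space: "space m = bohr"
  using haar by (simp add: haar_measure_def)

lemma haar_sets: "sets m = sets (restrict_space borel bohr)"
  using haar by (simp add: haar_measure_def)

lemma haar_prob_space: "emeasure m (space m) = 1" "finite_measure m" "sigma_finite_measure m"
proof -
  show "emeasure m (space m) = 1" using haar unfolding haar_measure_def by blast
  then show "finite_measure m" by (intro finite_measureI) simp
  then show "sigma_finite_measure m" by (rule finite_measure.axioms)
qed

lemma haar_measure_space: "measure m (space m) = 1"
  using haar_prob_space(1) by (simp add: measure_def)

lemma haar_measurable_continuous:
  fixes f :: "'d bohr_pt \<Rightarrow> 'b::topological_space"
  assumes "continuous_on bohr f" shows "f \<in> borel_measurable m"
  using borel_measurable_continuous_on_restrict[OF assms] measurable_cong_sets[OF haar_sets refl] by blast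

lemma haar_measurable_coord [measurable]: "(\<lambda>\<omega>. \<omega> \<xi>) \<in> borel_measurable m"
  by (rule haar_measurable_continuous) (rule continuous_on_coord)

lemma haar_integrable_continuous:
  fixes f :: "'d bohr_pt \<Rightarrow> real"
  assumes "continuous_on bohr f" shows "integrable m f"
proof -
  obtain B where "\<And>x. x \<in> bohr \<Longrightarrow> norm (f x) \<le> B"
    using compact_imp_bounded[OF compact_continuous_image[OF assms compact_bohr]]
    by (auto simp: bounded_iff)
  then show ?thesis
    using haar_measurable_continuous[OF assms]
    by (intro finite_measure.integrable_const_bound[OF haar_prob_space(2), where B = B])
      (auto simp: haar_space)
qed

text \<open>That compact sets are closed, hence Borel, rests on the \<open>t2_space\<close> instance
  for functions.\<close>

lemma haar_sets_compact: "compact C \<Longrightarrow> C \<subseteq> bohr \<Longrightarrow> C \<in> sets m"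
  unfolding haar_sets sets_restrict_space
  by (rule image_eqI[of _ _ C]) (auto intro!: borel_closed compact_imp_closed)

lemma haar_translate_measurable:
  assumes "g \<in> bohr" shows "(\<lambda>\<omega> \<xi>. g \<xi> * \<omega> \<xi>) \<in> measurable m m"
proof -
  have "(\<lambda>\<omega> \<xi>. g \<xi> * \<omega> \<xi>) \<in> borel_measurable m"
    by (intro haar_measurable_continuous continuous_on_coordinatewise_then_product
        continuous_intros continuous_on_coord)
  then show ?thesis
    unfolding measurable_cong_sets[OF refl haar_sets]
    by (intro measurable_restrict_space2) (auto simp: haar_space bohr_mult[OF assms])
qed

lemma haar_translate_distr:
  assumes "g \<in> bohr" shows "distr m m (\<lambda>\<omega> \<xi>. g \<xi> * \<omega> \<xi>) = m"
proof (rule measure_eqI)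
  fix A assume "A \<in> sets (distr m m (\<lambda>\<omega> \<xi>. g \<xi> * \<omega> \<xi>))"
  then have A: "A \<in> sets m" by simp
  then show "emeasure (distr m m (\<lambda>\<omega> \<xi>. g \<xi> * \<omega> \<xi>)) A = emeasure m A"
    using haar assms haar_translate_measurable[OF assms]
    by (simp add: emeasure_distr haar_measure_def)
qed simp

lemma haar_translate_integral:
  fixes f :: "'d bohr_pt \<Rightarrow> 'b::{banach, second_countable_topology}"
  assumes "g \<in> bohr" "f \<in> borel_measurable m"
  shows "(\<integral>\<omega>. f (\<lambda>\<xi>. g \<xi> * \<omega> \<xi>) \<partial>m) = (\<integral>\<omega>. f \<omega> \<partial>m)"
  using integral_distr[OF haar_translate_measurable[OF assms(1)] assms(2)]
    haar_translate_distr[OF assms(1)] by simp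

text \<open>Invariance multiplies the integral by g(\<xi>) for every g in the group, so one g with
  g(\<xi>) \<noteq> 1 is enough. The point z = (\<pi> / |\<xi>|^2) \<xi> of R^d has \<xi>.z = \<pi>
  and gives g(\<xi>) = -1.\<close>

lemma haar_integral_character:
  assumes "\<xi> \<noteq> 0" shows "(\<integral>\<omega>. \<omega> \<xi> \<partial>m) = 0"
proof -
  define g :: "'d bohr_pt" where "g = (\<lambda>\<zeta>. cis (\<zeta> \<bullet> ((pi / (\<xi> \<bullet> \<xi>)) *\<^sub>R \<xi>)))"
  have g: "g \<in> bohr" unfolding g_def by (rule bohr_point)
  have "g \<xi> = -1" using assms by (simp add: g_def)
  moreover have "(\<integral>\<omega>. g \<xi> * \<omega> \<xi> \<partial>m) = (\<integral>\<omega>. \<omega> \<xi> \<partial>m)"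
    using haar_translate_integral[OF g, of "\<lambda>\<omega>. \<omega> \<xi>"] by simp
  ultimately have "- (\<integral>\<omega>. \<omega> \<xi> \<partial>m) = (\<integral>\<omega>. \<omega> \<xi> \<partial>m)" by simp
  then show ?thesis by (simp add: neg_equal_zero)
qed

lemma haar_integrable_coord: "integrable m (\<lambda>\<omega>. \<omega> \<xi>)"
  by (rule finite_measure.integrable_const_bound[OF haar_prob_space(2), where B = 1])
    (auto simp: haar_space bohr_norm)

lemma haar_integral_Re:
  "(\<integral>\<omega>. Re (c * \<omega> \<xi>) \<partial>m) = (if \<xi> = 0 then Re c else 0)"
proof (cases "\<xi> = 0")
  case True
  have "(\<integral>\<omega>. Re (c * \<omega> \<xi>) \<partial>m) = (\<integral>\<omega>. Re c \<partial>m)"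
    using True by (intro Bochner_Integration.integral_cong) (auto simp: haar_space bohr_zero)
  then show ?thesis using True haar_measure_space by simp
next
  case False
  have "(\<integral>\<omega>. Re (c * \<omega> \<xi>) \<partial>m) = Re (c * (\<integral>\<omega>. \<omega> \<xi> \<partial>m))"
    using haar_integrable_coord by simp
  then show ?thesis using False haar_integral_character by simp
qed

lemma haar_integral_trig:
  assumes "finite S" shows "(\<integral>\<omega>. trig S c \<omega> \<partial>m) = (if 0 \<in> S then Re (c 0) else 0)"
proof -
  have "(\<integral>\<omega>. trig S c \<omega> \<partial>m) = (\<Sum>\<xi>\<in>S. \<integral>\<omega>. Re (c \<xi> * \<omega> \<xi>) \<partial>m)"
    unfolding trig_def using haar_integrable_coord by (intro Bochner_Integration.integral_sum) auto
  also have "\<dots> = (if 0 \<in> S then Re (c 0) else 0)"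
    unfolding haar_integral_Re using assms by simp
  finally show ?thesis .
qed

lemma haar_integrable_trig: "integrable m (trig S c)"
  unfolding trig_def using haar_integrable_coord by auto

lemma trig_measurable [measurable]: "trig S c \<in> borel_measurable m"
  using haar_integrable_trig by auto

lemma kern_measurable [measurable]: "(\<lambda>z. kern S k (fst z) (snd z)) \<in> borel_measurable (m \<Otimes>\<^sub>M m)"
proof -
  have [measurable]: "(\<lambda>z. fst z \<xi>) \<in> borel_measurable (m \<Otimes>\<^sub>M m)"
    "(\<lambda>z. snd z \<xi>) \<in> borel_measurable (m \<Otimes>\<^sub>M m)" for \<xi>
    using measurable_compose[OF measurable_fst haar_measurable_coord]
      measurable_compose[OF measurable_snd haar_measurable_coord] by auto
  show ?thesis unfolding kern_def times_complex.simps cnj.simps by measurable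
qed

text \<open>Nontrivial characters integrate to 0, so only frequency 0 survives. A derivative
  multiplies the coefficients by \<i> \<xi>_j and kills that frequency, which is why kernel
  derivatives have mean zero.\<close>

lemma haar_integral_kern:
  assumes "finite S" "x \<in> bohr"
  shows "(\<integral>y. kern S k x y \<partial>m) = (if 0 \<in> S then Re (k 0) else 0)"
    "(\<integral>y. kern S k y x \<partial>m) = (if 0 \<in> S then Re (k 0) else 0)"
  using haar_integral_trig[OF assms(1)] bohr_zero[OF assms(2)]
  unfolding kern_eq_trig_snd[of S k x] kern_eq_trig_fst[of S k _ x] by auto

text \<open>For the indicator of A, inner regularity of A and of its complement gives disjoint
  compact sets that carry almost all the mass, and \<open>trig_ring.two\<close> separates them. Sums
  and dominated limits extend this to integrable functions.\<close>

lemma trig_poly_L1_dense: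
  fixes f :: "'d bohr_pt \<Rightarrow> real"
  assumes "integrable m f" "0 < e"
  shows "\<exists>p\<in>trig_poly. (\<integral>\<omega>. \<bar>f \<omega> - p \<omega>\<bar> \<partial>m) < e"
  using assms
proof (induction arbitrary: e rule: integrable_induct)
  case (base A c)
  interpret finite_measure m by (rule haar_prob_space)
  \<comment> \<open>Three errors of size e' arise, one uniform and two from exceptional sets, each
    with a factor of at most |c| + 1. The 4 leaves room for a strict inequality, and the + 1 keeps
    the divisor positive when c = 0.\<close>
  define e' where "e' = min (1/2) (e / (4 * (\<bar>c\<bar> + 1)))"
  have e': "0 < e'" "e' < 1" "e' \<le> e / (4 * (\<bar>c\<bar> + 1))" using base by (auto simp: e'_def)
  have inner: "\<exists>C. compact C \<and> C \<subseteq> B \<and> measure m (B - C) < e'" if B: "B \<in> sets m" for B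
  \<comment> \<open>If B is already small, the empty set serves; otherwise
    \<open>measure m B - e'\<close> is nonnegative and survives the passage to
    \<open>ennreal\<close>.\<close>
  proof (cases "measure m B < e'")
    case True then show ?thesis by (intro exI[of _ "{}"]) auto
  next
    case False
    have "ennreal (measure m B - e') < emeasure m B"
      using False e' by (simp add: emeasure_eq_measure ennreal_lessI)
    also have "emeasure m B = (SUP K\<in>{K. compact K \<and> K \<subseteq> B}. emeasure m K)"
      using haar B by (simp add: haar_measure_def)
    finally obtain C where C: "compact C" "C \<subseteq> B" "ennreal (measure m B - e') < emeasure m C"
      unfolding less_SUP_iff by auto
    have CB: "C \<in> sets m"
      using haar_sets_compact[OF C(1)] C(2) sets.sets_into_space[OF B] by (auto simp: haar_space)
    have "measure m B - e' < measure m C"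
      using C(3) False by (simp add: emeasure_eq_measure ennreal_less_iff)
    then have "measure m (B - C) < e'"
      using finite_measure_Diff[OF B CB C(2)] by simp
    then show ?thesis using C by blast
  qed
  have A: "A \<in> sets m" "bohr - A \<in> sets m" "A \<subseteq> bohr"
    using base sets.compl_sets[of A m] sets.sets_into_space[of A m] by (auto simp: haar_space)
  obtain C1 where C1: "compact C1" "C1 \<subseteq> A" "measure m (A - C1) < e'" using inner[OF A(1)] by blast
  obtain C2 where C2: "compact C2" "C2 \<subseteq> bohr - A" "measure m ((bohr - A) - C2) < e'"
    using inner[OF A(2)] by blast
  obtain p where p: "p \<in> trig_poly" "p ` bohr \<subseteq> {0..1}" "\<forall>x\<in>C2. p x < e'" "\<forall>x\<in>C1. p x > 1 - e'"
  proof -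
    have "C2 \<inter> C1 = {}" "C1 \<subseteq> bohr" "C2 \<subseteq> bohr" using C1 C2 A by auto
    with trig_ring.two[of C2 C1 e'] compact_imp_closed[OF C1(1)] compact_imp_closed[OF C2(1)] e'
    show ?thesis using that by auto
  qed
  have C12: "C1 \<in> sets m" "C2 \<in> sets m"
    using C1 C2 A haar_sets_compact[OF C1(1)] haar_sets_compact[OF C2(1)] by auto
  have pc: "continuous_on bohr p" using trig_ring.continuous[OF p(1)] .
  have pm [measurable]: "p \<in> borel_measurable m" using haar_measurable_continuous[OF pc] .
  have pi: "integrable m p" using haar_integrable_continuous[OF pc] .
  note [measurable] = A(1,2) C12
  have le: "\<bar>indicator A x *\<^sub>R c - c * p x\<bar> \<le>
      (\<bar>c\<bar> + 1) * (e' + indicator (A - C1) x + indicator ((bohr - A) - C2) x)" if "x \<in> bohr" for x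
  proof -
    have px: "0 \<le> p x" "p x \<le> 1" using p(2) that by auto
    have "\<bar>indicator A x - p x\<bar> \<le> e' + indicator (A - C1) x + indicator ((bohr - A) - C2) x"
      using px p(3,4) that C1(2) C2(2) e' by (fastforce simp: indicator_def)
    then have "\<bar>c\<bar> * \<bar>indicator A x - p x\<bar> \<le> \<bar>c\<bar> * (e' + indicator (A - C1) x + indicator ((bohr - A) - C2) x)"
      by (intro mult_left_mono) auto
    also have "\<dots> \<le> (\<bar>c\<bar> + 1) * (e' + indicator (A - C1) x + indicator ((bohr - A) - C2) x)"
      using e' by (intro mult_right_mono) auto
    finally show ?thesis by (simp add: abs_mult[symmetric] algebra_simps)
  qed
  have "(\<integral>x. \<bar>indicator A x *\<^sub>R c - c * p x\<bar> \<partial>m) \<le>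
      (\<integral>x. (\<bar>c\<bar> + 1) * (e' + indicator (A - C1) x + indicator ((bohr - A) - C2) x) \<partial>m)"
    using le pi A C12
    by (intro integral_mono integrable_abs Bochner_Integration.integrable_diff integrable_mult_right
        Bochner_Integration.integrable_add integrable_real_indicator)
       (auto simp: haar_space less_top[symmetric] emeasure_eq_measure)
  also have "\<dots> = (\<bar>c\<bar> + 1) * (e' + measure m (A - C1) + measure m ((bohr - A) - C2))"
    using A C12 haar_measure_space
    by (simp add: haar_space less_top[symmetric] emeasure_eq_measure Int_absorb2 Diff_subset subset_trans[OF Diff_subset])
  also have "\<dots> < (\<bar>c\<bar> + 1) * (4 * e')"
    using C1(3) C2(3) e'(1) by (intro mult_strict_left_mono) auto
  also have "\<dots> \<le> e" using e'(3) by (simp add: field_simps)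
  finally show ?case
    using trig_poly_mult[OF trig_poly_const p(1), of c] by (intro bexI[of _ "\<lambda>x. c * p x"]) auto
next
  case (add f g)
  obtain p q where pq: "p \<in> trig_poly" "(\<integral>\<omega>. \<bar>f \<omega> - p \<omega>\<bar> \<partial>m) < e/2"
    "q \<in> trig_poly" "(\<integral>\<omega>. \<bar>g \<omega> - q \<omega>\<bar> \<partial>m) < e/2"
    using add.IH(1)[of "e/2"] add.IH(2)[of "e/2"] add.prems by auto
  have int: "integrable m (\<lambda>x. \<bar>f x - p x\<bar>)" "integrable m (\<lambda>x. \<bar>g x - q x\<bar>)"
    using add.hyps haar_integrable_continuous[OF trig_ring.continuous[OF pq(1)]]
      haar_integrable_continuous[OF trig_ring.continuous[OF pq(3)]] by auto
  have "(\<integral>\<omega>. \<bar>(f \<omega> + g \<omega>) - (p \<omega> + q \<omega>)\<bar> \<partial>m) \<le> (\<integral>\<omega>. \<bar>f \<omega> - p \<omega>\<bar> + \<bar>g \<omega> - q \<omega>\<bar> \<partial>m)"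
    using int by (intro Bochner_Integration.integral_mono' Bochner_Integration.integrable_add) auto
  also have "\<dots> < e" using int pq by simp
  finally show ?case using trig_poly_add[OF pq(1,3)] by (intro bexI) auto
next
  case (lim f s)
  have sf: "integrable m (s i)" for i using lim by auto
  have "(\<lambda>i. \<integral>x. \<bar>f x - s i x\<bar> \<partial>m) \<longlonglongrightarrow> (\<integral>x. 0 \<partial>m)"
  proof (rule integral_dominated_convergence[where w = "\<lambda>x. 3 * \<bar>f x\<bar>"])
    show "integrable m (\<lambda>x. 3 * \<bar>f x\<bar>)" using lim by auto
    show "AE x in m. (\<lambda>i. \<bar>f x - s i x\<bar>) \<longlonglongrightarrow> 0"
    proof (rule AE_I2)
      fix x assume "x \<in> space m"
      then have "(\<lambda>i. s i x) \<longlonglongrightarrow> f x" by (rule lim)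
      then have "(\<lambda>i. \<bar>f x - s i x\<bar>) \<longlonglongrightarrow> \<bar>f x - f x\<bar>" by (intro tendsto_intros)
      then show "(\<lambda>i. \<bar>f x - s i x\<bar>) \<longlonglongrightarrow> 0" by simp
    qed
    show "AE x in m. norm \<bar>f x - s i x\<bar> \<le> 3 * \<bar>f x\<bar>" for i
    proof (rule AE_I2)
      fix x assume "x \<in> space m"
      then have "norm (s i x) \<le> 2 * norm (f x)" by (rule lim)
      then show "norm \<bar>f x - s i x\<bar> \<le> 3 * \<bar>f x\<bar>" by simp
    qed
  qed (use lim in auto)
  then have "\<forall>\<^sub>F i in sequentially. (\<integral>x. \<bar>f x - s i x\<bar> \<partial>m) < e/2"
    using lim.prems by (intro order_tendstoD) auto
  then obtain i where i: "(\<integral>x. \<bar>f x - s i x\<bar> \<partial>m) < e/2"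
    by (auto simp: eventually_sequentially)
  obtain p where p: "p \<in> trig_poly" "(\<integral>\<omega>. \<bar>s i \<omega> - p \<omega>\<bar> \<partial>m) < e/2"
    using lim.IH[of "e/2" i] lim.prems by auto
  have int: "integrable m (\<lambda>x. \<bar>f x - s i x\<bar>)" "integrable m (\<lambda>x. \<bar>s i x - p x\<bar>)"
    using lim.hyps sf haar_integrable_continuous[OF trig_ring.continuous[OF p(1)]] by auto
  have "(\<integral>\<omega>. \<bar>f \<omega> - p \<omega>\<bar> \<partial>m) \<le> (\<integral>\<omega>. \<bar>f \<omega> - s i \<omega>\<bar> + \<bar>s i \<omega> - p \<omega>\<bar> \<partial>m)"
    using int by (intro Bochner_Integration.integral_mono' Bochner_Integration.integrable_add) auto
  also have "\<dots> < e" using int i p by simp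
  finally show ?case using p by auto
qed

text \<open>Finitely many translates of U cover the compact group, and by invariance all have the
  measure of U; a null U would make the whole group null.\<close>

lemma haar_nbhd_pos:
  assumes "open U" "(\<lambda>\<xi>. 1) \<in> U" shows "0 < measure m (bohr \<inter> U)"
proof (rule ccontr)
  interpret finite_measure m by (rule haar_prob_space)
  assume "\<not> 0 < measure m (bohr \<inter> U)"
  then have zero: "emeasure m (bohr \<inter> U) = 0"
    using measure_nonneg[of m "bohr \<inter> U"] by (simp add: emeasure_eq_measure)
  have Um: "bohr \<inter> U \<in> sets m"
    using assms by (auto simp: haar_sets sets_restrict_space)
  define V where "V = (\<lambda>g::'d bohr_pt. (\<lambda>\<omega> \<xi>. g \<xi> * \<omega> \<xi>) -` U)"
  have "open (V g)" for g
    unfolding V_def using assms(1)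
    by (intro open_vimage continuous_on_coordinatewise_then_product
        continuous_intros continuous_on_product_coordinates)
  moreover have "bohr \<subseteq> (\<Union>g\<in>bohr. V g)"
  proof
    fix \<omega> :: "'d bohr_pt" assume \<omega>: "\<omega> \<in> bohr"
    have "(\<lambda>\<xi>. cnj (\<omega> \<xi>) * \<omega> \<xi>) = (\<lambda>\<xi>. 1)"
      using bohr_mult_cnj[OF \<omega>] by (simp add: mult.commute)
    then have "\<omega> \<in> V (\<lambda>\<xi>. cnj (\<omega> \<xi>))" using assms(2) by (simp add: V_def)
    then show "\<omega> \<in> (\<Union>g\<in>bohr. V g)" using bohr_cnj[OF \<omega>] by blast
  qed
  ultimately obtain F where F: "F \<subseteq> bohr" "finite F" "bohr \<subseteq> (\<Union>g\<in>F. V g)"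
    using compactE_image[OF compact_bohr, of bohr V] by metis
  have Vm: "bohr \<inter> V g \<in> null_sets m" if "g \<in> F" for g
  proof -
    have g: "g \<in> bohr" using that F by auto
    have eq: "bohr \<inter> V g = (\<lambda>\<omega> \<xi>. g \<xi> * \<omega> \<xi>) -` (bohr \<inter> U) \<inter> bohr"
      using bohr_mult[OF g] by (auto simp: V_def)
    have "emeasure m (bohr \<inter> V g) = emeasure m (bohr \<inter> U)"
      unfolding eq using haar g Um unfolding haar_measure_def by blast
    moreover have "bohr \<inter> V g \<in> sets m"
      unfolding eq using measurable_sets[OF haar_translate_measurable[OF g] Um] by (simp add: haar_space)
    ultimately show ?thesis using zero by auto
  qed
  have "(\<Union>g\<in>F. bohr \<inter> V g) \<in> null_sets m" using F(2) Vm by (intro null_sets_UN') (auto intro: countable_finite)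
  moreover have "(\<Union>g\<in>F. bohr \<inter> V g) = space m" using F(3) by (auto simp: haar_space)
  ultimately show False using haar_prob_space(1) by auto
qed

text \<open>Replaces kernels supported in shrinking neighbourhoods: concentration is measured by a
  single continuous D that vanishes at the identity. A polynomial close to 1 where D is small and
  close to 0 where D is at least \<epsilon>/2 is divided by its integral, which is positive because
  neighbourhoods of the identity have positive measure.\<close>

lemma trig_poly_approximate_unit:
  assumes D: "continuous_on bohr D" "\<And>\<omega>. \<omega> \<in> bohr \<Longrightarrow> 0 \<le> D \<omega>" "D (\<lambda>\<xi>. 1) = 0" and "0 < \<epsilon>"
  shows "\<exists>K\<in>trig_poly. (\<forall>\<omega>\<in>bohr. 0 \<le> K \<omega>) \<and> (\<integral>\<omega>. K \<omega> \<partial>m) = 1 \<and> (\<integral>\<omega>. D \<omega> * K \<omega> \<partial>m) < \<epsilon>"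
proof -
  interpret finite_measure m by (rule haar_prob_space)
  obtain M where M: "\<And>\<omega>. \<omega> \<in> bohr \<Longrightarrow> D \<omega> \<le> M" "0 < M"
  proof -
    obtain B where "\<And>x. x \<in> bohr \<Longrightarrow> norm (D x) \<le> B"
      using compact_imp_bounded[OF compact_continuous_image[OF D(1) compact_bohr]]
      by (auto simp: bounded_iff)
    then show ?thesis by (intro that[of "\<bar>B\<bar> + 1"]) (force)+
  qed
  obtain U where U: "open U" "{\<omega>\<in>bohr. D \<omega> < \<epsilon>/4} = bohr \<inter> U"
  proof -
    have "openin (top_of_set bohr) (bohr \<inter> D -` {..<\<epsilon>/4})"
      using D(1) by (intro continuous_openin_preimage_gen) auto
    moreover have "bohr \<inter> D -` {..<\<epsilon>/4} = {\<omega>\<in>bohr. D \<omega> < \<epsilon>/4}" by auto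
    ultimately show ?thesis using that by (auto simp: openin_open)
  qed
  define \<mu> where "\<mu> = measure m (bohr \<inter> U)"
  have "(\<lambda>\<xi>. 1) \<in> bohr \<inter> U" using D(3) \<open>0 < \<epsilon>\<close> bohr_one unfolding U(2)[symmetric] by auto
  then have \<mu>: "0 < \<mu>" unfolding \<mu>_def using haar_nbhd_pos[OF U(1)] by auto
  have Um: "bohr \<inter> U \<in> sets m" using U by (auto simp: haar_sets sets_restrict_space)
  \<comment> \<open>e \<le> 1/2 makes p at least 1/2 on U, so its integral I is at least \<mu>/2.
    The other bound makes M e, the share of the region where D \<ge> \<epsilon>/2, at most
    \<epsilon> I / 4.\<close>
  define e where "e = min (1/2) (\<epsilon> * \<mu> / (8 * M))"
  have e: "0 < e" "e < 1" "e \<le> 1/2" "e \<le> \<epsilon> * \<mu> / (8 * M)" using \<mu> M \<open>0 < \<epsilon>\<close> by (auto simp: e_def)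
  have cl: "closed {\<omega>\<in>bohr. \<epsilon>/2 \<le> D \<omega>}" "closed {\<omega>\<in>bohr. D \<omega> \<le> \<epsilon>/4}"
    by (intro continuous_on_closed_Collect_le continuous_on_const D(1) compact_imp_closed[OF compact_bohr])+
  obtain p where p: "p \<in> trig_poly" "p ` bohr \<subseteq> {0..1}" "\<forall>x\<in>{\<omega>\<in>bohr. \<epsilon>/2 \<le> D \<omega>}. p x < e"
      "\<forall>x\<in>{\<omega>\<in>bohr. D \<omega> \<le> \<epsilon>/4}. p x > 1 - e"
  proof -
    have "{\<omega>\<in>bohr. \<epsilon>/2 \<le> D \<omega>} \<inter> {\<omega>\<in>bohr. D \<omega> \<le> \<epsilon>/4} = {}" using \<open>0 < \<epsilon>\<close> by auto
    from trig_ring.two[OF cl(1) _ cl(2) _ this e(1,2)] show ?thesis using that by auto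
  qed
  have pc: "continuous_on bohr p" using trig_ring.continuous[OF p(1)] .
  have pi: "integrable m p" using haar_integrable_continuous[OF pc] .
  have Dpi: "integrable m (\<lambda>\<omega>. D \<omega> * p \<omega>)"
    using haar_integrable_continuous[of "\<lambda>\<omega>. D \<omega> * p \<omega>"] D(1) pc by (auto intro!: continuous_intros)
  define I where "I = (\<integral>\<omega>. p \<omega> \<partial>m)"
  have "(\<integral>\<omega>. (1/2) * indicator (bohr \<inter> U) \<omega> \<partial>m) \<le> I"
    unfolding I_def
  proof (rule integral_mono)
    show "integrable m (\<lambda>\<omega>. (1/2::real) * indicator (bohr \<inter> U) \<omega>)"
      using Um by (auto simp: less_top[symmetric] emeasure_eq_measure)
    show "(1/2) * indicator (bohr \<inter> U) \<omega> \<le> p \<omega>" if "\<omega> \<in> space m" for \<omega>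
    proof (cases "\<omega> \<in> bohr \<inter> U")
      case True
      then have "\<omega> \<in> {\<omega>\<in>bohr. D \<omega> < \<epsilon>/4}" using U(2) by simp
      then have "p \<omega> > 1 - e" using p(4) by auto
      then show ?thesis using True e by auto
    next
      case False then show ?thesis using p(2) that by (auto simp: haar_space)
    qed
  qed (rule pi)
  then have I: "\<mu> / 2 \<le> I" "0 < I" using Um \<mu> by (auto simp: \<mu>_def)
  have "(\<integral>\<omega>. D \<omega> * p \<omega> \<partial>m) \<le> (\<integral>\<omega>. (\<epsilon>/2) * p \<omega> + M * e \<partial>m)"
  proof (rule integral_mono[OF Dpi])
    show "integrable m (\<lambda>\<omega>. (\<epsilon>/2) * p \<omega> + M * e)" using pi by auto
    fix \<omega> assume "\<omega> \<in> space m"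
    then have \<omega>: "\<omega> \<in> bohr" by (simp add: haar_space)
    have p01: "0 \<le> p \<omega>" using p(2) \<omega> by auto
    show "D \<omega> * p \<omega> \<le> (\<epsilon>/2) * p \<omega> + M * e"
    proof (cases "\<epsilon>/2 \<le> D \<omega>")
      case True
      then have "p \<omega> \<le> e" using p(3) \<omega> by auto
      then have "D \<omega> * p \<omega> \<le> M * e" using M(1)[OF \<omega>] M(2) p01 D(2)[OF \<omega>] by (intro mult_mono) auto
      then show ?thesis using p01 \<open>0 < \<epsilon>\<close> by (simp add: add_increasing)
    next
      case False
      then have "D \<omega> * p \<omega> \<le> (\<epsilon>/2) * p \<omega>" using p01 by (intro mult_right_mono) auto
      then show ?thesis using M(2) e(1) by (simp add: add_increasing2)
    qed
  qed
  also have "\<dots> = (\<epsilon>/2) * I + M * e" using pi haar_measure_space by (simp add: I_def)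
  also have "\<dots> < \<epsilon> * I"
  proof -
    have "M * e \<le> \<epsilon> * \<mu> / 8" using e(4) M(2) by (simp add: field_simps)
    also have "\<dots> \<le> \<epsilon> * I / 4" using I(1) \<open>0 < \<epsilon>\<close> by (simp add: field_simps)
    also have "\<dots> < \<epsilon> * I / 2" using I(2) \<open>0 < \<epsilon>\<close> by (simp add: field_simps)
    finally show ?thesis by simp
  qed
  finally have "(\<integral>\<omega>. D \<omega> * p \<omega> \<partial>m) / I < \<epsilon>" using I(2) by (simp add: field_simps)
  then have fin: "(\<integral>\<omega>. D \<omega> * (inverse I * p \<omega>) \<partial>m) < \<epsilon>"
    by (simp add: divide_inverse mult.left_commute[of _ "inverse I"] mult.commute)
  have "(\<integral>\<omega>. inverse I * p \<omega> \<partial>m) = 1" using I(2) by (simp add: I_def[symmetric])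
  moreover have "(\<lambda>\<omega>. inverse I * p \<omega>) \<in> trig_poly" using trig_poly_mult[OF trig_poly_const p(1)] .
  moreover have "\<forall>\<omega>\<in>bohr. 0 \<le> inverse I * p \<omega>" using I(2) p(2) by auto
  ultimately show ?thesis using fin by (intro bexI[of _ "\<lambda>\<omega>. inverse I * p \<omega>"] conjI)
qed

lemma haar_pair: "pair_sigma_finite m m"
  using haar_prob_space(3) by (simp add: pair_sigma_finite_def)

lemma haar_kern_integral:
  assumes "finite S" "integrable m g"
  shows "integrable (m \<Otimes>\<^sub>M m) (\<lambda>z. g (fst z) * kern S k (fst z) (snd z))"
    "integrable (m \<Otimes>\<^sub>M m) (\<lambda>z. g (snd z) * kern S k (fst z) (snd z))"
    "(\<integral>z. g (fst z) * kern S k (fst z) (snd z) \<partial>(m \<Otimes>\<^sub>M m)) = (\<integral>x. g x \<partial>m) * (if 0 \<in> S then Re (k 0) else 0)"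
    "(\<integral>z. g (snd z) * kern S k (fst z) (snd z) \<partial>(m \<Otimes>\<^sub>M m)) = (\<integral>x. g x \<partial>m) * (if 0 \<in> S then Re (k 0) else 0)"
proof -
  interpret pair_sigma_finite m m by (rule haar_pair)
  interpret finite_measure m by (rule haar_prob_space)
  have [measurable]: "g \<in> borel_measurable m" using assms by auto
  let ?C = "\<Sum>\<xi>\<in>S. cmod (k \<xi>)"
  have C: "0 \<le> ?C" by (intro sum_nonneg) auto
  show int: "integrable (m \<Otimes>\<^sub>M m) (\<lambda>z. g (fst z) * kern S k (fst z) (snd z))"
  proof (rule Bochner_Integration.integrable_bound)
    show "integrable (m \<Otimes>\<^sub>M m) (\<lambda>z. g (fst z) * (\<lambda>_. ?C) (snd z))"
      by (intro integrable_pair_times assms) simp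
    show "AE z in m \<Otimes>\<^sub>M m. norm (g (fst z) * kern S k (fst z) (snd z)) \<le> norm (g (fst z) * ?C)"
      using C by (intro AE_I2) (auto simp: abs_mult space_pair_measure haar_space intro!: mult_left_mono kern_bound)
  qed simp
  show int': "integrable (m \<Otimes>\<^sub>M m) (\<lambda>z. g (snd z) * kern S k (fst z) (snd z))"
  proof (rule Bochner_Integration.integrable_bound)
    show "integrable (m \<Otimes>\<^sub>M m) (\<lambda>z. (\<lambda>_. ?C) (fst z) * g (snd z))"
      by (intro integrable_pair_times assms) simp
    show "AE z in m \<Otimes>\<^sub>M m. norm (g (snd z) * kern S k (fst z) (snd z)) \<le> norm (?C * g (snd z))"
      using C by (subst mult.commute[of ?C], intro AE_I2)
        (auto simp: abs_mult space_pair_measure haar_space intro!: mult_left_mono kern_bound)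
  qed simp
  have "(\<integral>z. g (fst z) * kern S k (fst z) (snd z) \<partial>(m \<Otimes>\<^sub>M m)) = (\<integral>x. \<integral>y. g x * kern S k x y \<partial>m \<partial>m)"
    using integral_fst'[OF int] by simp
  also have "\<dots> = (\<integral>x. g x * (if 0 \<in> S then Re (k 0) else 0) \<partial>m)"
    using haar_integral_kern[OF assms(1)]
    by (intro Bochner_Integration.integral_cong) (auto simp: haar_space)
  finally show "(\<integral>z. g (fst z) * kern S k (fst z) (snd z) \<partial>(m \<Otimes>\<^sub>M m)) = (\<integral>x. g x \<partial>m) * (if 0 \<in> S then Re (k 0) else 0)"
    by simp
  have "(\<integral>z. g (snd z) * kern S k (fst z) (snd z) \<partial>(m \<Otimes>\<^sub>M m)) = (\<integral>y. \<integral>x. g y * kern S k x y \<partial>m \<partial>m)"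
    using integral_snd[of "\<lambda>x y. g y * kern S k x y"] int' by (simp add: case_prod_unfold)
  also have "\<dots> = (\<integral>x. g x * (if 0 \<in> S then Re (k 0) else 0) \<partial>m)"
    using haar_integral_kern[OF assms(1)]
    by (intro Bochner_Integration.integral_cong) (auto simp: haar_space)
  finally show "(\<integral>z. g (snd z) * kern S k (fst z) (snd z) \<partial>(m \<Otimes>\<^sub>M m)) = (\<integral>x. g x \<partial>m) * (if 0 \<in> S then Re (k 0) else 0)"
    by simp
qed

lemma haar_integrable_diff_kern:
  assumes "finite S" "integrable m f" "integrable m g"
  shows "integrable (m \<Otimes>\<^sub>M m) (\<lambda>z. \<bar>f (fst z) - g (snd z)\<bar> * kern S k (fst z) (snd z))"
proof -
  have [measurable]: "f \<in> borel_measurable m" "g \<in> borel_measurable m" using assms by auto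
  have "integrable (m \<Otimes>\<^sub>M m) (\<lambda>z. f (fst z) * kern S k (fst z) (snd z) - g (snd z) * kern S k (fst z) (snd z))"
    using assms by (intro Bochner_Integration.integrable_diff haar_kern_integral)
  then show ?thesis
    by (rule Bochner_Integration.integrable_bound) (auto simp: abs_mult left_diff_distrib[symmetric])
qed

text \<open>Takes the place of continuity of translations in L^1. For a trigonometric polynomial p,
  |p(x) - p(y)| is controlled by a function D of x y^-1 alone, continuous and zero at the identity,
  and the kernel is concentrated for this D. Replacing f by p costs the L^1 distance twice, since
  both marginals of the kernel are 1.\<close>

lemma haar_kernel_exists:
  fixes f :: "'d bohr_pt \<Rightarrow> real"
  assumes f: "integrable m f" and \<epsilon>: "0 < \<epsilon>"
  shows "\<exists>S k. finite S \<and> 0 \<in> S \<and> Re (k 0) = 1 \<and> (\<forall>x\<in>bohr. \<forall>y\<in>bohr. 0 \<le> kern S k x y) \<and>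
    (\<integral>z. \<bar>f (fst z) - f (snd z)\<bar> * kern S k (fst z) (snd z) \<partial>(m \<Otimes>\<^sub>M m)) < \<epsilon>"
proof -
  interpret pair_sigma_finite m m by (rule haar_pair)
  interpret finite_measure m by (rule haar_prob_space)
  obtain p where p: "p \<in> trig_poly" "(\<integral>\<omega>. \<bar>f \<omega> - p \<omega>\<bar> \<partial>m) < \<epsilon>/4"
    using trig_poly_L1_dense[OF f, of "\<epsilon>/4"] \<epsilon> by auto
  obtain S c where S: "finite S" "\<And>\<omega>. \<omega> \<in> bohr \<Longrightarrow> p \<omega> = trig S c \<omega>"
    using p(1) by (auto simp: trig_poly_def)
  define D :: "'d bohr_pt \<Rightarrow> real" where "D = (\<lambda>\<omega>. \<Sum>\<xi>\<in>S. cmod (c \<xi>) * cmod (1 - \<omega> \<xi>))"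
  have Dc: "continuous_on bohr D" unfolding D_def by (intro continuous_intros continuous_on_coord)
  have D0: "0 \<le> D \<omega>" "D (\<lambda>\<xi>. 1) = 0" for \<omega> by (auto simp: D_def intro!: sum_nonneg)
  obtain K where K: "K \<in> trig_poly" "\<forall>\<omega>\<in>bohr. 0 \<le> K \<omega>" "(\<integral>\<omega>. K \<omega> \<partial>m) = 1" "(\<integral>\<omega>. D \<omega> * K \<omega> \<partial>m) < \<epsilon>/2"
    using trig_poly_approximate_unit[OF Dc D0, of "\<epsilon>/2"] \<epsilon> by auto
  obtain S' k where S': "finite S'" "\<And>\<omega>. \<omega> \<in> bohr \<Longrightarrow> K \<omega> = trig S' k \<omega>"
    using K(1) by (auto simp: trig_poly_def)
  have kK: "kern S' k x y = K (\<lambda>\<xi>. x \<xi> * cnj (y \<xi>))" if "x \<in> bohr" "y \<in> bohr" for x y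
    using S'(2)[OF bohr_mult[OF that(1) bohr_cnj[OF that(2)]]] by (simp add: kern_eq_trig)
  have k0: "0 \<le> kern S' k x y" if "x \<in> bohr" "y \<in> bohr" for x y
    unfolding kK[OF that] using K(2) bohr_mult[OF that(1) bohr_cnj[OF that(2)]] by blast
  have "(\<integral>\<omega>. K \<omega> \<partial>m) = (\<integral>\<omega>. trig S' k \<omega> \<partial>m)"
    using S'(2) by (intro Bochner_Integration.integral_cong) (auto simp: haar_space)
  then have mean: "(if 0 \<in> S' then Re (k 0) else 0) = 1" using haar_integral_trig[OF S'(1)] K(3) by simp
  have pi: "integrable m p" using haar_integrable_continuous[OF trig_ring.continuous[OF p(1)]] .
  have [measurable]: "f \<in> borel_measurable m" "p \<in> borel_measurable m" using f pi by auto
  have [measurable]: "(\<lambda>z. fst z \<xi>) \<in> borel_measurable (m \<Otimes>\<^sub>M m)"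
    "(\<lambda>z. cnj (snd z \<xi>)) \<in> borel_measurable (m \<Otimes>\<^sub>M m)" for \<xi>
  proof -
    show "(\<lambda>z. fst z \<xi>) \<in> borel_measurable (m \<Otimes>\<^sub>M m)"
      using measurable_compose[OF measurable_fst haar_measurable_coord] .
    have "cnj \<in> borel_measurable borel"
      by (intro borel_measurable_continuous_onI continuous_intros)
    then show "(\<lambda>z. cnj (snd z \<xi>)) \<in> borel_measurable (m \<Otimes>\<^sub>M m)"
      using measurable_compose[OF measurable_compose[OF measurable_snd haar_measurable_coord]] by blast
  qed
  have dist: "\<bar>p x - p y\<bar> \<le> D (\<lambda>\<xi>. x \<xi> * cnj (y \<xi>))" if xy: "x \<in> bohr" "y \<in> bohr" for x y
  proof -
    have "\<bar>p x - p y\<bar> = \<bar>\<Sum>\<xi>\<in>S. Re (c \<xi> * (x \<xi> - y \<xi>))\<bar>"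
      using S(2) xy by (simp add: trig_def sum_subtractf[symmetric] algebra_simps)
    also have "\<dots> \<le> (\<Sum>\<xi>\<in>S. cmod (c \<xi>) * cmod (1 - x \<xi> * cnj (y \<xi>)))"
    proof (rule order_trans[OF sum_abs], rule sum_mono)
      fix \<xi>
      have "x \<xi> - y \<xi> = - (y \<xi> * (1 - x \<xi> * cnj (y \<xi>)))"
        using bohr_mult_cnj[OF xy(2), of \<xi>] by (simp add: algebra_simps)
      then have "cmod (x \<xi> - y \<xi>) = cmod (1 - x \<xi> * cnj (y \<xi>))"
        by (simp only: norm_minus_cancel norm_mult bohr_norm[OF xy(2)] mult_1)
      then show "\<bar>Re (c \<xi> * (x \<xi> - y \<xi>))\<bar> \<le> cmod (c \<xi>) * cmod (1 - x \<xi> * cnj (y \<xi>))"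
        using abs_Re_le_cmod[of "c \<xi> * (x \<xi> - y \<xi>)"] by (simp add: norm_mult)
    qed
    finally show ?thesis by (simp add: D_def)
  qed
  let ?k = "\<lambda>z. kern S' k (fst z) (snd z)"
  let ?D = "\<lambda>z. D (\<lambda>\<xi>. fst z \<xi> * cnj (snd z \<xi>)) * ?k z"
  have Dint: "integrable (m \<Otimes>\<^sub>M m) ?D"
  proof (rule Bochner_Integration.integrable_bound)
    let ?C = "(\<Sum>\<xi>\<in>S. cmod (c \<xi>) * 2) * (\<Sum>\<xi>\<in>S'. cmod (k \<xi>))"
    show "integrable (m \<Otimes>\<^sub>M m) (\<lambda>z. (\<lambda>_. ?C) (fst z) * (\<lambda>_. 1) (snd z))"
      by (intro integrable_pair_times) simp_all
    show "?D \<in> borel_measurable (m \<Otimes>\<^sub>M m)" unfolding D_def by measurable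
    show "AE z in m \<Otimes>\<^sub>M m. norm (?D z) \<le> norm (?C * 1)"
    proof (rule AE_I2)
      fix z assume "z \<in> space (m \<Otimes>\<^sub>M m)"
      then have z: "fst z \<in> bohr" "snd z \<in> bohr" by (auto simp: space_pair_measure haar_space)
      have "cmod (1 - fst z \<xi> * cnj (snd z \<xi>)) \<le> 2" for \<xi>
        using norm_triangle_ineq4[of 1 "fst z \<xi> * cnj (snd z \<xi>)"] z by (simp add: norm_mult bohr_norm)
      then have "D (\<lambda>\<xi>. fst z \<xi> * cnj (snd z \<xi>)) \<le> (\<Sum>\<xi>\<in>S. cmod (c \<xi>) * 2)"
        unfolding D_def by (intro sum_mono mult_left_mono) auto
      then have "norm (?D z) \<le> ?C"
        using D0(1) kern_bound[OF z] by (auto simp: abs_mult intro!: mult_mono sum_nonneg)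
      then show "norm (?D z) \<le> norm (?C * 1)" by simp
    qed
  qed
  \<comment> \<open>For each y, invariance in x replaces x y^-1 by x, so the double integral is the
    single integral of D K.\<close>
  have "(\<integral>z. ?D z \<partial>(m \<Otimes>\<^sub>M m)) = (\<integral>y. \<integral>x. D (\<lambda>\<xi>. x \<xi> * cnj (y \<xi>)) * kern S' k x y \<partial>m \<partial>m)"
    using integral_snd[of "\<lambda>x y. D (\<lambda>\<xi>. x \<xi> * cnj (y \<xi>)) * kern S' k x y"] Dint
    by (simp add: case_prod_unfold)
  also have "\<dots> = (\<integral>y. (\<integral>x. D x * K x \<partial>m) \<partial>m)"
  proof (rule Bochner_Integration.integral_cong[OF refl])
    fix y assume "y \<in> space m"
    then have y: "y \<in> bohr" by (simp add: haar_space)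
    have meas: "(\<lambda>x. D x * trig S' k x) \<in> borel_measurable m"
      using haar_measurable_continuous[OF Dc] by measurable
    have "(\<integral>x. D (\<lambda>\<xi>. x \<xi> * cnj (y \<xi>)) * kern S' k x y \<partial>m) =
        (\<integral>x. (\<lambda>x. D x * trig S' k x) (\<lambda>\<xi>. cnj (y \<xi>) * x \<xi>) \<partial>m)"
      by (simp add: kern_eq_trig mult.commute)
    also have "\<dots> = (\<integral>x. D x * trig S' k x \<partial>m)"
      by (rule haar_translate_integral[OF bohr_cnj[OF y] meas])
    also have "\<dots> = (\<integral>x. D x * K x \<partial>m)"
      using S'(2) by (intro Bochner_Integration.integral_cong) (auto simp: haar_space)
    finally show "(\<integral>x. D (\<lambda>\<xi>. x \<xi> * cnj (y \<xi>)) * kern S' k x y \<partial>m) = (\<integral>x. D x * K x \<partial>m)" .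
  qed
  also have "\<dots> < \<epsilon>/2" using K(4) haar_measure_space by simp
  finally have Dlt: "(\<integral>z. ?D z \<partial>(m \<Otimes>\<^sub>M m)) < \<epsilon>/2" .
  have fpi: "integrable m (\<lambda>\<omega>. \<bar>f \<omega> - p \<omega>\<bar>)" using f pi by auto
  note kint = haar_kern_integral[OF S'(1) fpi, of k]
  have "(\<integral>z. \<bar>f (fst z) - f (snd z)\<bar> * ?k z \<partial>(m \<Otimes>\<^sub>M m)) \<le>
      (\<integral>z. (\<bar>f (fst z) - p (fst z)\<bar> * ?k z + ?D z) + \<bar>f (snd z) - p (snd z)\<bar> * ?k z \<partial>(m \<Otimes>\<^sub>M m))"
  proof (rule integral_mono)
    show "integrable (m \<Otimes>\<^sub>M m) (\<lambda>z. \<bar>f (fst z) - f (snd z)\<bar> * ?k z)"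
      by (rule haar_integrable_diff_kern[OF S'(1) f f])
    show "integrable (m \<Otimes>\<^sub>M m) (\<lambda>z. (\<bar>f (fst z) - p (fst z)\<bar> * ?k z + ?D z) + \<bar>f (snd z) - p (snd z)\<bar> * ?k z)"
      by (intro Bochner_Integration.integrable_add kint(1,2) Dint)
    fix z assume "z \<in> space (m \<Otimes>\<^sub>M m)"
    then have z: "fst z \<in> bohr" "snd z \<in> bohr" by (auto simp: space_pair_measure haar_space)
    have "\<bar>f (fst z) - f (snd z)\<bar> \<le> (\<bar>f (fst z) - p (fst z)\<bar> + D (\<lambda>\<xi>. fst z \<xi> * cnj (snd z \<xi>))) + \<bar>f (snd z) - p (snd z)\<bar>"
      using dist[OF z] by linarith
    from mult_right_mono[OF this k0[OF z]]
    show "\<bar>f (fst z) - f (snd z)\<bar> * ?k z \<le>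
      (\<bar>f (fst z) - p (fst z)\<bar> * ?k z + ?D z) + \<bar>f (snd z) - p (snd z)\<bar> * ?k z"
      by (simp add: distrib_right)
  qed
  also have "\<dots> = (\<integral>\<omega>. \<bar>f \<omega> - p \<omega>\<bar> \<partial>m) + (\<integral>z. ?D z \<partial>(m \<Otimes>\<^sub>M m)) + (\<integral>\<omega>. \<bar>f \<omega> - p \<omega>\<bar> \<partial>m)"
    using kint Dint mean by simp
  also have "\<dots> < \<epsilon>" using Dlt p(2) by simp
  finally have "(\<integral>z. \<bar>f (fst z) - f (snd z)\<bar> * ?k z \<partial>(m \<Otimes>\<^sub>M m)) < \<epsilon>" .
  then show ?thesis
    using S'(1) mean k0 by (intro exI[of _ S'] exI[of _ k]) (auto split: if_splits)
qed

end

subsection \<open>Signed primitives and double primitives\<close>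

lemma prim_FTC:
  assumes "\<And>x. (G has_real_derivative g x) (at x)" shows "prim g u = G u - G 0"
proof -
  have I: "(g has_integral (G b - G a)) {a..b}" if "a \<le> b" for a b
    using that assms by (intro fundamental_theorem_of_calculus)
      (auto simp: has_real_derivative_iff_has_vector_derivative[symmetric] intro: DERIV_subset)
  show ?thesis
    using integral_unique[OF I[of 0 u]] integral_unique[OF I[of u 0]] by (auto simp: prim_def)
qed

text \<open>Near u the signed primitive is an integral from the fixed point -M minus a constant,
  which removes the case distinction at 0.\<close>

lemma prim_DERIV:
  assumes g: "continuous_on UNIV g" shows "(prim g has_real_derivative g u) (at u)"
proof -
  have "prim g u = integral {- M..u} g - integral {- M..0} g" if "\<bar>u\<bar> \<le> M" for u M :: real
  proof -
    have int: "g integrable_on {a..b}" for a b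
      using g by (intro integrable_continuous_real) (auto intro: continuous_on_subset)
    show ?thesis
      using Henstock_Kurzweil_Integration.integral_combine[of "- M" 0 u g]
        Henstock_Kurzweil_Integration.integral_combine[of "- M" u 0 g] that int
      by (auto simp: prim_def)
  qed
  note eq = this
  let ?M = "\<bar>u\<bar> + 1"
  have "((\<lambda>u. integral {- ?M..u} g) has_real_derivative g u) (at u within {- ?M..?M})"
    using g by (intro integral_has_real_derivative) (auto intro: continuous_on_subset)
  moreover have "at u within {- ?M..?M} = at u"
    by (rule at_within_interior) auto
  ultimately have d: "((\<lambda>u. integral {- ?M..u} g - integral {- ?M..0} g) has_real_derivative g u) (at u)"
    by (auto intro!: derivative_eq_intros)
  have ev: "\<forall>\<^sub>F x in nhds u. prim g x = integral {- ?M..x} g - integral {- ?M..0} g"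
  proof (rule eventually_mono)
    show "\<forall>\<^sub>F x in nhds u. x \<in> {- ?M<..<?M}" by (intro eventually_nhds_in_open) auto
    show "prim g x = integral {- ?M..x} g - integral {- ?M..0} g" if "x \<in> {- ?M<..<?M}" for x
      using that by (intro eq) auto
  qed
  show ?thesis by (rule DERIV_cong_ev[OF refl ev refl, THEN iffD2, OF d])
qed

lemma prim_zero [simp]: "prim g 0 = 0"
  by (simp add: prim_def)

lemma prim_add:
  assumes "continuous_on UNIV f" "continuous_on UNIV g"
  shows "prim (\<lambda>s. f s + g s) u = prim f u + prim g u"
proof -
  have "((\<lambda>u. prim f u + prim g u) has_real_derivative f x + g x) (at x)" for x
    by (intro DERIV_add prim_DERIV assms)
  from prim_FTC[OF this] show ?thesis by simp
qed

lemma prim_cmult: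
  assumes "continuous_on UNIV f" shows "prim (\<lambda>s. c * f s) u = c * prim f u"
proof -
  have "((\<lambda>u. c * prim f u) has_real_derivative c * f x) (at x)" for x
    by (intro DERIV_cmult prim_DERIV assms)
  from prim_FTC[OF this] show ?thesis by simp
qed

lemma prim_diff:
  assumes "continuous_on UNIV f" "continuous_on UNIV g"
  shows "prim (\<lambda>s. f s - g s) u = prim f u - prim g u"
  using prim_add[OF assms(1), of "\<lambda>s. (-1) * g s" u] prim_cmult[OF assms(2), of "-1" u] assms(2)
  by (auto intro!: continuous_intros)

lemma prim_sum:
  assumes "\<And>i. i \<in> I \<Longrightarrow> continuous_on UNIV (f i)"
  shows "prim (\<lambda>s. \<Sum>i\<in>I. f i s) u = (\<Sum>i\<in>I. prim (f i) u)"
  using assms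
proof (induction I rule: infinite_finite_induct)
  case (insert i I)
  then show ?case
    by (simp add: prim_add continuous_on_sum)
qed (use prim_FTC[of "\<lambda>_. 0" "\<lambda>_. 0" u] in simp_all)

text \<open>Rescaling to [0, 1] moves the endpoint u into the integrand; continuity in parameters
  and Fubini then reduce to statements about a fixed interval.\<close>

lemma prim_unit:
  assumes g: "continuous_on UNIV g" shows "prim g u = u * integral {0..1} (\<lambda>\<tau>. g (u * \<tau>))"
proof -
  have "((\<lambda>\<tau>. u * g (u * \<tau>)) has_integral (prim g (u * 1) - prim g (u * 0))) {0..1}"
  proof (intro fundamental_theorem_of_calculus)
    fix \<tau> :: real
    have "((\<lambda>\<tau>. prim g (u * \<tau>)) has_real_derivative g (u * \<tau>) * u) (at \<tau>)"
      by (rule DERIV_chain2[OF prim_DERIV[OF g]]) (auto intro!: derivative_eq_intros)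
    then show "((\<lambda>\<tau>. prim g (u * \<tau>)) has_vector_derivative u * g (u * \<tau>)) (at \<tau> within {0..1})"
      by (simp add: has_real_derivative_iff_has_vector_derivative[symmetric] mult.commute has_field_derivative_at_within)
  qed simp
  then have "integral {0..1} (\<lambda>\<tau>. u * g (u * \<tau>)) = prim g u"
    by (intro integral_unique) simp
  then show ?thesis by simp
qed

lemma prim_continuous_param:
  fixes g :: "'a::topological_space \<Rightarrow> real \<Rightarrow> real"
  assumes g: "continuous_on UNIV (\<lambda>p. g (fst p) (snd p))" and U: "continuous_on UNIV U"
  shows "continuous_on UNIV (\<lambda>x. prim (g x) (U x))"
proof -
  have "continuous_on UNIV (\<lambda>s. g x s)" for x
    by (rule continuous_on_compose2[OF g, of _ "\<lambda>s. (x, s)", simplified]) (intro continuous_intros)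
  then have eq: "prim (g x) (U x) = U x * integral {0..1} (\<lambda>\<tau>. g x (U x * \<tau>))" for x
    by (rule prim_unit)
  have "continuous_on (UNIV \<times> cbox 0 1) (\<lambda>(x, \<tau>). g x (U x * \<tau>))"
    unfolding case_prod_unfold
    by (rule continuous_on_compose2[OF g, of _ "\<lambda>p. (fst p, U (fst p) * snd p)", simplified])
      (intro continuous_intros continuous_on_compose2[OF U], auto)
  from integral_continuous_on_param[OF this]
  show ?thesis unfolding eq using U by (intro continuous_intros) auto
qed

text \<open>Both H - \<open>prim g\<close> and H + \<open>prim g\<close> are nondecreasing on
  [-M, M]. The increment of H over the whole interval is a bound that serves both signs of
  u.\<close>

lemma abs_prim_le:
  assumes g: "continuous_on UNIV g" and H: "\<And>x. (H has_real_derivative h x) (at x)"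
    and le: "\<And>x. \<bar>x\<bar> \<le> M \<Longrightarrow> \<bar>g x\<bar> \<le> h x" and u: "\<bar>u\<bar> \<le> M"
  shows "\<bar>prim g u\<bar> \<le> H M - H (- M)"
proof -
  have mono: "H a - prim g a \<le> H b - prim g b" "H a + prim g a \<le> H b + prim g b"
    "H a \<le> H b" if "- M \<le> a" "a \<le> b" "b \<le> M" for a b
  proof -
    have h: "\<bar>g x\<bar> \<le> h x" if "a \<le> x" "x \<le> b" for x
      using le[of x] that \<open>- M \<le> a\<close> \<open>b \<le> M\<close> by auto
    show "H a - prim g a \<le> H b - prim g b"
    proof (rule DERIV_nonneg_imp_nondecreasing[OF \<open>a \<le> b\<close>])
      fix x assume "a \<le> x" "x \<le> b"
      then show "\<exists>y. ((\<lambda>x. H x - prim g x) has_real_derivative y) (at x) \<and> 0 \<le> y"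
        using h[of x] by (intro exI[of _ "h x - g x"]) (auto intro!: derivative_intros H prim_DERIV g)
    qed
    show "H a + prim g a \<le> H b + prim g b"
    proof (rule DERIV_nonneg_imp_nondecreasing[OF \<open>a \<le> b\<close>])
      fix x assume "a \<le> x" "x \<le> b"
      then show "\<exists>y. ((\<lambda>x. H x + prim g x) has_real_derivative y) (at x) \<and> 0 \<le> y"
        using h[of x] by (intro exI[of _ "h x + g x"]) (auto intro!: derivative_intros H prim_DERIV g)
    qed
    show "H a \<le> H b"
    proof (rule DERIV_nonneg_imp_nondecreasing[OF \<open>a \<le> b\<close>])
      fix x assume "a \<le> x" "x \<le> b"
      then show "\<exists>y. (H has_real_derivative y) (at x) \<and> 0 \<le> y"
        using h[of x] by (intro exI[of _ "h x"]) (auto intro!: H)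
    qed
  qed
  show ?thesis
  proof (cases "0 \<le> u")
    case True
    then show ?thesis using mono(1,2)[of 0 u] mono(3)[of "- M" 0] mono(3)[of u M] u by auto
  next
    case False
    then show ?thesis using mono(1,2)[of u 0] mono(3)[of "- M" u] mono(3)[of 0 M] u by auto
  qed
qed

text \<open>The inner primitive runs over the first argument of H up to u, the outer one over the
  second up to v; for u, v \<ge> 0 this is the integral of H over [0, u] x [0, v].\<close>

definition dprim :: "(real \<Rightarrow> real \<Rightarrow> real) \<Rightarrow> real \<Rightarrow> real \<Rightarrow> real" where
  "dprim H u v = prim (\<lambda>\<zeta>. prim (\<lambda>\<tau>. H \<tau> \<zeta>) u) v"

context
  fixes H :: "real \<Rightarrow> real \<Rightarrow> real"
  assumes H: "continuous_on UNIV (\<lambda>p. H (fst p) (snd p))"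
begin

lemma continuous_on_both: "continuous_on A f \<Longrightarrow> continuous_on A g \<Longrightarrow> continuous_on A (\<lambda>x. H (f x) (g x))"
  using continuous_on_compose2[OF H, of A "\<lambda>x. (f x, g x)"] by (auto intro!: continuous_intros)

lemma continuous_on_inner_prim: "continuous_on UNIV (\<lambda>\<zeta>. prim (\<lambda>\<tau>. H \<tau> \<zeta>) u)"
  by (rule prim_continuous_param) (auto intro!: continuous_on_both continuous_intros)

lemma continuous_on_dprim: "continuous_on UNIV (\<lambda>p. dprim H (fst p) (snd p))"
  unfolding dprim_def
  by (intro prim_continuous_param continuous_on_both continuous_intros)

lemma dprim_swap: "dprim H u v = prim (\<lambda>\<tau>. prim (\<lambda>\<zeta>. H \<tau> \<zeta>) v) u"
proof -
  have 1: "prim (\<lambda>\<tau>. H \<tau> \<zeta>) u = u * integral {0..1} (\<lambda>\<tau>. H (u * \<tau>) \<zeta>)" for \<zeta>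
    by (rule prim_unit) (intro continuous_on_both continuous_intros)
  have 2: "prim (\<lambda>\<zeta>. H \<tau> \<zeta>) v = v * integral {0..1} (\<lambda>\<zeta>. H \<tau> (v * \<zeta>))" for \<tau>
    by (rule prim_unit) (intro continuous_on_both continuous_intros)
  have "dprim H u v = v * (u * integral {0..1} (\<lambda>\<zeta>. integral {0..1} (\<lambda>\<tau>. H (u * \<tau>) (v * \<zeta>))))"
    unfolding dprim_def by (subst prim_unit[OF continuous_on_inner_prim]) (simp add: 1)
  also have "integral {0..1} (\<lambda>\<zeta>. integral {0..1} (\<lambda>\<tau>. H (u * \<tau>) (v * \<zeta>))) =
      integral {0..1} (\<lambda>\<tau>. integral {0..1} (\<lambda>\<zeta>. H (u * \<tau>) (v * \<zeta>)))"
  proof -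
    have "continuous_on (cbox (0, 0) (1, 1)) (\<lambda>(\<zeta>, \<tau>). H (u * \<tau>) (v * \<zeta>))"
      unfolding case_prod_unfold by (intro continuous_on_both continuous_intros)
    from integral_swap_continuous[OF this] show ?thesis by simp
  qed
  also have "v * (u * integral {0..1} (\<lambda>\<tau>. integral {0..1} (\<lambda>\<zeta>. H (u * \<tau>) (v * \<zeta>)))) =
      prim (\<lambda>\<tau>. prim (\<lambda>\<zeta>. H \<tau> \<zeta>) v) u"
  proof -
    have "continuous_on UNIV (\<lambda>\<tau>. prim (\<lambda>\<zeta>. H \<tau> \<zeta>) v)"
      by (rule prim_continuous_param) (auto intro!: continuous_on_both continuous_intros)
    from prim_unit[OF this, of u] show ?thesis by (simp add: 2)
  qed
  finally show ?thesis .
qed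

end

lemma dprim_add:
  assumes "continuous_on UNIV (\<lambda>p. H (fst p) (snd p))" "continuous_on UNIV (\<lambda>p. H' (fst p) (snd p))"
  shows "dprim (\<lambda>\<tau> \<zeta>. H \<tau> \<zeta> + H' \<tau> \<zeta>) u v = dprim H u v + dprim H' u v"
  unfolding dprim_def
  by (simp add: prim_add continuous_on_both[OF assms(1)] continuous_on_both[OF assms(2)]
      continuous_on_const continuous_on_id continuous_on_inner_prim[OF assms(1)] continuous_on_inner_prim[OF assms(2)])

lemma dprim_diff:
  assumes "continuous_on UNIV (\<lambda>p. H (fst p) (snd p))" "continuous_on UNIV (\<lambda>p. H' (fst p) (snd p))"
  shows "dprim (\<lambda>\<tau> \<zeta>. H \<tau> \<zeta> - H' \<tau> \<zeta>) u v = dprim H u v - dprim H' u v"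
  unfolding dprim_def
  by (simp add: prim_diff continuous_on_both[OF assms(1)] continuous_on_both[OF assms(2)]
      continuous_on_const continuous_on_id continuous_on_inner_prim[OF assms(1)] continuous_on_inner_prim[OF assms(2)])

lemma dprim_sum:
  assumes "\<And>i. i \<in> I \<Longrightarrow> continuous_on UNIV (\<lambda>p. H i (fst p) (snd p))"
  shows "dprim (\<lambda>\<tau> \<zeta>. \<Sum>i\<in>I. H i \<tau> \<zeta>) u v = (\<Sum>i\<in>I. dprim (H i) u v)"
proof -
  have "(\<lambda>\<zeta>. prim (\<lambda>\<tau>. \<Sum>i\<in>I. H i \<tau> \<zeta>) u) = (\<lambda>\<zeta>. \<Sum>i\<in>I. prim (\<lambda>\<tau>. H i \<tau> \<zeta>) u)"
    by (intro ext prim_sum continuous_on_both[OF assms] continuous_on_const continuous_on_id)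
  then show ?thesis
    unfolding dprim_def by (simp add: prim_sum continuous_on_inner_prim[OF assms])
qed

subsection \<open>A smooth convex approximation of the absolute value\<close>

definition sabs :: "real \<Rightarrow> real \<Rightarrow> real" where "sabs \<delta> z = sqrt (z\<^sup>2 + \<delta>\<^sup>2)"
definition sabs' :: "real \<Rightarrow> real \<Rightarrow> real" where "sabs' \<delta> z = z / sqrt (z\<^sup>2 + \<delta>\<^sup>2)"
definition sabs'' :: "real \<Rightarrow> real \<Rightarrow> real" where "sabs'' \<delta> z = \<delta>\<^sup>2 / (sqrt (z\<^sup>2 + \<delta>\<^sup>2)) ^ 3"

context
  fixes \<delta> :: real
  assumes \<delta>: "0 < \<delta>"
begin

lemma sabs_pos: "0 < z\<^sup>2 + \<delta>\<^sup>2" "0 < sqrt (z\<^sup>2 + \<delta>\<^sup>2)"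
  using \<delta> by (auto intro: add_nonneg_pos)

lemma sabs_DERIV: "(sabs \<delta> has_real_derivative sabs' \<delta> z) (at z)"
  unfolding sabs_def[abs_def] sabs'_def using sabs_pos[of z]
  by (auto intro!: derivative_eq_intros simp: field_simps)

lemma sabs'_DERIV: "(sabs' \<delta> has_real_derivative sabs'' \<delta> z) (at z)"
proof -
  define r where "r = sqrt (z\<^sup>2 + \<delta>\<^sup>2)"
  have r: "0 < r" "r\<^sup>2 = z\<^sup>2 + \<delta>\<^sup>2" using sabs_pos[of z] by (auto simp: r_def)
  have "((\<lambda>z. z / sqrt (z\<^sup>2 + \<delta>\<^sup>2)) has_real_derivative (1 * r - z * (z / r)) / (r * r)) (at z)"
    using sabs_pos[of z] unfolding r_def
    by (auto intro!: derivative_eq_intros simp: field_simps)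
  moreover have "(1 * r - z * (z / r)) / (r * r) = \<delta>\<^sup>2 / r ^ 3"
    using r by (simp add: field_simps power2_eq_square power3_eq_cube)
  ultimately show ?thesis by (simp add: sabs'_def[abs_def] sabs''_def r_def)
qed

lemma sabs'_diff_DERIV:
  "((\<lambda>x. sabs' \<delta> (x - c)) has_real_derivative sabs'' \<delta> (x - c)) (at x)"
  "((\<lambda>x. sabs' \<delta> (c - x)) has_real_derivative - sabs'' \<delta> (c - x)) (at x)"
  by (rule DERIV_cong[OF DERIV_chain2[where f = "sabs' \<delta>", OF sabs'_DERIV]],
      auto intro!: derivative_eq_intros)+

lemma sabs''_continuous: "continuous_on A (sabs'' \<delta>)"
  unfolding sabs''_def[abs_def] using sabs_pos(2) by (intro continuous_intros) (auto simp: less_imp_neq[symmetric])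

lemma sabs''_nonneg: "0 \<le> sabs'' \<delta> z"
  by (simp add: sabs''_def)

lemma abs_sabs'_le: "\<bar>sabs' \<delta> z\<bar> \<le> 1"
proof -
  have "\<bar>z\<bar> \<le> sqrt (z\<^sup>2 + \<delta>\<^sup>2)" by (rule real_le_rsqrt) simp
  then show ?thesis using sabs_pos[of z] by (simp add: sabs'_def abs_divide divide_le_eq)
qed

lemma sabs_approx: "\<bar>sabs \<delta> z - \<bar>z\<bar>\<bar> \<le> \<delta>"
proof -
  have "\<bar>z\<bar> \<le> sabs \<delta> z" unfolding sabs_def by (rule real_le_rsqrt) simp
  moreover have "sabs \<delta> z \<le> \<bar>z\<bar> + \<delta>"
    unfolding sabs_def using \<delta> by (intro real_le_lsqrt) (auto simp: power2_eq_square algebra_simps)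
  ultimately show ?thesis by simp
qed

lemma sabs_minus: "sabs \<delta> (a - b) = sabs \<delta> (b - a)"
  by (simp add: sabs_def power2_commute)

lemma sabs''_minus: "sabs'' \<delta> (a - b) = sabs'' \<delta> (b - a)"
  by (simp add: sabs''_def power2_commute)

lemma square_times_sabs''_le: "z\<^sup>2 * sabs'' \<delta> z \<le> \<delta>"
proof -
  define r where "r = sqrt (z\<^sup>2 + \<delta>\<^sup>2)"
  have r: "0 < r" "r\<^sup>2 = z\<^sup>2 + \<delta>\<^sup>2" using sabs_pos[of z] by (auto simp: r_def)
  have "\<delta> \<le> r" unfolding r_def by (rule real_le_rsqrt) simp
  have "z\<^sup>2 * \<delta>\<^sup>2 \<le> r\<^sup>2 * (\<delta> * r)"
    using r \<delta> \<open>\<delta> \<le> r\<close> unfolding power2_eq_square[of \<delta>] by (intro mult_mono) auto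
  also have "\<dots> = \<delta> * r ^ 3" by (simp add: power2_eq_square power3_eq_cube)
  finally show ?thesis using r by (simp add: sabs''_def r_def[symmetric] divide_le_eq)
qed

text \<open>For |z| of order \<delta> the left side is of order 1, so no uniform bound tends to 0: a
  multiple of \<eta>'' must stay on the right, harmless because its integral is at most 2. The proof
  multiplies 2 |z| \<open>sqrt \<delta>\<close> \<le> z^2 + \<delta> by \<eta>'' and uses the bound
  \<delta> on z^2 \<eta>''(z).\<close>

lemma abs_times_sabs''_le: "\<bar>z\<bar> * sabs'' \<delta> z \<le> sqrt \<delta> * (1 + sabs'' \<delta> z)"
proof -
  have s: "0 < sqrt \<delta>" "sqrt \<delta> * sqrt \<delta> = \<delta>" using \<delta> by auto
  have "2 * (\<bar>z\<bar> * sqrt \<delta>) \<le> z\<^sup>2 + \<delta>"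
    using sum_squares_bound[of "\<bar>z\<bar>" "sqrt \<delta>"] s by (simp add: power2_eq_square)
  then have "sqrt \<delta> * (\<bar>z\<bar> * sabs'' \<delta> z) * 2 \<le> (z\<^sup>2 + \<delta>) * sabs'' \<delta> z"
    using mult_right_mono[OF _ sabs''_nonneg[of z], of "2 * (\<bar>z\<bar> * sqrt \<delta>)" "z\<^sup>2 + \<delta>"]
    by (simp add: mult_ac)
  also have "\<dots> \<le> \<delta> + \<delta> * sabs'' \<delta> z"
    using square_times_sabs''_le[of z] by (simp add: distrib_right)
  also have "\<dots> = sqrt \<delta> * (sqrt \<delta> * (1 + sabs'' \<delta> z))"
    using s by (simp add: mult.assoc[symmetric] distrib_left)
  finally have "sqrt \<delta> * (\<bar>z\<bar> * sabs'' \<delta> z * 2) \<le> sqrt \<delta> * (sqrt \<delta> * (1 + sabs'' \<delta> z))"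
    by (simp add: mult.assoc)
  then have "\<bar>z\<bar> * sabs'' \<delta> z * 2 \<le> sqrt \<delta> * (1 + sabs'' \<delta> z)"
    using s by simp
  moreover have "0 \<le> \<bar>z\<bar> * sabs'' \<delta> z" using sabs''_nonneg by simp
  ultimately show ?thesis by linarith
qed

text \<open>In the inner variable 1 + \<eta>''(\<tau> - \<zeta>) has the primitive \<tau> +
  \<eta>'(\<tau> - \<zeta>). As |\<eta>'| \<le> 1, its increment over [-M, M] is at most 2 M + 2,
  uniformly in \<delta> and \<zeta>; the outer variable contributes the length 2 M.\<close>

lemma abs_dprim_le:
  assumes H: "continuous_on UNIV (\<lambda>p. H (fst p) (snd p))"
    and le: "\<And>\<tau> \<zeta>. \<bar>\<tau>\<bar> \<le> M \<Longrightarrow> \<bar>\<zeta>\<bar> \<le> M \<Longrightarrow> \<bar>H \<tau> \<zeta>\<bar> \<le> C * (1 + sabs'' \<delta> (\<tau> - \<zeta>))"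
    and uv: "\<bar>u\<bar> \<le> M" "\<bar>v\<bar> \<le> M" and C: "0 \<le> C"
  shows "\<bar>dprim H u v\<bar> \<le> C * (2 * M + 2) * (2 * M)"
proof -
  have inner: "\<bar>prim (\<lambda>\<tau>. H \<tau> \<zeta>) u\<bar> \<le> C * (2 * M + 2)" if \<zeta>: "\<bar>\<zeta>\<bar> \<le> M" for \<zeta>
  proof -
    have "\<bar>prim (\<lambda>\<tau>. H \<tau> \<zeta>) u\<bar> \<le> C * (M + sabs' \<delta> (M - \<zeta>)) - C * (- M + sabs' \<delta> (- M - \<zeta>))"
    proof (rule abs_prim_le[where h = "\<lambda>\<tau>. C * (1 + sabs'' \<delta> (\<tau> - \<zeta>))"])
      show "continuous_on UNIV (\<lambda>\<tau>. H \<tau> \<zeta>)" by (intro continuous_on_both[OF H] continuous_intros)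
      show "((\<lambda>\<tau>. C * (\<tau> + sabs' \<delta> (\<tau> - \<zeta>))) has_real_derivative C * (1 + sabs'' \<delta> (x - \<zeta>))) (at x)" for x
        by (intro DERIV_cmult DERIV_add DERIV_ident sabs'_diff_DERIV)
    qed (use le \<zeta> uv in auto)
    also have "\<dots> = C * (2 * M + (sabs' \<delta> (M - \<zeta>) - sabs' \<delta> (- M - \<zeta>)))"
      by (simp add: algebra_simps)
    also have "\<dots> \<le> C * (2 * M + 2)"
      using C abs_sabs'_le[of "M - \<zeta>"] abs_sabs'_le[of "- M - \<zeta>"] by (intro mult_left_mono) auto
    finally show ?thesis .
  qed
  have "\<bar>dprim H u v\<bar> \<le> C * (2 * M + 2) * M - C * (2 * M + 2) * (- M)"
    unfolding dprim_def
  proof (rule abs_prim_le[where h = "\<lambda>_. C * (2 * M + 2)"])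
    show "((\<lambda>x. C * (2 * M + 2) * x) has_real_derivative C * (2 * M + 2)) (at x)" for x
      by (auto intro!: derivative_eq_intros)
  qed (use inner uv continuous_on_inner_prim[OF H] in auto)
  then show ?thesis by (simp add: algebra_simps)
qed

lemma continuous_on_sabs''_diff: "continuous_on A f \<Longrightarrow> continuous_on A g \<Longrightarrow> continuous_on A (\<lambda>x. sabs'' \<delta> (f x - g x))"
  by (rule continuous_on_compose2[OF sabs''_continuous[of UNIV]]) (auto intro!: continuous_intros)

text \<open>\<eta>'(\<tau> - v) is \<eta>'(\<tau>) minus the integral of \<eta>''(\<tau> - \<zeta>)
  over \<zeta> from 0 to v; this splits off the part of the flux that depends on u alone.\<close>

lemma prim_sabs'_left:
  assumes f: "continuous_on UNIV f"
  shows "prim (\<lambda>s. sabs' \<delta> (s - v) * f s) u =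
    prim (\<lambda>s. sabs' \<delta> s * f s) u - dprim (\<lambda>\<tau> \<zeta>. sabs'' \<delta> (\<tau> - \<zeta>) * f \<tau>) u v"
proof -
  have c: "continuous_on UNIV (\<lambda>p. sabs'' \<delta> (fst p - snd p) * f (fst p))"
    by (intro continuous_intros continuous_on_sabs''_diff continuous_on_compose2[OF f]) auto
  have sc: "continuous_on UNIV (\<lambda>s. sabs' \<delta> (s - v))" for v
    by (intro continuous_at_imp_continuous_on ballI DERIV_isCont) (rule sabs'_diff_DERIV)
  have "prim (\<lambda>\<zeta>. sabs'' \<delta> (\<tau> - \<zeta>) * f \<tau>) v = sabs' \<delta> \<tau> * f \<tau> - sabs' \<delta> (\<tau> - v) * f \<tau>" for \<tau>
    by (subst prim_FTC[of "\<lambda>\<zeta>. - (sabs' \<delta> (\<tau> - \<zeta>) * f \<tau>)"])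
      (auto intro!: derivative_eq_intros sabs'_diff_DERIV)
  then have "dprim (\<lambda>\<tau> \<zeta>. sabs'' \<delta> (\<tau> - \<zeta>) * f \<tau>) u v =
      prim (\<lambda>\<tau>. sabs' \<delta> \<tau> * f \<tau> - sabs' \<delta> (\<tau> - v) * f \<tau>) u"
    by (subst dprim_swap[OF c]) simp
  also have "\<dots> = prim (\<lambda>s. sabs' \<delta> s * f s) u - prim (\<lambda>s. sabs' \<delta> (s - v) * f s) u"
    using sc[of v] sc[of 0] f by (intro prim_diff continuous_intros) auto
  finally show ?thesis by simp
qed

lemma prim_sabs'_right:
  assumes f: "continuous_on UNIV f"
  shows "prim (\<lambda>s. sabs' \<delta> (s - u) * f s) v =
    prim (\<lambda>s. sabs' \<delta> s * f s) v - dprim (\<lambda>\<tau> \<zeta>. sabs'' \<delta> (\<tau> - \<zeta>) * f \<zeta>) u v"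
proof -
  have c: "continuous_on UNIV (\<lambda>p. sabs'' \<delta> (fst p - snd p) * f (snd p))"
    by (intro continuous_intros continuous_on_sabs''_diff continuous_on_compose2[OF f]) auto
  have "dprim (\<lambda>\<tau> \<zeta>. sabs'' \<delta> (\<tau> - \<zeta>) * f \<zeta>) u v = dprim (\<lambda>\<tau> \<zeta>. sabs'' \<delta> (\<tau> - \<zeta>) * f \<tau>) v u"
    by (subst dprim_swap[OF c]) (simp add: dprim_def sabs''_minus)
  then show ?thesis using prim_sabs'_left[OF f, of u v] by simp
qed

end

section \<open>The doubled flux and its remainder\<close>

lemma smooth_fun_lipschitz:
  assumes "smooth_fun f"
  shows "\<exists>L\<ge>0. \<forall>x y. \<bar>x\<bar> \<le> M \<longrightarrow> \<bar>y\<bar> \<le> M \<longrightarrow> \<bar>f x - f y\<bar> \<le> L * \<bar>x - y\<bar>"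
proof -
  have "compact (deriv f ` {-M..M})"
    by (intro compact_continuous_image smooth_fun_continuous smooth_fun_deriv assms) simp
  then obtain B where B: "\<And>x. \<bar>x\<bar> \<le> M \<Longrightarrow> \<bar>deriv f x\<bar> \<le> B"
    by (force dest!: compact_imp_bounded simp: bounded_iff abs_le_iff)
  have "\<bar>f x - f y\<bar> \<le> \<bar>B\<bar> * \<bar>x - y\<bar>" if "\<bar>x\<bar> \<le> M" "\<bar>y\<bar> \<le> M" for x y
  proof -
    have "norm (f x - f y) \<le> \<bar>B\<bar> * norm (x - y)"
    proof (rule field_differentiable_bound[of "{-M..M}" f "deriv f"])
      show "norm (deriv f z) \<le> \<bar>B\<bar>" if "z \<in> {-M..M}" for z
        using B[of z] that by (auto simp: abs_le_iff)
    qed (use that smooth_fun_DERIV[OF assms] in \<open>auto intro: has_field_derivative_at_within\<close>)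
    then show ?thesis by simp
  qed
  then show ?thesis by (intro exI[of _ "\<bar>B\<bar>"]) auto
qed

text \<open>\<open>k1\<close> and \<open>k2\<close> stand for first and second derivatives of the
  kernel in x. First order fluxes are subtracted because differentiating a function of x y^-1 in y
  gives minus the derivative in x; second derivatives agree, so those fluxes add. The sum over k is
  the contribution of the mixed dissipation term.\<close>

definition doubled_flux where
  "doubled_flux \<delta> f a \<sigma> u v k1 k2 =
     (\<Sum>j\<in>UNIV. (prim (\<lambda>s. sabs' \<delta> (s - v) * f j s) u - prim (\<lambda>s. sabs' \<delta> (s - u) * f j s) v) * k1 j)
     + (\<Sum>i\<in>UNIV. \<Sum>j\<in>UNIV. (prim (\<lambda>s. sabs' \<delta> (s - v) * a i j s) u + prim (\<lambda>s. sabs' \<delta> (s - u) * a i j s) v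
         + 2 * (\<Sum>k\<in>UNIV. dprim (\<lambda>\<tau> \<zeta>. sabs'' \<delta> (\<tau> - \<zeta>) * \<sigma> i k \<tau> * \<sigma> j k \<zeta>) u v)) * k2 i j)"
  for f :: "'d::finite \<Rightarrow> real \<Rightarrow> real" and \<sigma> :: "'d \<Rightarrow> 'k::finite \<Rightarrow> real \<Rightarrow> real"

text \<open>Each summand depends on u alone or on v alone, so it integrates to zero against kernel
  derivatives. It arises from \<open>doubled_flux\<close> by replacing \<eta>'(s - v) and \<eta>'(s
  - u) with \<eta>'(s) and dropping the mixed term.\<close>

definition separated_flux where
  "separated_flux \<delta> f a u v k1 k2 =
     (\<Sum>j\<in>UNIV. (prim (\<lambda>s. sabs' \<delta> s * f j s) u - prim (\<lambda>s. sabs' \<delta> s * f j s) v) * k1 j)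
       + (\<Sum>i\<in>UNIV. \<Sum>j\<in>UNIV. (prim (\<lambda>s. sabs' \<delta> s * a i j s) u + prim (\<lambda>s. sabs' \<delta> s * a i j s) v) * k2 i j)"
  for f :: "'d::finite \<Rightarrow> real \<Rightarrow> real"

text \<open>Summing the two entropy inequalities and using the parabolic dissipation twice leaves, up to
  functions of \<open>u\<close> alone and of \<open>v\<close> alone, double primitives of
  \<open>\<eta>''(\<tau> - \<zeta>)\<close> times differences, or products of differences, of the coefficients at
  \<open>\<tau>\<close> and \<open>\<zeta>\<close>; these are small because \<open>\<bar>z\<bar> \<eta>''(z)\<close> is.\<close>

lemma doubling_remainder:
  fixes f :: "'d::finite \<Rightarrow> real \<Rightarrow> real" and \<sigma> :: "'d \<Rightarrow> 'k::finite \<Rightarrow> real \<Rightarrow> real"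
    and a :: "'d \<Rightarrow> 'd \<Rightarrow> real \<Rightarrow> real"
  assumes f: "\<And>j. smooth_fun (f j)" and \<sigma>: "\<And>i k. smooth_fun (\<sigma> i k)"
    and a: "\<And>i j s. a i j s = (\<Sum>k\<in>UNIV. \<sigma> i k s * \<sigma> j k s)"
  shows "\<exists>C\<ge>0. \<forall>\<delta> u v k1 k2. 0 < \<delta> \<longrightarrow> \<delta> \<le> 1 \<longrightarrow> \<bar>u\<bar> \<le> M \<longrightarrow> \<bar>v\<bar> \<le> M \<longrightarrow> (\<forall>i j. k2 i j = k2 j i) \<longrightarrow>
    \<bar>doubled_flux \<delta> f a \<sigma> u v k1 k2 - separated_flux \<delta> f a u v k1 k2\<bar>
    \<le> C * sqrt \<delta> * ((\<Sum>j\<in>UNIV. \<bar>k1 j\<bar>) + (\<Sum>i\<in>UNIV. \<Sum>j\<in>UNIV. \<bar>k2 i j\<bar>))"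
proof -
  have "\<exists>L. \<forall>j. 0 \<le> L j \<and> (\<forall>x y. \<bar>x\<bar> \<le> M \<longrightarrow> \<bar>y\<bar> \<le> M \<longrightarrow> \<bar>f j x - f j y\<bar> \<le> L j * \<bar>x - y\<bar>)"
    using smooth_fun_lipschitz[OF f] by (intro choice) blast
  then obtain Lf where Lf: "\<And>j. 0 \<le> Lf j" "\<And>j x y. \<bar>x\<bar> \<le> M \<Longrightarrow> \<bar>y\<bar> \<le> M \<Longrightarrow> \<bar>f j x - f j y\<bar> \<le> Lf j * \<bar>x - y\<bar>"
    by blast
  have "\<exists>L. \<forall>p. 0 \<le> L p \<and> (\<forall>x y. \<bar>x\<bar> \<le> M \<longrightarrow> \<bar>y\<bar> \<le> M \<longrightarrow> \<bar>\<sigma> (fst p) (snd p) x - \<sigma> (fst p) (snd p) y\<bar> \<le> L p * \<bar>x - y\<bar>)"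
    using smooth_fun_lipschitz[OF \<sigma>] by (intro choice) blast
  then obtain Ls where Ls: "\<And>p. 0 \<le> Ls p" "\<And>p x y. \<bar>x\<bar> \<le> M \<Longrightarrow> \<bar>y\<bar> \<le> M \<Longrightarrow>
      \<bar>\<sigma> (fst p) (snd p) x - \<sigma> (fst p) (snd p) y\<bar> \<le> Ls p * \<bar>x - y\<bar>"
    by blast
  define L1 where "L1 = (\<Sum>j\<in>UNIV. Lf j)"
  define L2 where "L2 = (\<Sum>p\<in>UNIV. Ls p)"
  have L1: "0 \<le> L1" "\<bar>x\<bar> \<le> M \<Longrightarrow> \<bar>y\<bar> \<le> M \<Longrightarrow> \<bar>f j x - f j y\<bar> \<le> L1 * \<bar>x - y\<bar>" for j x y
  proof -
    show "0 \<le> L1" unfolding L1_def using Lf by (intro sum_nonneg) auto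
    have "Lf j \<le> L1" unfolding L1_def using Lf by (intro member_le_sum) auto
    then show "\<bar>x\<bar> \<le> M \<Longrightarrow> \<bar>y\<bar> \<le> M \<Longrightarrow> \<bar>f j x - f j y\<bar> \<le> L1 * \<bar>x - y\<bar>"
      using Lf(2)[of x y j] mult_right_mono[of "Lf j" L1 "\<bar>x - y\<bar>"] by linarith
  qed
  have L2: "0 \<le> L2" "\<bar>x\<bar> \<le> M \<Longrightarrow> \<bar>y\<bar> \<le> M \<Longrightarrow> \<bar>\<sigma> i k x - \<sigma> i k y\<bar> \<le> L2 * \<bar>x - y\<bar>" for i k x y
  proof -
    show "0 \<le> L2" unfolding L2_def using Ls by (intro sum_nonneg) auto
    have "Ls (i, k) \<le> L2" unfolding L2_def using Ls by (intro member_le_sum) auto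
    then show "\<bar>x\<bar> \<le> M \<Longrightarrow> \<bar>y\<bar> \<le> M \<Longrightarrow> \<bar>\<sigma> i k x - \<sigma> i k y\<bar> \<le> L2 * \<bar>x - y\<bar>"
      using Ls(2)[of x y "(i, k)"] mult_right_mono[of "Ls (i, k)" L2 "\<bar>x - y\<bar>"] by simp
  qed
  define c where "c = L1 + real CARD('k) * L2\<^sup>2"
  have c: "0 \<le> c" "L1 \<le> c" "real CARD('k) * L2\<^sup>2 \<le> c" using L1(1) by (auto simp: c_def)
  define C where "C = c * (2 * \<bar>M\<bar> + 2) * (2 * \<bar>M\<bar>)"
  have "0 \<le> C" using c by (simp add: C_def)
  moreover have "\<bar>doubled_flux \<delta> f a \<sigma> u v k1 k2 - separated_flux \<delta> f a u v k1 k2\<bar>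
    \<le> C * sqrt \<delta> * ((\<Sum>j\<in>UNIV. \<bar>k1 j\<bar>) + (\<Sum>i\<in>UNIV. \<Sum>j\<in>UNIV. \<bar>k2 i j\<bar>))"
    (is "\<bar>?T\<bar> \<le> _")
    if \<delta>: "0 < \<delta>" "\<delta> \<le> 1" and uv: "\<bar>u\<bar> \<le> M" "\<bar>v\<bar> \<le> M" and sym: "\<And>i j. k2 i j = k2 j i"
    for \<delta> u v k1 k2
  proof -
    have M: "\<bar>M\<bar> = M" using uv by simp
    have cont [continuous_intros]: "continuous_on A (f j)" "continuous_on A (\<sigma> i k)" for A i j k
      using smooth_fun_continuous f \<sigma> by auto
    have ca [continuous_intros]: "continuous_on A (a i j)" for A i j
      unfolding a[abs_def] by (intro continuous_intros)
    have comp [continuous_intros]: "continuous_on A h \<Longrightarrow> continuous_on A (\<lambda>x. f j (h x))"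
      "continuous_on A h \<Longrightarrow> continuous_on A (\<lambda>x. \<sigma> i k (h x))"
      "continuous_on A h \<Longrightarrow> continuous_on A (\<lambda>x. a i j (h x))" for A :: "(real \<times> real) set" and h i j k
      using continuous_on_compose2[OF cont(1)[of UNIV]] continuous_on_compose2[OF cont(2)[of UNIV]]
        continuous_on_compose2[OF ca[of UNIV]] by auto
    note [continuous_intros] = continuous_on_sabs''_diff[OF \<delta>(1)]
    let ?s = "\<lambda>\<tau> \<zeta>. sabs'' \<delta> (\<tau> - \<zeta>)"
    define F where "F = (\<lambda>j. dprim (\<lambda>\<tau> \<zeta>. ?s \<tau> \<zeta> * f j \<tau> - ?s \<tau> \<zeta> * f j \<zeta>) u v)"
    define G where "G = (\<lambda>i j. dprim (\<lambda>\<tau> \<zeta>. \<Sum>k\<in>UNIV. ?s \<tau> \<zeta> * ((\<sigma> i k \<tau> - \<sigma> i k \<zeta>) * (\<sigma> j k \<tau> - \<sigma> j k \<zeta>))) u v)"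
    define H where "H = (\<lambda>i j. dprim (\<lambda>\<tau> \<zeta>. ?s \<tau> \<zeta> * a i j \<tau>) u v + dprim (\<lambda>\<tau> \<zeta>. ?s \<tau> \<zeta> * a i j \<zeta>) u v
       - 2 * (\<Sum>k\<in>UNIV. dprim (\<lambda>\<tau> \<zeta>. ?s \<tau> \<zeta> * \<sigma> i k \<tau> * \<sigma> j k \<zeta>) u v))"
    have F: "F j = dprim (\<lambda>\<tau> \<zeta>. ?s \<tau> \<zeta> * f j \<tau>) u v - dprim (\<lambda>\<tau> \<zeta>. ?s \<tau> \<zeta> * f j \<zeta>) u v" for j
      unfolding F_def by (intro dprim_diff continuous_intros)
    have G: "G i j = dprim (\<lambda>\<tau> \<zeta>. ?s \<tau> \<zeta> * a i j \<tau>) u v + dprim (\<lambda>\<tau> \<zeta>. ?s \<tau> \<zeta> * a i j \<zeta>) u v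
       - ((\<Sum>k\<in>UNIV. dprim (\<lambda>\<tau> \<zeta>. ?s \<tau> \<zeta> * \<sigma> i k \<tau> * \<sigma> j k \<zeta>) u v)
        + (\<Sum>k\<in>UNIV. dprim (\<lambda>\<tau> \<zeta>. ?s \<tau> \<zeta> * \<sigma> j k \<tau> * \<sigma> i k \<zeta>) u v))" for i j
    proof -
      have e0: "(\<lambda>\<tau> \<zeta>. \<Sum>k\<in>UNIV. ?s \<tau> \<zeta> * ((\<sigma> i k \<tau> - \<sigma> i k \<zeta>) * (\<sigma> j k \<tau> - \<sigma> j k \<zeta>))) =
          (\<lambda>\<tau> \<zeta>. (?s \<tau> \<zeta> * a i j \<tau> + ?s \<tau> \<zeta> * a i j \<zeta>)
            - ((\<Sum>k\<in>UNIV. ?s \<tau> \<zeta> * \<sigma> i k \<tau> * \<sigma> j k \<zeta>) + (\<Sum>k\<in>UNIV. ?s \<tau> \<zeta> * \<sigma> j k \<tau> * \<sigma> i k \<zeta>)))"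
        unfolding a sum_distrib_left sum.distrib[symmetric] sum_subtractf[symmetric]
        by (intro ext sum.cong refl) (simp add: algebra_simps)
      have e1: "dprim (\<lambda>\<tau> \<zeta>. (?s \<tau> \<zeta> * a i j \<tau> + ?s \<tau> \<zeta> * a i j \<zeta>)
            - ((\<Sum>k\<in>UNIV. ?s \<tau> \<zeta> * \<sigma> i k \<tau> * \<sigma> j k \<zeta>) + (\<Sum>k\<in>UNIV. ?s \<tau> \<zeta> * \<sigma> j k \<tau> * \<sigma> i k \<zeta>))) u v =
          dprim (\<lambda>\<tau> \<zeta>. ?s \<tau> \<zeta> * a i j \<tau> + ?s \<tau> \<zeta> * a i j \<zeta>) u v
          - dprim (\<lambda>\<tau> \<zeta>. (\<Sum>k\<in>UNIV. ?s \<tau> \<zeta> * \<sigma> i k \<tau> * \<sigma> j k \<zeta>) + (\<Sum>k\<in>UNIV. ?s \<tau> \<zeta> * \<sigma> j k \<tau> * \<sigma> i k \<zeta>)) u v"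
        by (intro dprim_diff continuous_intros)
      have e2: "dprim (\<lambda>\<tau> \<zeta>. ?s \<tau> \<zeta> * a i j \<tau> + ?s \<tau> \<zeta> * a i j \<zeta>) u v =
          dprim (\<lambda>\<tau> \<zeta>. ?s \<tau> \<zeta> * a i j \<tau>) u v + dprim (\<lambda>\<tau> \<zeta>. ?s \<tau> \<zeta> * a i j \<zeta>) u v"
        by (intro dprim_add continuous_intros)
      have e3: "dprim (\<lambda>\<tau> \<zeta>. (\<Sum>k\<in>UNIV. ?s \<tau> \<zeta> * \<sigma> i k \<tau> * \<sigma> j k \<zeta>) + (\<Sum>k\<in>UNIV. ?s \<tau> \<zeta> * \<sigma> j k \<tau> * \<sigma> i k \<zeta>)) u v
        = dprim (\<lambda>\<tau> \<zeta>. \<Sum>k\<in>UNIV. ?s \<tau> \<zeta> * \<sigma> i k \<tau> * \<sigma> j k \<zeta>) u v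
          + dprim (\<lambda>\<tau> \<zeta>. \<Sum>k\<in>UNIV. ?s \<tau> \<zeta> * \<sigma> j k \<tau> * \<sigma> i k \<zeta>) u v"
        by (intro dprim_add continuous_intros)
      have e4: "dprim (\<lambda>\<tau> \<zeta>. \<Sum>k\<in>UNIV. ?s \<tau> \<zeta> * \<sigma> i k \<tau> * \<sigma> j k \<zeta>) u v =
          (\<Sum>k\<in>UNIV. dprim (\<lambda>\<tau> \<zeta>. ?s \<tau> \<zeta> * \<sigma> i k \<tau> * \<sigma> j k \<zeta>) u v)"
        by (intro dprim_sum continuous_intros)
      have e5: "dprim (\<lambda>\<tau> \<zeta>. \<Sum>k\<in>UNIV. ?s \<tau> \<zeta> * \<sigma> j k \<tau> * \<sigma> i k \<zeta>) u v =
          (\<Sum>k\<in>UNIV. dprim (\<lambda>\<tau> \<zeta>. ?s \<tau> \<zeta> * \<sigma> j k \<tau> * \<sigma> i k \<zeta>) u v)"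
        by (intro dprim_sum continuous_intros)
      show ?thesis unfolding G_def e0 e1 e2 e3 e4 e5 ..
    qed
    have asym: "a i j = a j i" for i j unfolding a[abs_def] by (simp add: mult.commute)
    \<comment> \<open>The mixed term in H pairs \<sigma>_ik(\<tau>) with \<sigma>_jk(\<zeta>) and is
      not symmetric in i and j. It is the sum H_ij + H_ji that factors into products of differences,
      and this suffices because \<open>k2\<close> is symmetric.\<close>
    have HG: "H i j + H j i = 2 * G i j" for i j
      unfolding H_def G asym[of j i] by simp
    have "(\<Sum>i\<in>UNIV. \<Sum>j\<in>UNIV. H i j * k2 i j) = (\<Sum>i\<in>UNIV. \<Sum>j\<in>UNIV. H j i * k2 i j)"
      by (subst sum.swap) (simp add: sym)
    then have "2 * (\<Sum>i\<in>UNIV. \<Sum>j\<in>UNIV. H i j * k2 i j) = (\<Sum>i\<in>UNIV. \<Sum>j\<in>UNIV. (H i j + H j i) * k2 i j)"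
      by (simp add: sum.distrib distrib_right)
    also have "\<dots> = 2 * (\<Sum>i\<in>UNIV. \<Sum>j\<in>UNIV. G i j * k2 i j)"
      by (simp add: HG sum_distrib_left mult.assoc)
    finally have HG': "(\<Sum>i\<in>UNIV. \<Sum>j\<in>UNIV. H i j * k2 i j) = (\<Sum>i\<in>UNIV. \<Sum>j\<in>UNIV. G i j * k2 i j)" by simp
    have "?T = - (\<Sum>j\<in>UNIV. F j * k1 j) - (\<Sum>i\<in>UNIV. \<Sum>j\<in>UNIV. H i j * k2 i j)"
      unfolding doubled_flux_def separated_flux_def prim_sabs'_left[OF \<delta>(1) cont(1), where u = u and v = v] prim_sabs'_right[OF \<delta>(1) cont(1), where u = u and v = v]
        prim_sabs'_left[OF \<delta>(1) ca, where u = u and v = v] prim_sabs'_right[OF \<delta>(1) ca, where u = u and v = v] F H_def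
      by (simp add: sum.distrib sum_subtractf algebra_simps)
    then have T: "?T = - (\<Sum>j\<in>UNIV. F j * k1 j) - (\<Sum>i\<in>UNIV. \<Sum>j\<in>UNIV. G i j * k2 i j)"
      unfolding HG' .
    have Fb: "\<bar>F j\<bar> \<le> C * sqrt \<delta>" for j
    proof -
      have "\<bar>F j\<bar> \<le> (c * sqrt \<delta>) * (2 * M + 2) * (2 * M)"
        unfolding F_def
      proof (rule abs_dprim_le[OF \<delta>(1) _ _ uv])
        fix \<tau> \<zeta> :: real assume b: "\<bar>\<tau>\<bar> \<le> M" "\<bar>\<zeta>\<bar> \<le> M"
        have s0: "0 \<le> ?s \<tau> \<zeta>" by (rule sabs''_nonneg[OF \<delta>(1)])
        have "\<bar>?s \<tau> \<zeta> * f j \<tau> - ?s \<tau> \<zeta> * f j \<zeta>\<bar> = ?s \<tau> \<zeta> * \<bar>f j \<tau> - f j \<zeta>\<bar>"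
          using s0 by (simp add: right_diff_distrib[symmetric] abs_mult)
        also have "\<dots> \<le> ?s \<tau> \<zeta> * (L1 * \<bar>\<tau> - \<zeta>\<bar>)" using L1(2)[OF b] s0 by (intro mult_left_mono)
        also have "\<dots> = L1 * (\<bar>\<tau> - \<zeta>\<bar> * ?s \<tau> \<zeta>)" by simp
        also have "\<dots> \<le> c * (sqrt \<delta> * (1 + ?s \<tau> \<zeta>))"
          using s0 by (intro mult_mono[OF c(2) abs_times_sabs''_le[OF \<delta>(1)] c(1)]) simp
        finally show "\<bar>?s \<tau> \<zeta> * f j \<tau> - ?s \<tau> \<zeta> * f j \<zeta>\<bar> \<le> c * sqrt \<delta> * (1 + ?s \<tau> \<zeta>)"
          by (simp add: mult.assoc)
      qed (use c \<delta> in \<open>auto intro!: continuous_intros\<close>)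
      then show ?thesis unfolding C_def M by (simp add: mult_ac)
    qed
    have Gb: "\<bar>G i j\<bar> \<le> C * sqrt \<delta>" for i j
    proof -
      have "\<bar>G i j\<bar> \<le> (c * sqrt \<delta>) * (2 * M + 2) * (2 * M)"
        unfolding G_def
      proof (rule abs_dprim_le[OF \<delta>(1) _ _ uv])
        fix \<tau> \<zeta> :: real assume b: "\<bar>\<tau>\<bar> \<le> M" "\<bar>\<zeta>\<bar> \<le> M"
        have s0: "0 \<le> ?s \<tau> \<zeta>" by (rule sabs''_nonneg[OF \<delta>(1)])
        \<comment> \<open>Two differences are available here, so z^2 \<eta>''(z) \<le> \<delta>
          applies pointwise; the result is weakened to \<open>sqrt \<delta>\<close> below, using
          \<delta> \<le> 1.\<close>
        have "\<bar>?s \<tau> \<zeta> * ((\<sigma> i k \<tau> - \<sigma> i k \<zeta>) * (\<sigma> j k \<tau> - \<sigma> j k \<zeta>))\<bar> \<le> L2\<^sup>2 * \<delta>" for k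
        proof -
          have "\<bar>?s \<tau> \<zeta> * ((\<sigma> i k \<tau> - \<sigma> i k \<zeta>) * (\<sigma> j k \<tau> - \<sigma> j k \<zeta>))\<bar> =
              ?s \<tau> \<zeta> * (\<bar>\<sigma> i k \<tau> - \<sigma> i k \<zeta>\<bar> * \<bar>\<sigma> j k \<tau> - \<sigma> j k \<zeta>\<bar>)"
            using s0 by (simp add: abs_mult)
          also have "\<dots> \<le> ?s \<tau> \<zeta> * ((L2 * \<bar>\<tau> - \<zeta>\<bar>) * (L2 * \<bar>\<tau> - \<zeta>\<bar>))"
            using L2 b s0 by (intro mult_left_mono mult_mono) auto
          also have "\<dots> = L2\<^sup>2 * ((\<tau> - \<zeta>)\<^sup>2 * ?s \<tau> \<zeta>)"
            by (simp add: power2_eq_square mult_ac abs_mult_self_eq)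
          also have "\<dots> \<le> L2\<^sup>2 * \<delta>"
            using square_times_sabs''_le[OF \<delta>(1), of "\<tau> - \<zeta>"] by (intro mult_left_mono) auto
          finally show ?thesis .
        qed
        then have "\<bar>\<Sum>k\<in>UNIV. ?s \<tau> \<zeta> * ((\<sigma> i k \<tau> - \<sigma> i k \<zeta>) * (\<sigma> j k \<tau> - \<sigma> j k \<zeta>))\<bar> \<le> (\<Sum>k\<in>(UNIV :: 'k set). L2\<^sup>2 * \<delta>)"
          by (intro order_trans[OF sum_abs] sum_mono)
        also have "\<dots> = (real CARD('k) * L2\<^sup>2) * (\<delta> * 1)" by simp
        also have "\<dots> \<le> c * (sqrt \<delta> * (1 + ?s \<tau> \<zeta>))"
        proof -
          have "\<delta> = sqrt \<delta> * sqrt \<delta>" using \<delta> by simp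
          also have "\<dots> \<le> sqrt \<delta> * 1" using \<delta> by (intro mult_left_mono) auto
          finally have "\<delta> \<le> sqrt \<delta>" by simp
          then show ?thesis using c s0 \<delta> by (intro mult_mono) auto
        qed
        finally show "\<bar>\<Sum>k\<in>UNIV. ?s \<tau> \<zeta> * ((\<sigma> i k \<tau> - \<sigma> i k \<zeta>) * (\<sigma> j k \<tau> - \<sigma> j k \<zeta>))\<bar> \<le> c * sqrt \<delta> * (1 + ?s \<tau> \<zeta>)"
          by (simp add: mult.assoc)
      qed (use c \<delta> in \<open>auto intro!: continuous_intros\<close>)
      then show ?thesis unfolding C_def M by (simp add: mult_ac)
    qed
    have "\<bar>?T\<bar> \<le> \<bar>\<Sum>j\<in>UNIV. F j * k1 j\<bar> + \<bar>\<Sum>i\<in>UNIV. \<Sum>j\<in>UNIV. G i j * k2 i j\<bar>"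
      unfolding T by linarith
    also have "\<dots> \<le> (\<Sum>j\<in>UNIV. C * sqrt \<delta> * \<bar>k1 j\<bar>) + (\<Sum>i\<in>UNIV. \<Sum>j\<in>UNIV. C * sqrt \<delta> * \<bar>k2 i j\<bar>)"
      by (intro add_mono order_trans[OF sum_abs] sum_mono)
        (auto simp: abs_mult intro!: mult_right_mono Fb Gb)
    finally show ?thesis by (simp add: sum_distrib_left distrib_left)
  qed
  ultimately show ?thesis by blast
qed

subsection \<open>Integration on the time--space product\<close>

lemma smooth_fun_compact_support_bounded:
  assumes "smooth_fun \<theta>" "\<And>t. t \<notin> {a..b} \<Longrightarrow> \<theta> t = 0"
  shows "\<exists>B\<ge>0. \<forall>t. \<bar>\<theta> t\<bar> \<le> B"
proof -
  have "compact (\<theta> ` {a..b})"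
    by (intro compact_continuous_image smooth_fun_continuous assms(1)) simp
  then obtain B where B: "\<And>t. t \<in> {a..b} \<Longrightarrow> \<bar>\<theta> t\<bar> \<le> B"
    by (force dest!: compact_imp_bounded simp: bounded_iff)
  have "\<bar>\<theta> t\<bar> \<le> \<bar>B\<bar>" for t using B[of t] assms(2)[of t] by (cases "t \<in> {a..b}") auto
  then show ?thesis by (intro exI[of _ "\<bar>B\<bar>"]) auto
qed

lemma deriv_zero_outside:
  fixes \<theta> :: "real \<Rightarrow> real"
  assumes "\<And>t. t \<notin> {a..b} \<Longrightarrow> \<theta> t = 0" "t \<notin> {a..b}"
  shows "deriv \<theta> t = 0"
proof -
  have "\<forall>\<^sub>F x in nhds t. \<theta> x = 0"
  proof (rule eventually_mono)
    show "\<forall>\<^sub>F x in nhds t. x \<in> - {a..b}" using assms(2) by (intro eventually_nhds_in_open) auto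
  qed (use assms(1) in auto)
  then have "(\<theta> has_real_derivative 0) (at t)"
    by (rule DERIV_cong_ev[OF refl _ refl, THEN iffD2]) simp
  then show ?thesis by (rule DERIV_imp_deriv)
qed

lemma smooth_fun_measurable: "smooth_fun \<theta> \<Longrightarrow> \<theta> \<in> borel_measurable borel"
  by (intro borel_measurable_continuous_onI smooth_fun_continuous)

abbreviation half_line :: "real measure" where "half_line \<equiv> restrict_space lborel {0<..}"

lemma sigma_finite_half_line: "sigma_finite_measure half_line"
  by (intro sigma_finite_measure_restrict_space lborel.sigma_finite_measure_axioms) simp

lemma half_line_measurable: "f \<in> borel_measurable borel \<Longrightarrow> f \<in> borel_measurable half_line"
  by (intro measurable_restrict_space1) simp

lemma half_line_integrable:
  fixes f :: "real \<Rightarrow> real"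
  assumes "f \<in> borel_measurable borel" "\<And>t. \<bar>f t\<bar> \<le> B * indicator {a..b} t"
  shows "integrable half_line f"
proof -
  have "integrable lborel (\<lambda>t. indicator {0<..} t *\<^sub>R f t)"
  proof (rule Bochner_Integration.integrable_bound)
    show "integrable lborel (\<lambda>t. B * indicator {a..b} t)"
      by (intro integrable_mult_right integrable_real_indicator) (auto simp: emeasure_lborel_Icc_eq)
    show "AE t in lborel. norm (indicator {0<..} t *\<^sub>R f t) \<le> norm (B * indicator {a..b} t)"
    proof (rule AE_I2)
      show "norm (indicator {0<..} t *\<^sub>R f t) \<le> norm (B * indicator {a..b} t)" for t
        using assms(2)[of t] by (auto simp: indicator_def)
    qed
  qed (use assms(1) in measurable)
  then show ?thesis by (subst integrable_restrict_space) auto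
qed

lemma half_line_integral:
  fixes f :: "real \<Rightarrow> real"
  assumes "\<And>t. t \<le> 0 \<Longrightarrow> f t = 0"
  shows "(\<integral>t. f t \<partial>half_line) = (\<integral>t. f t \<partial>lborel)"
proof -
  have "(\<integral>t. f t \<partial>half_line) = (\<integral>t. indicator {0<..} t *\<^sub>R f t \<partial>lborel)"
    by (rule integral_restrict_space) simp
  also have "\<dots> = (\<integral>t. f t \<partial>lborel)"
    using assms by (intro Bochner_Integration.integral_cong) (auto simp: indicator_def)
  finally show ?thesis .
qed

context
  fixes m :: "'d::finite bohr_pt measure"
  assumes haar: "haar_measure m"
begin

lemma tG_space: "space (tG m) = {0<..} \<times> bohr"
  by (simp add: tG_def space_pair_measure space_restrict_space haar_space[OF haar])

lemma tG_pair: "pair_sigma_finite half_line m"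
  using haar_prob_space(3)[OF haar] sigma_finite_half_line by (simp add: pair_sigma_finite_def)

lemma tG_sigma_finite: "sigma_finite_measure (tG m)"
proof -
  interpret pair_sigma_finite half_line m by (rule tG_pair)
  show ?thesis unfolding tG_def by (rule P.sigma_finite_measure_axioms)
qed

lemma tG_tG_pair: "pair_sigma_finite (tG m) (tG m)"
  using tG_sigma_finite by (simp add: pair_sigma_finite_def)

lemma tG_fst_measurable [measurable]: "fst \<in> borel_measurable (tG m)"
  unfolding tG_def
  using measurable_compose[OF measurable_fst half_line_measurable[of "\<lambda>x. x"]] by simp

lemma tG_snd_measurable [measurable]: "snd \<in> measurable (tG m) m"
  unfolding tG_def by simp

lemma tG_product:
  fixes p :: "real \<Rightarrow> real" and q :: "'d bohr_pt \<Rightarrow> real"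
  assumes "integrable half_line p" "integrable m q"
  shows "integrable (tG m) (\<lambda>X. p (fst X) * q (snd X))"
    "(\<integral>X. p (fst X) * q (snd X) \<partial>tG m) = (\<integral>t. p t \<partial>half_line) * (\<integral>x. q x \<partial>m)"
proof -
  interpret pair_sigma_finite half_line m by (rule tG_pair)
  show "integrable (tG m) (\<lambda>X. p (fst X) * q (snd X))"
    "(\<integral>X. p (fst X) * q (snd X) \<partial>tG m) = (\<integral>t. p t \<partial>half_line) * (\<integral>x. q x \<partial>m)"
    unfolding tG_def using integrable_pair_times[OF assms] integral_pair_times[OF assms] by auto
qed

lemma tG_integrable_time:
  fixes p :: "real \<Rightarrow> real"
  assumes "integrable half_line p" shows "integrable (tG m) (\<lambda>X. p (fst X))"
proof -
  have "integrable m (\<lambda>_. 1::real)"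
    using finite_measure.integrable_const[OF haar_prob_space(2)[OF haar]] .
  from tG_product(1)[OF assms this] show ?thesis by simp
qed

lemma tG_tG_integrable_bound:
  fixes P :: "_ \<Rightarrow> real"
  assumes "P \<in> borel_measurable (tG m \<Otimes>\<^sub>M tG m)" "integrable (tG m) p" "integrable (tG m) q"
    "\<And>X Y. X \<in> space (tG m) \<Longrightarrow> Y \<in> space (tG m) \<Longrightarrow> \<bar>P (X, Y)\<bar> \<le> p X * q Y"
  shows "integrable (tG m \<Otimes>\<^sub>M tG m) P"
proof -
  interpret pair_sigma_finite "tG m" "tG m" by (rule tG_tG_pair)
  show ?thesis
  proof (rule Bochner_Integration.integrable_bound[OF integrable_pair_times[OF assms(2,3)] assms(1)])
    show "AE z in tG m \<Otimes>\<^sub>M tG m. norm (P z) \<le> norm (p (fst z) * q (snd z))"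
    proof (rule AE_I2)
      fix z assume "z \<in> space (tG m \<Otimes>\<^sub>M tG m)"
      then have "fst z \<in> space (tG m)" "snd z \<in> space (tG m)" by (auto simp: space_pair_measure)
      from assms(4)[OF this] show "norm (P z) \<le> norm (p (fst z) * q (snd z))" by simp
    qed
  qed
qed

lemma tG_tG_measurable_coords [measurable]:
  "(\<lambda>z. fst (fst z)) \<in> borel_measurable (tG m \<Otimes>\<^sub>M tG m)"
  "(\<lambda>z. fst (snd z)) \<in> borel_measurable (tG m \<Otimes>\<^sub>M tG m)"
  "(\<lambda>z. snd (fst z)) \<in> measurable (tG m \<Otimes>\<^sub>M tG m) m"
  "(\<lambda>z. snd (snd z)) \<in> measurable (tG m \<Otimes>\<^sub>M tG m) m"
  by (rule measurable_compose[OF measurable_fst] measurable_compose[OF measurable_snd];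
      rule tG_fst_measurable tG_snd_measurable)+

lemma tG_tG_measurable_kern [measurable]:
  "(\<lambda>z. kern S k (snd (fst z)) (snd (snd z))) \<in> borel_measurable (tG m \<Otimes>\<^sub>M tG m)"
proof -
  have "(\<lambda>z. (snd (fst z), snd (snd z))) \<in> measurable (tG m \<Otimes>\<^sub>M tG m) (m \<Otimes>\<^sub>M m)"
    by (intro measurable_Pair tG_tG_measurable_coords)
  from measurable_compose[OF this kern_measurable[OF haar]] show ?thesis by simp
qed

end

text \<open>Condition (ii) for products of \<theta>(t) and \<open>trig S c\<close>, with the
  derivatives already evaluated. The solution enters only under integrals, so the condition passes
  to a representative W that is bounded everywhere.\<close>

definition weak_chain_rule ::
  "'d::finite bohr_pt measure \<Rightarrow> ('d \<Rightarrow> 'k::finite \<Rightarrow> real \<Rightarrow> real) \<Rightarrow>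
   (real \<times> 'd bohr_pt \<Rightarrow> real) \<Rightarrow> ('k \<Rightarrow> real \<times> 'd bohr_pt \<Rightarrow> real) \<Rightarrow> bool" where
  "weak_chain_rule m \<sigma> W G \<longleftrightarrow>
    (\<forall>\<psi> k \<theta> a b S c. continuous_on UNIV \<psi> \<longrightarrow> smooth_fun \<theta> \<longrightarrow> 0 < a \<longrightarrow> (\<forall>t. t \<notin> {a..b} \<longrightarrow> \<theta> t = 0) \<longrightarrow>
      (\<integral>X. \<psi> (W X) * G k X * (\<theta> (fst X) * trig S c (snd X)) \<partial>tG m) =
      - (\<integral>X. (\<Sum>i\<in>UNIV. prim (\<lambda>s. \<psi> s * \<sigma> i k s) (W X)
               * (\<theta> (fst X) * trig S (\<lambda>\<xi>. c \<xi> * (\<i> * \<xi> $ i)) (snd X))) \<partial>tG m))"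

text \<open>Condition (iii) for the entropies \<open>sabs \<delta> (s - z)\<close>, with z free so
  that a value of the other solution can be inserted. The factor \<i> \<xi>_j precedes \<i> \<xi>_i
  because \<open>Dop [Dx i, Dx j]\<close> applies \<open>Dx j\<close> first.\<close>

definition weak_entropy_ineq ::
  "'d::finite bohr_pt measure \<Rightarrow> ('d \<Rightarrow> real \<Rightarrow> real) \<Rightarrow> ('d \<Rightarrow> 'd \<Rightarrow> real \<Rightarrow> real) \<Rightarrow>
   (real \<times> 'd bohr_pt \<Rightarrow> real) \<Rightarrow> ('k::finite \<Rightarrow> real \<times> 'd bohr_pt \<Rightarrow> real) \<Rightarrow> bool" where
  "weak_entropy_ineq m f a W G \<longleftrightarrow>
    (\<forall>\<delta> z \<theta> l b S c. 0 < \<delta> \<longrightarrow> smooth_fun \<theta> \<longrightarrow> 0 < l \<longrightarrow> (\<forall>t. t \<notin> {l..b} \<longrightarrow> \<theta> t = 0) \<longrightarrow>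
      (\<forall>t. 0 \<le> \<theta> t) \<longrightarrow> (\<forall>\<omega>\<in>bohr. 0 \<le> trig S c \<omega>) \<longrightarrow>
      (\<integral>X. sabs'' \<delta> (W X - z) * (\<Sum>k\<in>UNIV. (G k X)\<^sup>2) * (\<theta> (fst X) * trig S c (snd X)) \<partial>tG m)
      \<le> (\<integral>X. sabs \<delta> (W X - z) * (deriv \<theta> (fst X) * trig S c (snd X))
          + (\<Sum>j\<in>UNIV. prim (\<lambda>s. sabs' \<delta> (s - z) * f j s) (W X)
               * (\<theta> (fst X) * trig S (\<lambda>\<xi>. c \<xi> * (\<i> * \<xi> $ j)) (snd X)))
          + (\<Sum>i\<in>UNIV. \<Sum>j\<in>UNIV. prim (\<lambda>s. sabs' \<delta> (s - z) * a i j s) (W X)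
               * (\<theta> (fst X) * trig S (\<lambda>\<xi>. c \<xi> * (\<i> * \<xi> $ j) * (\<i> * \<xi> $ i)) (snd X))) \<partial>tG m))"

section \<open>Derivatives of the kernel in either variable\<close>

definition kern1 :: "(real^'d) set \<Rightarrow> (real^'d \<Rightarrow> complex) \<Rightarrow> 'd \<Rightarrow> 'd::finite bohr_pt \<Rightarrow> 'd bohr_pt \<Rightarrow> real" where
  "kern1 S k j = kern S (\<lambda>\<xi>. k \<xi> * (\<i> * \<xi> $ j))"

definition kern2 :: "(real^'d) set \<Rightarrow> (real^'d \<Rightarrow> complex) \<Rightarrow> 'd \<Rightarrow> 'd \<Rightarrow> 'd::finite bohr_pt \<Rightarrow> 'd bohr_pt \<Rightarrow> real" where
  "kern2 S k i j = kern S (\<lambda>\<xi>. k \<xi> * (\<i> * \<xi> $ j) * (\<i> * \<xi> $ i))"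

lemma kern_derivs_fst:
  "trig S (\<lambda>\<xi>. k \<xi> * cnj (y \<xi>) * (\<i> * \<xi> $ j)) x = kern1 S k j x y"
  "trig S (\<lambda>\<xi>. k \<xi> * cnj (y \<xi>) * (\<i> * \<xi> $ j) * (\<i> * \<xi> $ i)) x = kern2 S k i j x y"
  unfolding kern1_def kern2_def kern_eq_trig_fst by (simp_all only: mult_ac)

text \<open>y enters through its inverse, so each derivative in y costs a sign relative to the one
  in x: first derivatives flip, second derivatives agree.\<close>

lemma kern_derivs_snd:
  "trig S (\<lambda>\<xi>. cnj (k \<xi> * x \<xi>) * (\<i> * \<xi> $ j)) y = - kern1 S k j x y"
  "trig S (\<lambda>\<xi>. cnj (k \<xi> * x \<xi>) * (\<i> * \<xi> $ j) * (\<i> * \<xi> $ i)) y = kern2 S k i j x y"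
  unfolding kern1_def kern2_def kern_eq_trig_snd trig_def sum_negf[symmetric]
  by (intro sum.cong refl; simp add: algebra_simps)+

lemma kern1_derivs_snd: "trig S (\<lambda>\<xi>. cnj (k \<xi> * (\<i> * \<xi> $ i) * x \<xi>) * (\<i> * \<xi> $ j)) y = - kern2 S k j i x y"
  using kern_derivs_snd(1)[of S "\<lambda>\<xi>. k \<xi> * (\<i> * \<xi> $ i)" x j y]
  by (simp add: kern1_def kern2_def)

lemma kern2_sym: "kern2 S k i j = kern2 S k j i"
  unfolding kern2_def by (simp add: mult_ac)


subsection \<open>Doubling the variables\<close>

lemma continuous_bounded_on_square:
  fixes \<phi> :: "real \<Rightarrow> real \<Rightarrow> real"
  assumes "continuous_on UNIV (\<lambda>p. \<phi> (fst p) (snd p))"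
  shows "\<exists>B\<ge>0. \<forall>u v. \<bar>u\<bar> \<le> M \<longrightarrow> \<bar>v\<bar> \<le> M \<longrightarrow> \<bar>\<phi> u v\<bar> \<le> B"
proof -
  have "compact ((\<lambda>p. \<phi> (fst p) (snd p)) ` ({-M..M} \<times> {-M..M}))"
    by (intro compact_continuous_image continuous_on_subset[OF assms] compact_Times) auto
  then obtain B where B: "\<And>p. p \<in> {-M..M} \<times> {-M..M} \<Longrightarrow> \<bar>\<phi> (fst p) (snd p)\<bar> \<le> B"
    by (force dest!: compact_imp_bounded simp: bounded_iff)
  have "\<bar>\<phi> u v\<bar> \<le> \<bar>B\<bar>" if "\<bar>u\<bar> \<le> M" "\<bar>v\<bar> \<le> M" for u v
    using B[of "(u, v)"] that by (auto simp: abs_le_iff)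
  then show ?thesis by (intro exI[of _ "\<bar>B\<bar>"]) auto
qed

text \<open>The bounds on U and V hold at every point, so values can be inserted as entropy
  constants and integrability checked without null sets. With \<rho> < l both times stay in
  [l - \<rho>, r + \<rho>], a compact part of (0, \<infinity>). U and V may coincide, as the pair
  (v, v) requires.\<close>

locale doubling =
  fixes m :: "'d::finite bohr_pt measure"
    and f :: "'d \<Rightarrow> real \<Rightarrow> real" and \<sigma> :: "'d \<Rightarrow> 'k::finite \<Rightarrow> real \<Rightarrow> real"
    and a :: "'d \<Rightarrow> 'd \<Rightarrow> real \<Rightarrow> real"
    and U V :: "real \<times> 'd bohr_pt \<Rightarrow> real"
    and G H :: "'k \<Rightarrow> real \<times> 'd bohr_pt \<Rightarrow> real"
    and M l r \<rho> :: real and \<theta> \<kappa> :: "real \<Rightarrow> real"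
    and S :: "(real^'d) set" and K :: "real^'d \<Rightarrow> complex"
  assumes haar: "haar_measure m"
    and smooth_f: "\<And>j. smooth_fun (f j)" and smooth_\<sigma>: "\<And>i k. smooth_fun (\<sigma> i k)"
    and a_def: "\<And>i j s. a i j s = (\<Sum>k\<in>UNIV. \<sigma> i k s * \<sigma> j k s)"
    and U_meas [measurable]: "U \<in> borel_measurable (tG m)" and V_meas [measurable]: "V \<in> borel_measurable (tG m)"
    and UM: "\<And>X. \<bar>U X\<bar> \<le> M" and VM: "\<And>X. \<bar>V X\<bar> \<le> M"
    and G_L2: "\<And>k. L2 (tG m) (G k)" and H_L2: "\<And>k. L2 (tG m) (H k)"
    and chain_U: "weak_chain_rule m \<sigma> U G" and chain_V: "weak_chain_rule m \<sigma> V H"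
    and entropy_U: "weak_entropy_ineq m f a U G" and entropy_V: "weak_entropy_ineq m f a V H"
    and \<theta>: "smooth_fun \<theta>" "\<And>t. 0 \<le> \<theta> t" "\<And>t. t \<notin> {l..r} \<Longrightarrow> \<theta> t = 0"
    and \<kappa>: "smooth_fun \<kappa>" "\<And>t. 0 \<le> \<kappa> t" "\<And>t. t \<notin> {-\<rho>..\<rho>} \<Longrightarrow> \<kappa> t = 0"
    and \<rho>: "0 < \<rho>" "\<rho> < l"
    and S: "finite S"
    and kern_nonneg: "\<And>x y. x \<in> bohr \<Longrightarrow> y \<in> bohr \<Longrightarrow> 0 \<le> kern S K x y"
begin

abbreviation "NN \<equiv> tG m \<Otimes>\<^sub>M tG m"

sublocale pair_sigma_finite "tG m" "tG m" by (rule tG_tG_pair[OF haar])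

lemma smooth_measurable [measurable]:
  "\<theta> \<in> borel_measurable borel" "\<kappa> \<in> borel_measurable borel"
  "deriv \<theta> \<in> borel_measurable borel" "deriv \<kappa> \<in> borel_measurable borel"
  using \<theta>(1) \<kappa>(1) by (auto intro!: smooth_fun_measurable smooth_fun_deriv)

lemma GH_measurable [measurable]: "G k \<in> borel_measurable (tG m)" "H k \<in> borel_measurable (tG m)"
  using G_L2 H_L2 by (auto simp: L2_def)

lemma coord_measurable [measurable]:
  "fst \<in> borel_measurable (tG m)"
  "(\<lambda>z. fst (fst z)) \<in> borel_measurable NN" "(\<lambda>z. fst (snd z)) \<in> borel_measurable NN"
  "(\<lambda>z. kern S k (snd (fst z)) (snd (snd z))) \<in> borel_measurable NN"
  by (rule tG_fst_measurable[OF haar] tG_tG_measurable_coords[OF haar] tG_tG_measurable_kern[OF haar])+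

lemma UV_measurable:
  assumes "continuous_on UNIV (\<lambda>p. \<phi> (fst p) (snd p))"
  shows "(\<lambda>z. \<phi> (U (fst z)) (V (snd z))) \<in> borel_measurable NN"
  using borel_measurable_continuous_Pair[OF _ _ assms, of "\<lambda>z. U (fst z)" NN "\<lambda>z. V (snd z)"] by measurable

definition time_box :: "real \<Rightarrow> real" where "time_box t = indicator {l - \<rho>..r + \<rho>} t"

lemma time_box_integrable: "integrable (tG m) (\<lambda>X. c * time_box (fst X))"
proof -
  have "integrable half_line time_box"
    by (rule half_line_integrable[where B = 1 and a = "l - \<rho>" and b = "r + \<rho>"]) (auto simp: time_box_def[abs_def])
  then show ?thesis using tG_integrable_time[OF haar] by auto
qed

lemma time_box_nonneg: "0 \<le> time_box t" by (simp add: time_box_def)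

text \<open>The derivative of \<open>\<Theta>\<close> in s is \<open>\<Theta>s\<close>, and in t it
  is \<open>\<Theta>t - \<Theta>s\<close>. Adding the two entropy inequalities therefore leaves
  \<open>\<Theta>t\<close>, in which \<kappa> is not differentiated.\<close>

definition "\<Theta> t s = \<theta> t * \<kappa> (s - t)"
definition "\<Theta>s t s = \<theta> t * deriv \<kappa> (s - t)"
definition "\<Theta>t t s = deriv \<theta> t * \<kappa> (s - t)"

definition time_weight :: "(real \<Rightarrow> real \<Rightarrow> real) \<Rightarrow> bool" where
  "time_weight \<tau> \<longleftrightarrow> (\<lambda>z. \<tau> (fst (fst z)) (fst (snd z))) \<in> borel_measurable NN \<and>
     (\<exists>B\<ge>0. \<forall>t s. \<bar>\<tau> t s\<bar> \<le> B * (time_box t * time_box s))"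

lemma time_weights: "time_weight \<Theta>" "time_weight \<Theta>s" "time_weight \<Theta>t"
proof -
  have *: "time_weight (\<lambda>t s. c t * k (s - t))"
    if c: "smooth_fun c" "\<And>t. t \<notin> {l..r} \<Longrightarrow> c t = 0" and k: "smooth_fun k" "\<And>t. t \<notin> {-\<rho>..\<rho>} \<Longrightarrow> k t = 0" for c k
  proof -
    note [measurable] = smooth_fun_measurable[OF c(1)] smooth_fun_measurable[OF k(1)]
    obtain B where B1: "0 \<le> B" "\<And>t. \<bar>c t\<bar> \<le> B"
      using smooth_fun_compact_support_bounded[of c l r, OF c] by auto
    obtain B' where B2: "0 \<le> B'" "\<And>t. \<bar>k t\<bar> \<le> B'"
      using smooth_fun_compact_support_bounded[of k "-\<rho>" \<rho>, OF k] by auto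
    note B = B1 B2
    have "\<bar>c t * k (s - t)\<bar> \<le> (B * B') * (time_box t * time_box s)" for t s
    proof (cases "t \<in> {l..r} \<and> s - t \<in> {-\<rho>..\<rho>}")
      case True
      then have "time_box t = 1" "time_box s = 1" using \<rho> by (auto simp: time_box_def)
      then show ?thesis using B by (auto simp: abs_mult intro!: mult_mono)
    next
      case False
      then have "\<bar>c t * k (s - t)\<bar> = 0" using c(2)[of t] k(2)[of "s - t"] by auto
      moreover have "0 \<le> (B * B') * (time_box t * time_box s)" using B time_box_nonneg by (intro mult_nonneg_nonneg) auto
      ultimately show ?thesis by linarith
    qed
    moreover have "(\<lambda>z. c (fst (fst z)) * k (fst (snd z) - fst (fst z))) \<in> borel_measurable NN"
      by measurable
    ultimately show ?thesis unfolding time_weight_def using B by (auto intro!: exI[of _ "B * B'"])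
  qed
  show "time_weight \<Theta>" unfolding \<Theta>_def[abs_def] by (rule *[OF \<theta>(1,3) \<kappa>(1,3)])
  show "time_weight \<Theta>s" unfolding \<Theta>s_def[abs_def]
    by (rule *[OF \<theta>(1,3) smooth_fun_deriv[OF \<kappa>(1)] deriv_zero_outside[OF \<kappa>(3)]])
  show "time_weight \<Theta>t" unfolding \<Theta>t_def[abs_def]
    by (rule *[OF smooth_fun_deriv[OF \<theta>(1)] deriv_zero_outside[OF \<theta>(3)] \<kappa>(1,3)])
qed

text \<open>p and q stand for 1, for a sum of squares of dissipation functions, or for a single one.
  Integrability over the time window is enough: \<phi>, the time weight and the kernel are bounded,
  and the weight vanishes outside the window.\<close>

lemma weighted_integrable:
  assumes \<phi>: "continuous_on UNIV (\<lambda>p. \<phi> (fst p) (snd p))" and \<tau>: "time_weight \<tau>"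
    and p: "integrable (tG m) (\<lambda>X. p X * time_box (fst X))" and q: "integrable (tG m) (\<lambda>X. q X * time_box (fst X))"
    and pm [measurable]: "p \<in> borel_measurable (tG m)" "q \<in> borel_measurable (tG m)"
  shows "integrable NN (\<lambda>z. \<phi> (U (fst z)) (V (snd z)) * (p (fst z) * q (snd z)) *
    (\<tau> (fst (fst z)) (fst (snd z)) * kern S k (snd (fst z)) (snd (snd z))))"
proof -
  obtain B where B: "0 \<le> B" "\<And>X Y. \<bar>\<phi> (U X) (V Y)\<bar> \<le> B"
    using continuous_bounded_on_square[OF \<phi>, of M] UM VM by blast
  obtain B' where B': "0 \<le> B'" "\<And>t s. \<bar>\<tau> t s\<bar> \<le> B' * (time_box t * time_box s)"
    using \<tau> by (auto simp: time_weight_def)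
  have [measurable]: "(\<lambda>z. \<tau> (fst (fst z)) (fst (snd z))) \<in> borel_measurable NN"
    using \<tau> by (auto simp: time_weight_def)
  note [measurable] = UV_measurable[OF \<phi>]
  let ?C = "\<Sum>\<xi>\<in>S. cmod (k \<xi>)"
  have C: "0 \<le> ?C" by (intro sum_nonneg) auto
  show ?thesis
  proof (rule tG_tG_integrable_bound[OF haar])
    show "integrable (tG m) (\<lambda>X. (B * (B' * ?C)) * \<bar>p X * time_box (fst X)\<bar>)" using p by auto
    show "integrable (tG m) (\<lambda>X. \<bar>q X * time_box (fst X)\<bar>)" using q by auto
    fix X Y assume XY: "X \<in> space (tG m)" "Y \<in> space (tG m)"
    have k: "\<bar>kern S k (snd X) (snd Y)\<bar> \<le> ?C" using XY by (intro kern_bound) (auto simp: tG_space[OF haar])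
    have "\<bar>\<phi> (U X) (V Y) * (p X * q Y) * (\<tau> (fst X) (fst Y) * kern S k (snd X) (snd Y))\<bar>
        = \<bar>\<phi> (U X) (V Y)\<bar> * (\<bar>p X * q Y\<bar> * (\<bar>\<tau> (fst X) (fst Y)\<bar> * \<bar>kern S k (snd X) (snd Y)\<bar>))"
      by (simp add: abs_mult mult.assoc)
    also have "\<dots> \<le> B * (\<bar>p X * q Y\<bar> * ((B' * (time_box (fst X) * time_box (fst Y))) * ?C))"
      using B B' k C time_box_nonneg by (intro mult_mono) auto
    also have "\<dots> = (B * (B' * ?C)) * \<bar>p X * time_box (fst X)\<bar> * \<bar>q Y * time_box (fst Y)\<bar>"
      using time_box_nonneg by (simp add: abs_mult mult_ac)
    finally show "\<bar>\<phi> (U (fst (X, Y))) (V (snd (X, Y))) * (p (fst (X, Y)) * q (snd (X, Y))) *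
        (\<tau> (fst (fst (X, Y))) (fst (snd (X, Y))) * kern S k (snd (fst (X, Y))) (snd (snd (X, Y))))\<bar>
        \<le> (B * (B' * ?C)) * \<bar>p X * time_box (fst X)\<bar> * \<bar>q Y * time_box (fst Y)\<bar>" by simp
  qed measurable
qed

lemma weighted_integrable_1:
  assumes \<phi>: "continuous_on UNIV (\<lambda>p. \<phi> (fst p) (snd p))" and \<tau>: "time_weight \<tau>"
  shows "integrable NN (\<lambda>z. \<phi> (U (fst z)) (V (snd z)) *
    (\<tau> (fst (fst z)) (fst (snd z)) * kern S k (snd (fst z)) (snd (snd z))))"
proof -
  have "integrable (tG m) (\<lambda>X. 1 * time_box (fst X))" by (rule time_box_integrable)
  from weighted_integrable[OF \<phi> \<tau> this this] show ?thesis by simp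
qed

lemmas weighted_integrable_12 =
  weighted_integrable_1[where k = "\<lambda>\<xi>. K \<xi> * (\<i> * \<xi> $ j)" for j, folded kern1_def]
  weighted_integrable_1[where k = "\<lambda>\<xi>. K \<xi> * (\<i> * \<xi> $ j) * (\<i> * \<xi> $ i)" for i j, folded kern2_def]

lemma kern_mean_zero:
  assumes "x \<in> bohr"
  shows "(\<integral>y. kern1 S K j x y \<partial>m) = 0" "(\<integral>y. kern1 S K j y x \<partial>m) = 0"
    "(\<integral>y. kern2 S K i j x y \<partial>m) = 0" "(\<integral>y. kern2 S K i j y x \<partial>m) = 0"
  unfolding kern1_def kern2_def by (simp_all add: haar_integral_kern[OF haar S assms])

text \<open>The point on which \<phi> does not depend is integrated out first. Time and space then
  factor, and the spatial factor is the vanishing mean of the kernel.\<close>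

lemma separated_vanish:
  assumes \<phi>: "continuous_on UNIV \<phi>"
    and k: "\<And>x. x \<in> bohr \<Longrightarrow> (\<integral>y. kern S k x y \<partial>m) = 0" "\<And>x. x \<in> bohr \<Longrightarrow> (\<integral>y. kern S k y x \<partial>m) = 0"
  shows "(\<integral>z. \<phi> (U (fst z)) * (\<Theta> (fst (fst z)) (fst (snd z)) * kern S k (snd (fst z)) (snd (snd z))) \<partial>NN) = 0"
    "(\<integral>z. \<phi> (V (snd z)) * (\<Theta> (fst (fst z)) (fst (snd z)) * kern S k (snd (fst z)) (snd (snd z))) \<partial>NN) = 0"
proof -
  obtain B where B: "0 \<le> B" "\<And>t s. \<bar>\<Theta> t s\<bar> \<le> B * (time_box t * time_box s)"
    using time_weights(1) by (auto simp: time_weight_def)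
  have \<Theta>int: "integrable half_line (\<lambda>s. \<Theta> t s)" "integrable half_line (\<lambda>t. \<Theta> t s)" for s t
  proof -
    have *: "\<bar>\<Theta> t s\<bar> \<le> B * indicator {l - \<rho>..r + \<rho>} t" "\<bar>\<Theta> t s\<bar> \<le> B * indicator {l - \<rho>..r + \<rho>} s" for t s
      using B(2)[of t s] B(1)
      by (cases "t \<in> {l - \<rho>..r + \<rho>}"; cases "s \<in> {l - \<rho>..r + \<rho>}"; simp add: time_box_def)+
    show "integrable half_line (\<lambda>s. \<Theta> t s)" "integrable half_line (\<lambda>t. \<Theta> t s)"
      by (rule half_line_integrable[OF _ *(2)] half_line_integrable[OF _ *(1)];
          unfold \<Theta>_def; measurable)+
  qed
  have kint: "integrable m (\<lambda>y. kern S k x y)" "integrable m (\<lambda>x. kern S k x y)" for x y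
    unfolding kern_eq_trig_snd[of S k x] kern_eq_trig_fst[of S k _ y] by (rule haar_integrable_trig[OF haar])+
  have int: "integrable NN (\<lambda>z. \<phi> (U (fst z)) * (\<Theta> (fst (fst z)) (fst (snd z)) * kern S k (snd (fst z)) (snd (snd z))))"
    by (rule weighted_integrable_1[OF _ time_weights(1), of "\<lambda>u v. \<phi> u"])
      (intro continuous_on_compose2[OF \<phi>] continuous_intros, auto)
  have "(\<integral>z. \<phi> (U (fst z)) * (\<Theta> (fst (fst z)) (fst (snd z)) * kern S k (snd (fst z)) (snd (snd z))) \<partial>NN) =
      (\<integral>X. \<integral>Y. \<phi> (U X) * (\<Theta> (fst X) (fst Y) * kern S k (snd X) (snd Y)) \<partial>tG m \<partial>tG m)"
    using integral_fst'[OF int] by simp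
  also have "\<dots> = (\<integral>X. 0 \<partial>tG m)"
    using k(1) by (intro Bochner_Integration.integral_cong[OF refl])
      (auto simp: tG_product(2)[OF haar \<Theta>int(1) kint(1)] tG_space[OF haar])
  finally show "(\<integral>z. \<phi> (U (fst z)) * (\<Theta> (fst (fst z)) (fst (snd z)) * kern S k (snd (fst z)) (snd (snd z))) \<partial>NN) = 0"
    by simp
  have int: "integrable NN (\<lambda>z. \<phi> (V (snd z)) * (\<Theta> (fst (fst z)) (fst (snd z)) * kern S k (snd (fst z)) (snd (snd z))))"
    by (rule weighted_integrable_1[OF _ time_weights(1), of "\<lambda>u v. \<phi> v"])
      (intro continuous_on_compose2[OF \<phi>] continuous_intros, auto)
  have "(\<integral>z. \<phi> (V (snd z)) * (\<Theta> (fst (fst z)) (fst (snd z)) * kern S k (snd (fst z)) (snd (snd z))) \<partial>NN) =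
      (\<integral>Y. \<integral>X. \<phi> (V Y) * (\<Theta> (fst X) (fst Y) * kern S k (snd X) (snd Y)) \<partial>tG m \<partial>tG m)"
    using integral_snd[of "\<lambda>X Y. \<phi> (V Y) * (\<Theta> (fst X) (fst Y) * kern S k (snd X) (snd Y))"] int
    by (simp add: case_prod_unfold)
  also have "\<dots> = (\<integral>Y. 0 \<partial>tG m)"
    using k(2) by (intro Bochner_Integration.integral_cong[OF refl])
      (auto simp: tG_product(2)[OF haar \<Theta>int(2) kint(2)] tG_space[OF haar])
  finally show "(\<integral>z. \<phi> (V (snd z)) * (\<Theta> (fst (fst z)) (fst (snd z)) * kern S k (snd (fst z)) (snd (snd z))) \<partial>NN) = 0"
    by simp
qed

lemma fst_test:
  "smooth_fun (\<lambda>t. \<Theta> t s)" "t \<notin> {l..r} \<Longrightarrow> \<Theta> t s = 0" "0 \<le> \<Theta> t s"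
  "deriv (\<lambda>t. \<Theta> t s) t = \<Theta>t t s - \<Theta>s t s"
proof -
  have eq: "(\<lambda>t. \<Theta> t s) = (\<lambda>t. \<theta> t * \<kappa> ((-1) * t + s))" by (simp add: \<Theta>_def)
  show "smooth_fun (\<lambda>t. \<Theta> t s)"
    unfolding eq by (intro smooth_fun_mult \<theta> smooth_fun_affine \<kappa>)
  show "t \<notin> {l..r} \<Longrightarrow> \<Theta> t s = 0" "0 \<le> \<Theta> t s" using \<theta> \<kappa> by (auto simp: \<Theta>_def)
  have k: "((\<lambda>t. \<kappa> (s - t)) has_real_derivative deriv \<kappa> (s - t) * (- 1)) (at t)"
    by (rule DERIV_chain2[where f = \<kappa>, OF smooth_fun_DERIV[OF \<kappa>(1)]]) (auto intro!: derivative_eq_intros)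
  show "deriv (\<lambda>t. \<Theta> t s) t = \<Theta>t t s - \<Theta>s t s"
    unfolding \<Theta>_def \<Theta>t_def \<Theta>s_def
    by (intro DERIV_imp_deriv DERIV_cong[OF DERIV_mult[OF smooth_fun_DERIV[OF \<theta>(1)] k]]) simp
qed

lemma snd_test:
  "smooth_fun (\<lambda>s. \<Theta> t s)" "s \<notin> {l - \<rho>..r + \<rho>} \<Longrightarrow> \<Theta> t s = 0"
  "deriv (\<lambda>s. \<Theta> t s) s = \<Theta>s t s"
proof -
  have eq: "(\<lambda>s. \<Theta> t s) = (\<lambda>s. \<theta> t * \<kappa> (1 * s + (- t)))" by (simp add: \<Theta>_def)
  show "smooth_fun (\<lambda>s. \<Theta> t s)"
    unfolding eq by (intro smooth_fun_mult smooth_fun_const smooth_fun_affine \<kappa>)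
  show "\<Theta> t s = 0" if "s \<notin> {l - \<rho>..r + \<rho>}"
  proof -
    have "t \<notin> {l..r} \<or> s - t \<notin> {-\<rho>..\<rho>}" using that by auto
    then show ?thesis using \<theta>(3)[of t] \<kappa>(3)[of "s - t"] by (auto simp: \<Theta>_def)
  qed
  have k: "((\<lambda>s. \<kappa> (s - t)) has_real_derivative deriv \<kappa> (s - t) * 1) (at s)"
    by (rule DERIV_chain2[where f = \<kappa>, OF smooth_fun_DERIV[OF \<kappa>(1)]]) (auto intro!: derivative_eq_intros)
  show "deriv (\<lambda>s. \<Theta> t s) s = \<Theta>s t s"
    unfolding \<Theta>_def \<Theta>s_def
    by (intro DERIV_imp_deriv DERIV_cong[OF DERIV_cmult[OF k]]) simp
qed

lemma iterated_snd:
  fixes P :: "_ \<Rightarrow> real"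
  assumes "integrable NN P"
  shows "(\<integral>Y. \<integral>X. P (X, Y) \<partial>tG m \<partial>tG m) = (\<integral>z. P z \<partial>NN)"
    "integrable (tG m) (\<lambda>Y. \<integral>X. P (X, Y) \<partial>tG m)"
  using integral_snd[of "\<lambda>X Y. P (X, Y)"] integrable_snd[of "\<lambda>X Y. P (X, Y)"] assms by simp_all

lemma iterated_snd_mono:
  fixes P Q :: "_ \<Rightarrow> real"
  assumes "integrable NN P" "integrable NN Q"
    "\<And>Y. Y \<in> space (tG m) \<Longrightarrow> (\<integral>X. P (X, Y) \<partial>tG m) \<le> (\<integral>X. Q (X, Y) \<partial>tG m)"
  shows "(\<integral>z. P z \<partial>NN) \<le> (\<integral>z. Q z \<partial>NN)"
  unfolding iterated_snd(1)[OF assms(1), symmetric] iterated_snd(1)[OF assms(2), symmetric]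
  by (rule integral_mono[OF iterated_snd(2)[OF assms(1)] iterated_snd(2)[OF assms(2)] assms(3)])

lemma iterated_fst_mono:
  fixes P Q :: "_ \<Rightarrow> real"
  assumes "integrable NN P" "integrable NN Q"
    "\<And>X. X \<in> space (tG m) \<Longrightarrow> (\<integral>Y. P (X, Y) \<partial>tG m) \<le> (\<integral>Y. Q (X, Y) \<partial>tG m)"
  shows "(\<integral>z. P z \<partial>NN) \<le> (\<integral>z. Q z \<partial>NN)"
  unfolding integral_fst'[OF assms(1), symmetric] integral_fst'[OF assms(2), symmetric]
  by (rule integral_mono[OF integrable_fst'[OF assms(1)] integrable_fst'[OF assms(2)] assms(3)])

lemma iterated_snd_eq:
  fixes P Q :: "_ \<Rightarrow> real"
  assumes "integrable NN P" "integrable NN Q"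
    "\<And>Y. Y \<in> space (tG m) \<Longrightarrow> (\<integral>X. P (X, Y) \<partial>tG m) = (\<integral>X. Q (X, Y) \<partial>tG m)"
  shows "(\<integral>z. P z \<partial>NN) = (\<integral>z. Q z \<partial>NN)"
  using assms by (intro antisym iterated_snd_mono) auto

lemma iterated_fst_eq:
  fixes P Q :: "_ \<Rightarrow> real"
  assumes "integrable NN P" "integrable NN Q"
    "\<And>X. X \<in> space (tG m) \<Longrightarrow> (\<integral>Y. P (X, Y) \<partial>tG m) = (\<integral>Y. Q (X, Y) \<partial>tG m)"
  shows "(\<integral>z. P z \<partial>NN) = (\<integral>z. Q z \<partial>NN)"
  using assms by (intro antisym iterated_fst_mono) auto

text \<open>First powers are handled by |g| \<le> g^2 + 1 together with the finite measure of the
  time window.\<close>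

lemma square_integrable_time_box:
  assumes "L2 (tG m) g"
  shows "integrable (tG m) (\<lambda>X. (g X)\<^sup>2 * time_box (fst X))" "integrable (tG m) (\<lambda>X. g X * time_box (fst X))"
    "integrable (tG m) (\<lambda>X. - g X * time_box (fst X))"
proof -
  have g: "g \<in> borel_measurable (tG m)" "integrable (tG m) (\<lambda>X. (g X)\<^sup>2)" using assms by (auto simp: L2_def)
  note [measurable] = g(1)
  have bm [measurable]: "(\<lambda>X. time_box (fst X)) \<in> borel_measurable (tG m)" using time_box_integrable[of 1] by auto
  show "integrable (tG m) (\<lambda>X. (g X)\<^sup>2 * time_box (fst X))"
    by (rule Bochner_Integration.integrable_bound[OF g(2)]) (auto simp: time_box_def indicator_def)
  show *: "integrable (tG m) (\<lambda>X. g X * time_box (fst X))"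
  proof (rule Bochner_Integration.integrable_bound[OF Bochner_Integration.integrable_add[OF g(2) time_box_integrable[of 1]]])
    show "AE X in tG m. norm (g X * time_box (fst X)) \<le> norm ((g X)\<^sup>2 + 1 * time_box (fst X))"
    proof (rule AE_I2)
      fix X
      have "2 * \<bar>g X\<bar> \<le> (g X)\<^sup>2 + 1" using sum_squares_bound[of "\<bar>g X\<bar>" 1] by simp
      then have "\<bar>g X\<bar> \<le> (g X)\<^sup>2 + 1" by simp
      then show "norm (g X * time_box (fst X)) \<le> norm ((g X)\<^sup>2 + 1 * time_box (fst X))"
        by (simp add: time_box_def indicator_def)
    qed
  qed measurable
  then show "integrable (tG m) (\<lambda>X. - g X * time_box (fst X))" by simp
qed

definition "w0 z = \<Theta> (fst (fst z)) (fst (snd z)) * kern S K (snd (fst z)) (snd (snd z))"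
definition "w1 j z = \<Theta> (fst (fst z)) (fst (snd z)) * kern1 S K j (snd (fst z)) (snd (snd z))"
definition "w2 i j z = \<Theta> (fst (fst z)) (fst (snd z)) * kern2 S K i j (snd (fst z)) (snd (snd z))"
definition "ws z = \<Theta>s (fst (fst z)) (fst (snd z)) * kern S K (snd (fst z)) (snd (snd z))"
definition "wt z = \<Theta>t (fst (fst z)) (fst (snd z)) * kern S K (snd (fst z)) (snd (snd z))"

section \<open>The inequality at a fixed smoothing parameter\<close>

context
  fixes \<delta> :: real
  assumes \<delta>: "0 < \<delta>"
begin

definition "sabs_flux g u v = prim (\<lambda>s. sabs' \<delta> (s - v) * g s) u"

lemma sabs_continuous: "continuous_on UNIV (sabs \<delta>)" "continuous_on UNIV (sabs' \<delta>)"
  using sabs_DERIV[OF \<delta>] sabs'_DERIV[OF \<delta>]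
  by (auto intro!: continuous_at_imp_continuous_on DERIV_isCont)

lemma a_continuous: "continuous_on UNIV (a i j)"
  unfolding a_def[abs_def] by (intro continuous_intros smooth_fun_continuous smooth_\<sigma>)

lemma sabs_flux_continuous:
  assumes "continuous_on UNIV g"
  shows "continuous_on UNIV (\<lambda>p. sabs_flux g (fst p) (snd p))" "continuous_on UNIV (\<lambda>p. sabs_flux g (snd p) (fst p))"
    "continuous_on UNIV (\<lambda>u. prim (\<lambda>s. sabs' \<delta> s * g s) u)"
  unfolding sabs_flux_def
  by (intro prim_continuous_param continuous_intros continuous_on_compose2[OF sabs_continuous(2)]
      continuous_on_compose2[OF assms]; simp)+

lemma sabs_UV_continuous:
  "continuous_on UNIV (\<lambda>p. sabs \<delta> (fst p - snd p))" "continuous_on UNIV (\<lambda>p. sabs'' \<delta> (fst p - snd p))"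
  by (intro continuous_on_compose2[OF sabs_continuous(1)] continuous_intros continuous_on_sabs''_diff[OF \<delta>]; simp)+

lemma w_integrable:
  assumes "continuous_on UNIV (\<lambda>p. \<phi> (fst p) (snd p))"
  shows "integrable NN (\<lambda>z. \<phi> (U (fst z)) (V (snd z)) * w0 z)" "integrable NN (\<lambda>z. \<phi> (U (fst z)) (V (snd z)) * w1 j z)"
    "integrable NN (\<lambda>z. \<phi> (U (fst z)) (V (snd z)) * w2 i j z)" "integrable NN (\<lambda>z. \<phi> (U (fst z)) (V (snd z)) * ws z)"
    "integrable NN (\<lambda>z. \<phi> (U (fst z)) (V (snd z)) * wt z)"
  unfolding w0_def w1_def w2_def ws_def wt_def
  by (rule weighted_integrable_1[OF assms] weighted_integrable_12[OF assms]; rule time_weights)+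

lemma dissipation_integrable:
  "integrable NN (\<lambda>z. sabs'' \<delta> (U (fst z) - V (snd z)) * (\<Sum>k\<in>UNIV. (G k (fst z))\<^sup>2) * w0 z)"
  "integrable NN (\<lambda>z. sabs'' \<delta> (U (fst z) - V (snd z)) * (\<Sum>k\<in>UNIV. (H k (snd z))\<^sup>2) * w0 z)"
  "integrable NN (\<lambda>z. sabs'' \<delta> (U (fst z) - V (snd z)) * (G k (fst z) * H k (snd z)) * w0 z)"
proof -
  have one: "integrable (tG m) (\<lambda>X. 1 * time_box (fst X))" by (rule time_box_integrable)
  have sq: "integrable (tG m) (\<lambda>X. (\<Sum>k\<in>UNIV. (G k X)\<^sup>2) * time_box (fst X))"
    "integrable (tG m) (\<lambda>X. (\<Sum>k\<in>UNIV. (H k X)\<^sup>2) * time_box (fst X))"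
    unfolding sum_distrib_right
    by (intro Bochner_Integration.integrable_sum square_integrable_time_box G_L2 H_L2)+
  note wi = weighted_integrable[where \<phi> = "\<lambda>u v. sabs'' \<delta> (u - v)" and k = K, OF sabs_UV_continuous(2) time_weights(1)]
  show "integrable NN (\<lambda>z. sabs'' \<delta> (U (fst z) - V (snd z)) * (\<Sum>k\<in>UNIV. (G k (fst z))\<^sup>2) * w0 z)"
    using wi[OF sq(1) one] by (simp add: w0_def)
  show "integrable NN (\<lambda>z. sabs'' \<delta> (U (fst z) - V (snd z)) * (\<Sum>k\<in>UNIV. (H k (snd z))\<^sup>2) * w0 z)"
    using wi[OF one sq(2)] by (simp add: w0_def)
  show "integrable NN (\<lambda>z. sabs'' \<delta> (U (fst z) - V (snd z)) * (G k (fst z) * H k (snd z)) * w0 z)"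
    using wi[OF square_integrable_time_box(2)[OF G_L2] square_integrable_time_box(2)[OF H_L2]] by (simp add: w0_def)
qed

text \<open>The entropy inequality of U for each frozen Y, integrated over Y. The term with
  \<open>ws\<close> appears because t enters the test function through \<kappa>(s - t) as well as
  through \<theta>.\<close>

lemma first_inequality:
  "(\<integral>z. sabs'' \<delta> (U (fst z) - V (snd z)) * (\<Sum>k\<in>UNIV. (G k (fst z))\<^sup>2) * w0 z \<partial>NN) \<le>
   (\<integral>z. (sabs \<delta> (U (fst z) - V (snd z)) * wt z - sabs \<delta> (U (fst z) - V (snd z)) * ws z)
      + (\<Sum>j\<in>UNIV. sabs_flux (f j) (U (fst z)) (V (snd z)) * w1 j z)
      + (\<Sum>i\<in>UNIV. \<Sum>j\<in>UNIV. sabs_flux (a i j) (U (fst z)) (V (snd z)) * w2 i j z) \<partial>NN)"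
proof (rule iterated_snd_mono[OF dissipation_integrable(1)])
  show "integrable NN (\<lambda>z. (sabs \<delta> (U (fst z) - V (snd z)) * wt z - sabs \<delta> (U (fst z) - V (snd z)) * ws z)
      + (\<Sum>j\<in>UNIV. sabs_flux (f j) (U (fst z)) (V (snd z)) * w1 j z)
      + (\<Sum>i\<in>UNIV. \<Sum>j\<in>UNIV. sabs_flux (a i j) (U (fst z)) (V (snd z)) * w2 i j z))"
    by (intro Bochner_Integration.integrable_add Bochner_Integration.integrable_diff
        Bochner_Integration.integrable_sum w_integrable[OF sabs_flux_continuous(1)[OF smooth_fun_continuous[OF smooth_f]]]
        w_integrable[OF sabs_flux_continuous(1)[OF a_continuous]]
        w_integrable[where \<phi> = "\<lambda>u v. sabs \<delta> (u - v)", OF sabs_UV_continuous(1)])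
  fix Y assume "Y \<in> space (tG m)"
  then have y: "snd Y \<in> bohr" by (auto simp: tG_space[OF haar])
  have "\<forall>\<omega>\<in>bohr. 0 \<le> trig S (\<lambda>\<xi>. K \<xi> * cnj (snd Y \<xi>)) \<omega>"
    using kern_nonneg[OF _ y] by (simp add: kern_eq_trig_fst)
  moreover have "\<forall>t. t \<notin> {l..r} \<longrightarrow> \<Theta> t (fst Y) = 0" "\<forall>t. 0 \<le> \<Theta> t (fst Y)" "0 < l"
    using fst_test(2,3) \<rho> by auto
  ultimately have "(\<integral>X. sabs'' \<delta> (U X - V Y) * (\<Sum>k\<in>UNIV. (G k X)\<^sup>2) * (\<Theta> (fst X) (fst Y) * trig S (\<lambda>\<xi>. K \<xi> * cnj (snd Y \<xi>)) (snd X)) \<partial>tG m)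
      \<le> (\<integral>X. sabs \<delta> (U X - V Y) * (deriv (\<lambda>t. \<Theta> t (fst Y)) (fst X) * trig S (\<lambda>\<xi>. K \<xi> * cnj (snd Y \<xi>)) (snd X))
          + (\<Sum>j\<in>UNIV. prim (\<lambda>s. sabs' \<delta> (s - V Y) * f j s) (U X)
               * (\<Theta> (fst X) (fst Y) * trig S (\<lambda>\<xi>. K \<xi> * cnj (snd Y \<xi>) * (\<i> * \<xi> $ j)) (snd X)))
          + (\<Sum>i\<in>UNIV. \<Sum>j\<in>UNIV. prim (\<lambda>s. sabs' \<delta> (s - V Y) * a i j s) (U X)
               * (\<Theta> (fst X) (fst Y) * trig S (\<lambda>\<xi>. K \<xi> * cnj (snd Y \<xi>) * (\<i> * \<xi> $ j) * (\<i> * \<xi> $ i)) (snd X))) \<partial>tG m)"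
    using entropy_U[unfolded weak_entropy_ineq_def, rule_format, OF \<delta> fst_test(1)[of "fst Y"]] by blast
  then show "(\<integral>X. sabs'' \<delta> (U (fst (X, Y)) - V (snd (X, Y))) * (\<Sum>k\<in>UNIV. (G k (fst (X, Y)))\<^sup>2) * w0 (X, Y) \<partial>tG m) \<le>
    (\<integral>X. (sabs \<delta> (U (fst (X, Y)) - V (snd (X, Y))) * wt (X, Y) - sabs \<delta> (U (fst (X, Y)) - V (snd (X, Y))) * ws (X, Y))
      + (\<Sum>j\<in>UNIV. sabs_flux (f j) (U (fst (X, Y))) (V (snd (X, Y))) * w1 j (X, Y))
      + (\<Sum>i\<in>UNIV. \<Sum>j\<in>UNIV. sabs_flux (a i j) (U (fst (X, Y))) (V (snd (X, Y))) * w2 i j (X, Y)) \<partial>tG m)"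
    unfolding kern_derivs_fst kern_eq_trig_fst[symmetric] fst_test(4) w0_def w1_def w2_def ws_def wt_def sabs_flux_def fst_conv snd_conv
    by (simp only: left_diff_distrib right_diff_distrib)
qed

text \<open>The counterpart with X frozen. \<open>sabs\<close> and \<open>sabs''\<close> are even,
  so the integrands match those of the first inequality; differentiating the kernel in y gives the
  first order flux its minus sign.\<close>

lemma second_inequality:
  "(\<integral>z. sabs'' \<delta> (U (fst z) - V (snd z)) * (\<Sum>k\<in>UNIV. (H k (snd z))\<^sup>2) * w0 z \<partial>NN) \<le>
   (\<integral>z. sabs \<delta> (U (fst z) - V (snd z)) * ws z
      - (\<Sum>j\<in>UNIV. sabs_flux (f j) (V (snd z)) (U (fst z)) * w1 j z)
      + (\<Sum>i\<in>UNIV. \<Sum>j\<in>UNIV. sabs_flux (a i j) (V (snd z)) (U (fst z)) * w2 i j z) \<partial>NN)"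
proof (rule iterated_fst_mono[OF dissipation_integrable(2)])
  show "integrable NN (\<lambda>z. sabs \<delta> (U (fst z) - V (snd z)) * ws z
      - (\<Sum>j\<in>UNIV. sabs_flux (f j) (V (snd z)) (U (fst z)) * w1 j z)
      + (\<Sum>i\<in>UNIV. \<Sum>j\<in>UNIV. sabs_flux (a i j) (V (snd z)) (U (fst z)) * w2 i j z))"
    by (intro Bochner_Integration.integrable_add Bochner_Integration.integrable_diff
        Bochner_Integration.integrable_sum
        w_integrable[where \<phi> = "\<lambda>u v. sabs_flux (f j) v u" for j, OF sabs_flux_continuous(2)[OF smooth_fun_continuous[OF smooth_f]]]
        w_integrable[where \<phi> = "\<lambda>u v. sabs_flux (a i j) v u" for i j, OF sabs_flux_continuous(2)[OF a_continuous]]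
        w_integrable[where \<phi> = "\<lambda>u v. sabs \<delta> (u - v)", OF sabs_UV_continuous(1)])
  fix X assume "X \<in> space (tG m)"
  then have x: "snd X \<in> bohr" by (auto simp: tG_space[OF haar])
  have "\<forall>\<omega>\<in>bohr. 0 \<le> trig S (\<lambda>\<xi>. cnj (K \<xi> * snd X \<xi>)) \<omega>"
    using kern_nonneg[OF x] by (simp only: kern_eq_trig_snd) blast
  moreover have "\<forall>s. s \<notin> {l - \<rho>..r + \<rho>} \<longrightarrow> \<Theta> (fst X) s = 0" "\<forall>s. 0 \<le> \<Theta> (fst X) s" "0 < l - \<rho>"
    using snd_test(2) fst_test(3) \<rho> by auto
  ultimately have "(\<integral>Y. sabs'' \<delta> (V Y - U X) * (\<Sum>k\<in>UNIV. (H k Y)\<^sup>2) * (\<Theta> (fst X) (fst Y) * trig S (\<lambda>\<xi>. cnj (K \<xi> * snd X \<xi>)) (snd Y)) \<partial>tG m)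
      \<le> (\<integral>Y. sabs \<delta> (V Y - U X) * (deriv (\<lambda>s. \<Theta> (fst X) s) (fst Y) * trig S (\<lambda>\<xi>. cnj (K \<xi> * snd X \<xi>)) (snd Y))
          + (\<Sum>j\<in>UNIV. prim (\<lambda>s. sabs' \<delta> (s - U X) * f j s) (V Y)
               * (\<Theta> (fst X) (fst Y) * trig S (\<lambda>\<xi>. cnj (K \<xi> * snd X \<xi>) * (\<i> * \<xi> $ j)) (snd Y)))
          + (\<Sum>i\<in>UNIV. \<Sum>j\<in>UNIV. prim (\<lambda>s. sabs' \<delta> (s - U X) * a i j s) (V Y)
               * (\<Theta> (fst X) (fst Y) * trig S (\<lambda>\<xi>. cnj (K \<xi> * snd X \<xi>) * (\<i> * \<xi> $ j) * (\<i> * \<xi> $ i)) (snd Y))) \<partial>tG m)"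
    using entropy_V[unfolded weak_entropy_ineq_def, rule_format, OF \<delta> snd_test(1)[of "fst X"]] by blast
  then show "(\<integral>Y. sabs'' \<delta> (U (fst (X, Y)) - V (snd (X, Y))) * (\<Sum>k\<in>UNIV. (H k (snd (X, Y)))\<^sup>2) * w0 (X, Y) \<partial>tG m) \<le>
    (\<integral>Y. sabs \<delta> (U (fst (X, Y)) - V (snd (X, Y))) * ws (X, Y)
      - (\<Sum>j\<in>UNIV. sabs_flux (f j) (V (snd (X, Y))) (U (fst (X, Y))) * w1 j (X, Y))
      + (\<Sum>i\<in>UNIV. \<Sum>j\<in>UNIV. sabs_flux (a i j) (V (snd (X, Y))) (U (fst (X, Y))) * w2 i j (X, Y)) \<partial>tG m)"
    unfolding kern_derivs_snd kern_eq_trig_snd[symmetric] snd_test(3) w0_def w1_def w2_def ws_def sabs_flux_def fst_conv snd_conv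
      sabs_minus[OF \<delta>, of "V _" "U X"] sabs''_minus[OF \<delta>, of "V _" "U X"]
    by (simp only: mult_minus_right sum_negf diff_conv_add_uminus)
qed

definition "cross_flux k i j u v = dprim (\<lambda>\<tau> \<zeta>. sabs'' \<delta> (\<tau> - \<zeta>) * \<sigma> i k \<tau> * \<sigma> j k \<zeta>) u v"

lemma cross_flux_continuous: "continuous_on UNIV (\<lambda>p. cross_flux k i j (fst p) (snd p))"
  unfolding cross_flux_def
  by (intro continuous_on_dprim continuous_intros continuous_on_sabs''_diff[OF \<delta>]
      continuous_on_compose2[OF smooth_fun_continuous[OF smooth_\<sigma>, of UNIV]]; simp)

text \<open>With Y frozen, the chain rule for U with \<psi> = \<eta>''(. - V(Y)) moves one
  derivative to the kernel and leaves the flux J. With X frozen, J(U(X), .) is continuous, hence a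
  legitimate \<psi> for the chain rule of V, which yields the double primitive. Each use contributes
  a sign and so does the derivative in y: three in all, hence the minus.\<close>

lemma cross_term:
  "(\<integral>z. sabs'' \<delta> (U (fst z) - V (snd z)) * (G k (fst z) * H k (snd z)) * w0 z \<partial>NN) =
   - (\<integral>z. (\<Sum>i\<in>UNIV. \<Sum>j\<in>UNIV. cross_flux k i j (U (fst z)) (V (snd z)) * w2 i j z) \<partial>NN)"
proof -
  define J where "J i u v = prim (\<lambda>\<tau>. sabs'' \<delta> (\<tau> - v) * \<sigma> i k \<tau>) u" for i u v
  have Jc: "continuous_on UNIV (\<lambda>p. J i (fst p) (snd p))" for i
    unfolding J_def
    by (intro prim_continuous_param continuous_intros continuous_on_sabs''_diff[OF \<delta>]
      continuous_on_compose2[OF smooth_fun_continuous[OF smooth_\<sigma>, of UNIV]]; simp)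
  have \<psi>c: "continuous_on UNIV (\<lambda>s. sabs'' \<delta> (s - v))" "continuous_on UNIV (\<lambda>\<zeta>. J i u \<zeta>)" for i u v
    by (intro continuous_on_sabs''_diff[OF \<delta>] continuous_intros)
      (rule continuous_on_compose2[OF Jc, of _ "\<lambda>\<zeta>. (u, \<zeta>)", simplified], intro continuous_intros)
  have one: "integrable (tG m) (\<lambda>X. 1 * time_box (fst X))" by (rule time_box_integrable)
  define Q where "Q i z = J i (U (fst z)) (V (snd z)) * (- H k (snd z)) * w1 i z" for i z
  have Qi: "integrable NN (Q i)" for i
    using weighted_integrable[where \<phi> = "J i" and k = "\<lambda>\<xi>. K \<xi> * (\<i> * \<xi> $ i)", OF Jc time_weights(1) one square_integrable_time_box(3)[OF H_L2, of k]]
    by (simp add: Q_def[abs_def] w1_def kern1_def)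
  have "(\<integral>z. sabs'' \<delta> (U (fst z) - V (snd z)) * (G k (fst z) * H k (snd z)) * w0 z \<partial>NN) = (\<integral>z. (\<Sum>i\<in>UNIV. Q i z) \<partial>NN)"
  proof (rule iterated_snd_eq[OF dissipation_integrable(3)])
    show "integrable NN (\<lambda>z. \<Sum>i\<in>UNIV. Q i z)" using Qi by auto
    fix Y assume "Y \<in> space (tG m)"
    have th: "\<forall>t. t \<notin> {l..r} \<longrightarrow> \<Theta> t (fst Y) = 0" "0 < l" using fst_test(2) \<rho> by auto
    have "(\<integral>X. sabs'' \<delta> (U X - V Y) * (G k X * H k Y) * w0 (X, Y) \<partial>tG m) =
        (\<integral>X. H k Y * (sabs'' \<delta> (U X - V Y) * G k X * w0 (X, Y)) \<partial>tG m)"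
      by (simp add: mult_ac)
    also have "\<dots> = H k Y * (\<integral>X. sabs'' \<delta> (U X - V Y) * G k X * w0 (X, Y) \<partial>tG m)" by simp
    also have "(\<integral>X. sabs'' \<delta> (U X - V Y) * G k X * w0 (X, Y) \<partial>tG m) =
        - (\<integral>X. (\<Sum>i\<in>UNIV. J i (U X) (V Y) * w1 i (X, Y)) \<partial>tG m)"
      using chain_U[unfolded weak_chain_rule_def, rule_format, OF \<psi>c(1)[of "V Y"] fst_test(1)[of "fst Y"] th(2),
          of r k S "\<lambda>\<xi>. K \<xi> * cnj (snd Y \<xi>)"] th(1)
      unfolding kern_derivs_fst kern_eq_trig_fst[symmetric] by (simp add: w0_def w1_def J_def)
    also have "H k Y * - (\<integral>X. (\<Sum>i\<in>UNIV. J i (U X) (V Y) * w1 i (X, Y)) \<partial>tG m) =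
        (\<integral>X. (- H k Y) * (\<Sum>i\<in>UNIV. J i (U X) (V Y) * w1 i (X, Y)) \<partial>tG m)" by simp
    also have "\<dots> = (\<integral>X. (\<Sum>i\<in>UNIV. Q i (X, Y)) \<partial>tG m)"
      unfolding Q_def sum_distrib_left by (simp add: mult_ac)
    finally show "(\<integral>X. sabs'' \<delta> (U (fst (X, Y)) - V (snd (X, Y))) * (G k (fst (X, Y)) * H k (snd (X, Y))) * w0 (X, Y) \<partial>tG m) =
        (\<integral>X. (\<Sum>i\<in>UNIV. Q i (X, Y)) \<partial>tG m)" by simp
  qed
  also have "\<dots> = (\<Sum>i\<in>UNIV. \<integral>z. Q i z \<partial>NN)" using Qi by simp
  also have "\<dots> = (\<Sum>i\<in>UNIV. - (\<integral>z. (\<Sum>j\<in>UNIV. cross_flux k i j (U (fst z)) (V (snd z)) * w2 i j z) \<partial>NN))"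
  proof (intro sum.cong refl)
    fix i
    have di: "integrable NN (\<lambda>z. - (\<Sum>j\<in>UNIV. cross_flux k i j (U (fst z)) (V (snd z)) * w2 i j z))"
      by (intro Bochner_Integration.integrable_minus Bochner_Integration.integrable_sum w_integrable cross_flux_continuous)
    have "(\<integral>z. Q i z \<partial>NN) = (\<integral>z. - (\<Sum>j\<in>UNIV. cross_flux k i j (U (fst z)) (V (snd z)) * w2 i j z) \<partial>NN)"
    proof (rule iterated_fst_eq[OF Qi di])
      fix X assume "X \<in> space (tG m)"
      have th: "\<forall>s. s \<notin> {l - \<rho>..r + \<rho>} \<longrightarrow> \<Theta> (fst X) s = 0" "0 < l - \<rho>" using snd_test(2) \<rho> by auto
      have pd: "prim (\<lambda>s. J i u s * \<sigma> j k s) v = cross_flux k i j u v" for j u v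
      proof -
        have "prim (\<lambda>\<tau>. sabs'' \<delta> (\<tau> - \<zeta>) * \<sigma> i k \<tau> * \<sigma> j k \<zeta>) u = J i u \<zeta> * \<sigma> j k \<zeta>" for \<zeta>
          using prim_cmult[of "\<lambda>\<tau>. sabs'' \<delta> (\<tau> - \<zeta>) * \<sigma> i k \<tau>" "\<sigma> j k \<zeta>" u]
            continuous_on_mult[OF \<psi>c(1)[of \<zeta>] smooth_fun_continuous[OF smooth_\<sigma>[of i k]]]
          by (simp add: J_def mult.commute)
        then show ?thesis by (simp add: cross_flux_def dprim_def)
      qed
      have "(\<integral>Y. Q i (X, Y) \<partial>tG m) = - (\<integral>Y. J i (U X) (V Y) * H k Y * w1 i (X, Y) \<partial>tG m)"
        by (simp add: Q_def)
      also have "(\<integral>Y. J i (U X) (V Y) * H k Y * w1 i (X, Y) \<partial>tG m) =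
          - (\<integral>Y. (\<Sum>j\<in>UNIV. cross_flux k i j (U X) (V Y) * (- w2 j i (X, Y))) \<partial>tG m)"
        using chain_V[unfolded weak_chain_rule_def, rule_format, OF \<psi>c(2)[of i "U X"] snd_test(1)[of "fst X"] th(2),
            of "r + \<rho>" k S "\<lambda>\<xi>. cnj (K \<xi> * (\<i> * \<xi> $ i) * snd X \<xi>)"] th(1)
        unfolding kern1_derivs_snd kern_eq_trig_snd[symmetric] pd kern1_def[symmetric] by (simp add: w1_def w2_def)
      finally show "(\<integral>Y. Q i (X, Y) \<partial>tG m) =
          (\<integral>Y. - (\<Sum>j\<in>UNIV. cross_flux k i j (U (fst (X, Y))) (V (snd (X, Y))) * w2 i j (X, Y)) \<partial>tG m)"
        by (simp add: w2_def kern2_sym[of S K _ i] sum_negf)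
    qed
    then show "(\<integral>z. Q i z \<partial>NN) = - (\<integral>z. (\<Sum>j\<in>UNIV. cross_flux k i j (U (fst z)) (V (snd z)) * w2 i j z) \<partial>NN)" by simp
  qed
  also have "\<dots> = - (\<Sum>i\<in>UNIV. \<integral>z. (\<Sum>j\<in>UNIV. cross_flux k i j (U (fst z)) (V (snd z)) * w2 i j z) \<partial>NN)"
    by (simp add: sum_negf)
  also have "(\<Sum>i\<in>UNIV. \<integral>z. (\<Sum>j\<in>UNIV. cross_flux k i j (U (fst z)) (V (snd z)) * w2 i j z) \<partial>NN) =
      (\<integral>z. (\<Sum>i\<in>UNIV. \<Sum>j\<in>UNIV. cross_flux k i j (U (fst z)) (V (snd z)) * w2 i j z) \<partial>NN)"
    by (intro Bochner_Integration.integral_sum[symmetric] Bochner_Integration.integrable_sum w_integrable cross_flux_continuous)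
  finally show ?thesis .
qed

lemma w1_w2_integrable: "integrable NN (w1 j)" "integrable NN (w2 i j)" "integrable NN wt"
  using w_integrable(2,3,5)[where \<phi> = "\<lambda>u v. 1"] by (auto simp: continuous_on_const)

text \<open>This is \<open>doubled_flux\<close> at the two solutions, with \<open>w1\<close> and
  \<open>w2\<close> as kernel derivatives.\<close>

definition "remainder z =
   (\<Sum>j\<in>UNIV. (sabs_flux (f j) (U (fst z)) (V (snd z)) - sabs_flux (f j) (V (snd z)) (U (fst z))) * w1 j z)
   + (\<Sum>i\<in>UNIV. \<Sum>j\<in>UNIV. (sabs_flux (a i j) (U (fst z)) (V (snd z)) + sabs_flux (a i j) (V (snd z)) (U (fst z))
       + 2 * (\<Sum>k\<in>UNIV. cross_flux k i j (U (fst z)) (V (snd z)))) * w2 i j z)"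

lemma remainder_pieces:
  "integrable NN (\<lambda>z. \<Sum>j\<in>UNIV. sabs_flux (f j) (U (fst z)) (V (snd z)) * w1 j z)"
  "integrable NN (\<lambda>z. \<Sum>j\<in>UNIV. sabs_flux (f j) (V (snd z)) (U (fst z)) * w1 j z)"
  "integrable NN (\<lambda>z. \<Sum>i\<in>UNIV. \<Sum>j\<in>UNIV. sabs_flux (a i j) (U (fst z)) (V (snd z)) * w2 i j z)"
  "integrable NN (\<lambda>z. \<Sum>i\<in>UNIV. \<Sum>j\<in>UNIV. sabs_flux (a i j) (V (snd z)) (U (fst z)) * w2 i j z)"
  "integrable NN (\<lambda>z. \<Sum>i\<in>UNIV. \<Sum>j\<in>UNIV. cross_flux k i j (U (fst z)) (V (snd z)) * w2 i j z)"
  by (intro Bochner_Integration.integrable_sum cross_flux_continuous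
      w_integrable[OF sabs_flux_continuous(1)[OF smooth_fun_continuous[OF smooth_f]]]
      w_integrable[OF sabs_flux_continuous(1)[OF a_continuous]]
      w_integrable[where \<phi> = "\<lambda>u v. sabs_flux (f j) v u" for j, OF sabs_flux_continuous(2)[OF smooth_fun_continuous[OF smooth_f]]]
      w_integrable[where \<phi> = "\<lambda>u v. sabs_flux (a i j) v u" for i j, OF sabs_flux_continuous(2)[OF a_continuous]]
      w_integrable[OF cross_flux_continuous])+

lemma remainder_eq:
  "remainder z = (\<Sum>j\<in>UNIV. sabs_flux (f j) (U (fst z)) (V (snd z)) * w1 j z)
     - (\<Sum>j\<in>UNIV. sabs_flux (f j) (V (snd z)) (U (fst z)) * w1 j z)
     + (\<Sum>i\<in>UNIV. \<Sum>j\<in>UNIV. sabs_flux (a i j) (U (fst z)) (V (snd z)) * w2 i j z)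
     + (\<Sum>i\<in>UNIV. \<Sum>j\<in>UNIV. sabs_flux (a i j) (V (snd z)) (U (fst z)) * w2 i j z)
     + 2 * (\<Sum>k\<in>UNIV. \<Sum>i\<in>UNIV. \<Sum>j\<in>UNIV. cross_flux k i j (U (fst z)) (V (snd z)) * w2 i j z)"
proof -
  have "(\<Sum>k\<in>UNIV. \<Sum>i\<in>UNIV. \<Sum>j\<in>UNIV. cross_flux k i j (U (fst z)) (V (snd z)) * w2 i j z) =
      (\<Sum>i\<in>UNIV. \<Sum>j\<in>UNIV. (\<Sum>k\<in>UNIV. cross_flux k i j (U (fst z)) (V (snd z))) * w2 i j z)"
    unfolding sum_distrib_right by (subst sum.swap, intro sum.cong refl sum.swap)
  then show ?thesis
    unfolding remainder_def
    by (simp add: left_diff_distrib distrib_right sum_subtractf sum.distrib sum_distrib_left[symmetric] mult.assoc)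
qed

lemma remainder_integrable: "integrable NN remainder"
  unfolding remainder_eq[abs_def]
  by (intro Bochner_Integration.integrable_add Bochner_Integration.integrable_diff remainder_pieces
      integrable_mult_right Bochner_Integration.integrable_sum[of UNIV])

text \<open>2 G H \<le> G^2 + H^2, weighted by the nonnegative \<eta>'' \<open>w0\<close> and summed
  over k, bounds the dissipation from below by the mixed terms, and \<open>cross_term\<close> turns
  these into fluxes. The \<open>ws\<close> parts of the two inequalities cancel.\<close>

lemma regularised_inequality:
  "0 \<le> (\<integral>z. sabs \<delta> (U (fst z) - V (snd z)) * wt z \<partial>NN) + (\<integral>z. remainder z \<partial>NN)"
proof -
  let ?D = "\<lambda>z. sabs'' \<delta> (U (fst z) - V (snd z))"
  let ?G = "\<lambda>z. ?D z * (\<Sum>k\<in>UNIV. (G k (fst z))\<^sup>2) * w0 z"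
  let ?H = "\<lambda>z. ?D z * (\<Sum>k\<in>UNIV. (H k (snd z))\<^sup>2) * w0 z"
  let ?X = "\<lambda>k z. ?D z * (G k (fst z) * H k (snd z)) * w0 z"
  let ?cross_flux = "\<lambda>k z. \<Sum>i\<in>UNIV. \<Sum>j\<in>UNIV. cross_flux k i j (U (fst z)) (V (snd z)) * w2 i j z"
  note s_int = w_integrable[where \<phi> = "\<lambda>u v. sabs \<delta> (u - v)", OF sabs_UV_continuous(1)]
  have "(\<integral>z. 2 * (\<Sum>k\<in>UNIV. ?X k z) \<partial>NN) \<le> (\<integral>z. ?G z + ?H z \<partial>NN)"
  proof (rule integral_mono)
    show "integrable NN (\<lambda>z. 2 * (\<Sum>k\<in>UNIV. ?X k z))"
      by (intro integrable_mult_right Bochner_Integration.integrable_sum dissipation_integrable)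
    show "integrable NN (\<lambda>z. ?G z + ?H z)"
      by (intro Bochner_Integration.integrable_add dissipation_integrable)
    fix z assume "z \<in> space NN"
    then have z: "snd (fst z) \<in> bohr" "snd (snd z) \<in> bohr" by (auto simp: space_pair_measure tG_space[OF haar])
    have w: "0 \<le> ?D z * w0 z"
      unfolding w0_def using fst_test(3) kern_nonneg[OF z] sabs''_nonneg[OF \<delta>] by (intro mult_nonneg_nonneg) auto
    have "2 * (\<Sum>k\<in>UNIV. G k (fst z) * H k (snd z)) \<le> (\<Sum>k\<in>UNIV. (G k (fst z))\<^sup>2) + (\<Sum>k\<in>UNIV. (H k (snd z))\<^sup>2)"
      unfolding sum_distrib_left sum.distrib[symmetric]
      by (intro sum_mono) (use sum_squares_bound in \<open>simp add: mult.assoc[symmetric]\<close>)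
    from mult_left_mono[OF this w] show "2 * (\<Sum>k\<in>UNIV. ?X k z) \<le> ?G z + ?H z"
      by (simp add: sum_distrib_left sum_distrib_right distrib_left mult_ac)
  qed
  also have "\<dots> = (\<integral>z. ?G z \<partial>NN) + (\<integral>z. ?H z \<partial>NN)"
    by (intro Bochner_Integration.integral_add dissipation_integrable)
  also have "\<dots> \<le> (\<integral>z. (sabs \<delta> (U (fst z) - V (snd z)) * wt z - sabs \<delta> (U (fst z) - V (snd z)) * ws z)
      + (\<Sum>j\<in>UNIV. sabs_flux (f j) (U (fst z)) (V (snd z)) * w1 j z)
      + (\<Sum>i\<in>UNIV. \<Sum>j\<in>UNIV. sabs_flux (a i j) (U (fst z)) (V (snd z)) * w2 i j z) \<partial>NN)
     + (\<integral>z. sabs \<delta> (U (fst z) - V (snd z)) * ws z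
      - (\<Sum>j\<in>UNIV. sabs_flux (f j) (V (snd z)) (U (fst z)) * w1 j z)
      + (\<Sum>i\<in>UNIV. \<Sum>j\<in>UNIV. sabs_flux (a i j) (V (snd z)) (U (fst z)) * w2 i j z) \<partial>NN)"
    by (intro add_mono first_inequality second_inequality)
  also have "\<dots> = (\<integral>z. sabs \<delta> (U (fst z) - V (snd z)) * wt z \<partial>NN)
      + ((\<integral>z. (\<Sum>j\<in>UNIV. sabs_flux (f j) (U (fst z)) (V (snd z)) * w1 j z) \<partial>NN)
      - (\<integral>z. (\<Sum>j\<in>UNIV. sabs_flux (f j) (V (snd z)) (U (fst z)) * w1 j z) \<partial>NN)
      + (\<integral>z. (\<Sum>i\<in>UNIV. \<Sum>j\<in>UNIV. sabs_flux (a i j) (U (fst z)) (V (snd z)) * w2 i j z) \<partial>NN)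
      + (\<integral>z. (\<Sum>i\<in>UNIV. \<Sum>j\<in>UNIV. sabs_flux (a i j) (V (snd z)) (U (fst z)) * w2 i j z) \<partial>NN))"
    by (simp only: Bochner_Integration.integral_add Bochner_Integration.integral_diff s_int remainder_pieces
        Bochner_Integration.integrable_add Bochner_Integration.integrable_diff)
  finally have le: "(\<integral>z. 2 * (\<Sum>k\<in>UNIV. ?X k z) \<partial>NN) \<le> \<dots>" .
  have X: "(\<integral>z. 2 * (\<Sum>k\<in>UNIV. ?X k z) \<partial>NN) = - (2 * (\<Sum>k\<in>UNIV. \<integral>z. ?cross_flux k z \<partial>NN))"
  proof -
    have "(\<integral>z. (\<Sum>k\<in>UNIV. ?X k z) \<partial>NN) = (\<Sum>k\<in>UNIV. \<integral>z. ?X k z \<partial>NN)"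
      by (intro Bochner_Integration.integral_sum dissipation_integrable)
    then show ?thesis by (simp add: cross_term sum_negf)
  qed
  have "(\<integral>z. remainder z \<partial>NN) = (\<integral>z. (\<Sum>j\<in>UNIV. sabs_flux (f j) (U (fst z)) (V (snd z)) * w1 j z) \<partial>NN)
      - (\<integral>z. (\<Sum>j\<in>UNIV. sabs_flux (f j) (V (snd z)) (U (fst z)) * w1 j z) \<partial>NN)
      + (\<integral>z. (\<Sum>i\<in>UNIV. \<Sum>j\<in>UNIV. sabs_flux (a i j) (U (fst z)) (V (snd z)) * w2 i j z) \<partial>NN)
      + (\<integral>z. (\<Sum>i\<in>UNIV. \<Sum>j\<in>UNIV. sabs_flux (a i j) (V (snd z)) (U (fst z)) * w2 i j z) \<partial>NN)
      + 2 * (\<Sum>k\<in>UNIV. \<integral>z. ?cross_flux k z \<partial>NN)"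
  proof -
    have k: "integrable NN (\<lambda>z. \<Sum>k\<in>UNIV. ?cross_flux k z)"
      by (intro Bochner_Integration.integrable_sum[of UNIV] remainder_pieces)
    have "(\<integral>z. (\<Sum>k\<in>UNIV. ?cross_flux k z) \<partial>NN) = (\<Sum>k\<in>UNIV. \<integral>z. ?cross_flux k z \<partial>NN)"
      by (intro Bochner_Integration.integral_sum remainder_pieces)
    then show ?thesis
      unfolding remainder_eq
      by (simp only: Bochner_Integration.integral_add Bochner_Integration.integral_diff remainder_pieces k
        Bochner_Integration.integrable_add Bochner_Integration.integrable_diff integrable_mult_right
        integral_mult_right_zero)
  qed
  with le X show ?thesis by linarith
qed

text \<open>The separated flux has integral zero; subtracting it leaves the integral unchanged and
  makes the integrand of order \<open>sqrt \<delta>\<close> pointwise. The assumed estimate is the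
  one supplied by \<open>doubling_remainder\<close>.\<close>

lemma remainder_small:
  assumes C: "\<And>u v k1 k2. \<bar>u\<bar> \<le> M \<Longrightarrow> \<bar>v\<bar> \<le> M \<Longrightarrow> (\<And>i j. k2 i j = k2 j i) \<Longrightarrow>
    \<bar>doubled_flux \<delta> f a \<sigma> u v k1 k2 - separated_flux \<delta> f a u v k1 k2\<bar>
    \<le> C * sqrt \<delta> * ((\<Sum>j\<in>UNIV. \<bar>k1 j\<bar>) + (\<Sum>i\<in>UNIV. \<Sum>j\<in>UNIV. \<bar>k2 i j\<bar>))"
  shows "(\<integral>z. remainder z \<partial>NN) \<le>
    C * sqrt \<delta> * (\<integral>z. (\<Sum>j\<in>UNIV. \<bar>w1 j z\<bar>) + (\<Sum>i\<in>UNIV. \<Sum>j\<in>UNIV. \<bar>w2 i j z\<bar>) \<partial>NN)"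
proof -
  define p where "p g u = prim (\<lambda>s. sabs' \<delta> s * g s) u" for g u
  have pc: "continuous_on UNIV (p (f j))" "continuous_on UNIV (p (a i j))" for i j
    unfolding p_def using sabs_flux_continuous(3) smooth_fun_continuous[OF smooth_f] a_continuous by auto
  have comp: "continuous_on UNIV (\<lambda>q. h (fst q))" "continuous_on UNIV (\<lambda>q. h (snd q))"
    if "continuous_on UNIV h" for h :: "real \<Rightarrow> real"
    by (rule continuous_on_compose2[OF that]; auto intro!: continuous_intros)+
  define sep where "sep z = (\<Sum>j\<in>UNIV. p (f j) (U (fst z)) * w1 j z) - (\<Sum>j\<in>UNIV. p (f j) (V (snd z)) * w1 j z)
     + (\<Sum>i\<in>UNIV. \<Sum>j\<in>UNIV. p (a i j) (U (fst z)) * w2 i j z)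
     + (\<Sum>i\<in>UNIV. \<Sum>j\<in>UNIV. p (a i j) (V (snd z)) * w2 i j z)" for z
  have si: "integrable NN (\<lambda>z. p (f j) (U (fst z)) * w1 j z)" "integrable NN (\<lambda>z. p (f j) (V (snd z)) * w1 j z)"
    "integrable NN (\<lambda>z. p (a i j) (U (fst z)) * w2 i j z)" "integrable NN (\<lambda>z. p (a i j) (V (snd z)) * w2 i j z)" for i j
    using w_integrable(2)[of "\<lambda>u v. p (f j) u", OF comp(1)[OF pc(1)]] w_integrable(2)[of "\<lambda>u v. p (f j) v", OF comp(2)[OF pc(1)]]
      w_integrable(3)[of "\<lambda>u v. p (a i j) u", OF comp(1)[OF pc(2)]] w_integrable(3)[of "\<lambda>u v. p (a i j) v", OF comp(2)[OF pc(2)]]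
    by auto
  have s0: "(\<integral>z. p (f j) (U (fst z)) * w1 j z \<partial>NN) = 0" "(\<integral>z. p (f j) (V (snd z)) * w1 j z \<partial>NN) = 0"
    "(\<integral>z. p (a i j) (U (fst z)) * w2 i j z \<partial>NN) = 0" "(\<integral>z. p (a i j) (V (snd z)) * w2 i j z \<partial>NN) = 0" for i j
    unfolding w1_def w2_def kern1_def kern2_def
    by (rule separated_vanish[OF pc(1) kern_mean_zero(1,2)[unfolded kern1_def]]
        separated_vanish[OF pc(2) kern_mean_zero(3,4)[unfolded kern2_def]]; assumption)+
  have sepi: "integrable NN sep"
    unfolding sep_def[abs_def]
    by (intro Bochner_Integration.integrable_add Bochner_Integration.integrable_diff Bochner_Integration.integrable_sum si)
  have sep0: "(\<integral>z. sep z \<partial>NN) = 0"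
    unfolding sep_def
    by (simp add: Bochner_Integration.integral_add Bochner_Integration.integral_diff Bochner_Integration.integral_sum
        si s0 Bochner_Integration.integrable_sum)
  have wi: "integrable NN (\<lambda>z. (\<Sum>j\<in>UNIV. \<bar>w1 j z\<bar>) + (\<Sum>i\<in>UNIV. \<Sum>j\<in>UNIV. \<bar>w2 i j z\<bar>))"
    by (intro Bochner_Integration.integrable_add Bochner_Integration.integrable_sum integrable_abs w1_w2_integrable)
  have "(\<integral>z. remainder z \<partial>NN) = (\<integral>z. remainder z - sep z \<partial>NN)"
    using sepi sep0 remainder_integrable by simp
  also have "\<dots> \<le> (\<integral>z. C * sqrt \<delta> * ((\<Sum>j\<in>UNIV. \<bar>w1 j z\<bar>) + (\<Sum>i\<in>UNIV. \<Sum>j\<in>UNIV. \<bar>w2 i j z\<bar>)) \<partial>NN)"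
  proof (rule integral_mono)
    show "integrable NN (\<lambda>z. remainder z - sep z)" using sepi remainder_integrable by simp
    show "integrable NN (\<lambda>z. C * sqrt \<delta> * ((\<Sum>j\<in>UNIV. \<bar>w1 j z\<bar>) + (\<Sum>i\<in>UNIV. \<Sum>j\<in>UNIV. \<bar>w2 i j z\<bar>)))"
      using wi by simp
    fix z
    have sym: "w2 i j z = w2 j i z" for i j by (simp add: w2_def kern2_sym[of S K i j])
    have sepz: "sep z = (\<Sum>j\<in>UNIV. (p (f j) (U (fst z)) - p (f j) (V (snd z))) * w1 j z)
       + (\<Sum>i\<in>UNIV. \<Sum>j\<in>UNIV. (p (a i j) (U (fst z)) + p (a i j) (V (snd z))) * w2 i j z)"
      by (simp add: sep_def left_diff_distrib distrib_right sum_subtractf sum.distrib)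
    have "\<bar>remainder z - sep z\<bar> \<le> C * sqrt \<delta> * ((\<Sum>j\<in>UNIV. \<bar>w1 j z\<bar>) + (\<Sum>i\<in>UNIV. \<Sum>j\<in>UNIV. \<bar>w2 i j z\<bar>))"
      using C[OF UM VM, of "\<lambda>i j. w2 i j z" "fst z" "snd z" "\<lambda>j. w1 j z", OF sym]
      unfolding sepz remainder_def doubled_flux_def separated_flux_def sabs_flux_def cross_flux_def p_def .
    then show "remainder z - sep z \<le> C * sqrt \<delta> * ((\<Sum>j\<in>UNIV. \<bar>w1 j z\<bar>) + (\<Sum>i\<in>UNIV. \<Sum>j\<in>UNIV. \<bar>w2 i j z\<bar>))"
      by linarith
  qed
  finally show ?thesis by simp
qed

end

lemma abs_UV_wt_integrable: "integrable NN (\<lambda>z. \<bar>U (fst z) - V (snd z)\<bar> * wt z)"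
  by (rule w_integrable(5)[where \<phi> = "\<lambda>u v. \<bar>u - v\<bar>", OF zero_less_one]) (intro continuous_intros)

text \<open>D1 and D2 contain the time weights and the derivatives of K but not \<delta>, so with K
  fixed both error terms vanish in the limit.\<close>

lemma kato_inequality: "0 \<le> (\<integral>z. \<bar>U (fst z) - V (snd z)\<bar> * wt z \<partial>NN)"
proof -
  define D1 where "D1 = (\<integral>z. \<bar>wt z\<bar> \<partial>NN)"
  define D2 where "D2 = (\<integral>z. (\<Sum>j\<in>UNIV. \<bar>w1 j z\<bar>) + (\<Sum>i\<in>UNIV. \<Sum>j\<in>UNIV. \<bar>w2 i j z\<bar>) \<partial>NN)"
  let ?I = "\<integral>z. \<bar>U (fst z) - V (snd z)\<bar> * wt z \<partial>NN"
  obtain C where C: "\<And>\<delta> u v k1 k2. 0 < \<delta> \<Longrightarrow> \<delta> \<le> 1 \<Longrightarrow> \<bar>u\<bar> \<le> M \<Longrightarrow> \<bar>v\<bar> \<le> M \<Longrightarrow> (\<And>i j. k2 i j = k2 j i) \<Longrightarrow>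
    \<bar>doubled_flux \<delta> f a \<sigma> u v k1 k2 - separated_flux \<delta> f a u v k1 k2\<bar>
    \<le> C * sqrt \<delta> * ((\<Sum>j\<in>UNIV. \<bar>k1 j\<bar>) + (\<Sum>i\<in>UNIV. \<Sum>j\<in>UNIV. \<bar>k2 i j\<bar>))"
  proof -
    note ex = doubling_remainder[of f \<sigma> a M, OF smooth_f smooth_\<sigma> a_def]
    show ?thesis
      by (rule that) (rule conjunct2[OF someI_ex[OF ex], rule_format]; assumption)
  qed
  have le: "0 \<le> ?I + \<delta> * D1 + C * sqrt \<delta> * D2" if \<delta>: "0 < \<delta>" "\<delta> \<le> 1" for \<delta>
  proof -
    have "(\<integral>z. sabs \<delta> (U (fst z) - V (snd z)) * wt z \<partial>NN) \<le> (\<integral>z. \<bar>U (fst z) - V (snd z)\<bar> * wt z + \<delta> * \<bar>wt z\<bar> \<partial>NN)"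
    proof (rule integral_mono)
      show "integrable NN (\<lambda>z. sabs \<delta> (U (fst z) - V (snd z)) * wt z)"
        by (rule w_integrable(5)[where \<phi> = "\<lambda>u v. sabs \<delta> (u - v)", OF \<delta>(1) sabs_UV_continuous(1)[OF \<delta>(1)]])
      show "integrable NN (\<lambda>z. \<bar>U (fst z) - V (snd z)\<bar> * wt z + \<delta> * \<bar>wt z\<bar>)"
        by (intro Bochner_Integration.integrable_add abs_UV_wt_integrable integrable_mult_right integrable_abs w1_w2_integrable[OF zero_less_one])
      fix z
      have "(sabs \<delta> (U (fst z) - V (snd z)) - \<bar>U (fst z) - V (snd z)\<bar>) * wt z
          \<le> \<bar>sabs \<delta> (U (fst z) - V (snd z)) - \<bar>U (fst z) - V (snd z)\<bar>\<bar> * \<bar>wt z\<bar>"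
        unfolding abs_mult[symmetric] by (rule abs_ge_self)
      also have "\<dots> \<le> \<delta> * \<bar>wt z\<bar>"
        by (rule mult_right_mono[OF sabs_approx[OF \<delta>(1)] abs_ge_zero])
      finally have "(sabs \<delta> (U (fst z) - V (snd z)) - \<bar>U (fst z) - V (snd z)\<bar>) * wt z \<le> \<delta> * \<bar>wt z\<bar>" .
      then show "sabs \<delta> (U (fst z) - V (snd z)) * wt z \<le> \<bar>U (fst z) - V (snd z)\<bar> * wt z + \<delta> * \<bar>wt z\<bar>"
        by (simp add: left_diff_distrib)
    qed
    also have "\<dots> = ?I + \<delta> * D1"
      using abs_UV_wt_integrable w1_w2_integrable(3)[OF zero_less_one] by (simp add: D1_def)
    finally have s: "(\<integral>z. sabs \<delta> (U (fst z) - V (snd z)) * wt z \<partial>NN) \<le> ?I + \<delta> * D1" .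
    have "(\<integral>z. remainder \<delta> z \<partial>NN) \<le> C * sqrt \<delta> * D2"
      unfolding D2_def by (rule remainder_small[OF \<delta>(1)], rule C[OF \<delta>])
    with s regularised_inequality[OF \<delta>(1)] show ?thesis by linarith
  qed
  have "((\<lambda>\<delta>. ?I + \<delta> * D1 + C * sqrt \<delta> * D2) \<longlongrightarrow> ?I + 0 * D1 + C * sqrt 0 * D2) (at_right 0)"
    by (intro tendsto_intros)
  moreover have "\<forall>\<^sub>F \<delta> in at_right 0. 0 \<le> ?I + \<delta> * D1 + C * sqrt \<delta> * D2"
    unfolding eventually_at_right_field by (intro exI[of _ 1]) (auto intro!: le)
  ultimately have "0 \<le> ?I + 0 * D1 + C * sqrt 0 * D2"
    by (intro tendsto_lowerbound) auto
  then show ?thesis by simp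
qed

end

subsection \<open>Testing against bumps in time\<close>

definition time_bump :: "real \<Rightarrow> real \<Rightarrow> (real \<Rightarrow> real) \<Rightarrow> bool" where
  "time_bump l r b \<longleftrightarrow> 0 < l \<and> l \<le> r \<and> smooth_fun b \<and> (\<forall>t. 0 \<le> b t) \<and> (\<forall>t. t \<notin> {l..r} \<longrightarrow> b t = 0)"

lemma time_bump_prim:
  assumes b: "time_bump l r b"
  shows "mono (prim b)" "t \<le> l \<Longrightarrow> prim b t = 0" "r \<le> t \<Longrightarrow> prim b t = prim b r"
    "(prim b has_real_derivative b t) (at t)"
proof -
  have D: "(prim b has_real_derivative b t) (at t)" for t
    using b by (intro prim_DERIV smooth_fun_continuous) (simp add: time_bump_def)
  then show "(prim b has_real_derivative b t) (at t)" .
  have mono: "prim b x \<le> prim b y" if "x \<le> y" for x y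
    using that D b by (intro DERIV_nonneg_imp_nondecreasing[OF that]) (auto simp: time_bump_def)
  then show "mono (prim b)" by (auto intro: monoI)
  have const: "prim b x = prim b y" if "x \<le> y" "y \<le> l \<or> r \<le> x" for x y
  proof (cases "x = y")
    case False
    show ?thesis
    proof (rule DERIV_isconst_end[where f = "prim b" and a = x and b = y, symmetric])
      show "x < y" using False that by simp
      show "continuous_on {x..y} (prim b)"
        using D by (intro continuous_at_imp_continuous_on) (auto intro: DERIV_isCont)
      show "(prim b has_real_derivative 0) (at z)" if "x < z" "z < y" for z
      proof -
        have "b z = 0" using b that \<open>y \<le> l \<or> r \<le> x\<close> by (auto simp: time_bump_def)
        then show ?thesis using D[of z] by simp
      qed
    qed
  qed simp
  show "r \<le> t \<Longrightarrow> prim b t = prim b r" using const[of r t] by simp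
  have "0 < l" using b by (simp add: time_bump_def)
  then show "t \<le> l \<Longrightarrow> prim b t = 0"
    using const[of t l] const[of 0 l] by simp
qed

lemma time_bump_integrable:
  assumes b: "time_bump l r b" shows "integrable half_line b"
proof -
  obtain B where B: "0 \<le> B" "\<And>t. \<bar>b t\<bar> \<le> B"
    using smooth_fun_compact_support_bounded[of b l r] b by (auto simp: time_bump_def)
  show ?thesis
  proof (rule half_line_integrable)
    show "b \<in> borel_measurable borel" using b by (simp add: time_bump_def smooth_fun_measurable)
    show "\<bar>b t\<bar> \<le> B * indicator {l..r} t" for t
      using B b by (auto simp: time_bump_def indicator_def)
  qed
qed

lemma time_bump_integral:
  assumes b: "time_bump l r b" shows "(\<integral>t. b t \<partial>half_line) = prim b r"
proof -
  have bl: "0 < l" "l \<le> r" "\<And>t. t \<notin> {l..r} \<Longrightarrow> b t = 0" using b by (auto simp: time_bump_def)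
  have "(\<integral>t. b t \<partial>half_line) = (\<integral>t. b t \<partial>lborel)" using bl by (intro half_line_integral) auto
  also have "\<dots> = (\<integral>t. indicator {0..r} t *\<^sub>R b t \<partial>lborel)"
  proof (intro Bochner_Integration.integral_cong refl)
    show "b t = indicator {0..r} t *\<^sub>R b t" for t
      using bl(1) bl(3)[of t] by (cases "t \<in> {l..r}") auto
  qed
  also have "\<dots> = prim b r - prim b 0"
    using time_bump_prim(4)[OF b] bl smooth_fun_continuous[of b] b
    by (intro integral_FTC_Icc) (auto simp: time_bump_def has_real_derivative_iff_has_vector_derivative[symmetric]
        intro: has_field_derivative_at_within)
  finally show ?thesis by simp
qed

lemma time_bump_exists:
  assumes "0 < l" "l < r" obtains b where "time_bump l r b" "0 < prim b r"
proof -
  obtain b where b: "smooth_fun b" "\<And>x. 0 \<le> b x" "\<And>x. 0 < b x \<longleftrightarrow> l < x \<and> x < r"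
    using smooth_bump[of l r] by metis
  have tb: "time_bump l r b"
    unfolding time_bump_def
  proof (intro conjI allI impI)
    show "b t = 0" if "t \<notin> {l..r}" for t
      using b(2)[of t] b(3)[of t] that by (auto simp: less_le)
  qed (use assms b in auto)
  note D = time_bump_prim(4)[OF tb]
  let ?c = "(l + r) / 2"
  have "0 < b ?c" using b(3)[of ?c] assms by (simp add: field_simps)
  \<comment> \<open>The positive derivative at the midpoint makes the primitive increase strictly
    there, and monotonicity carries the gain on to r.\<close>
  then obtain d where d: "0 < d" "\<And>h. 0 < h \<Longrightarrow> h < d \<Longrightarrow> prim b ?c < prim b (?c + h)"
    using DERIV_pos_inc_right[OF D[of ?c]] by auto
  have "0 \<le> prim b ?c" using monoD[OF time_bump_prim(1)[OF tb], of 0 ?c] assms by simp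
  also have "\<dots> < prim b (?c + min (d/2) ((r - l) / 2))" using d assms by (intro d) (auto simp: min_less_iff_disj)
  also have "\<dots> \<le> prim b r" by (rule monoD[OF time_bump_prim(1)[OF tb]]) (auto simp: min_def field_simps)
  finally show ?thesis using tb that by blast
qed

text \<open>U is a countable union of intervals I_i, each the positivity set of a bump \<beta>_i. In
  1 minus the product over i < n of (1 - \<beta>_i)^n, the range admits more and more intervals
  while the power drives every factor with \<beta>_i(t) > 0 to 0; outside U all factors equal
  1.\<close>

lemma bump_indicator_limit:
  assumes U: "open U" "U \<subseteq> {l<..<r}" and lr: "0 < l" "l < r"
  obtains b where "\<And>n. time_bump l r (b n)" "\<And>n t. b n t \<le> 1"
    "\<And>t. (\<lambda>n. b n t) \<longlonglongrightarrow> indicator U t"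
proof -
  obtain D where D: "countable D" "D \<subseteq> Pow U" "\<And>X. X \<in> D \<Longrightarrow> \<exists>a b. X = box a b" "\<Union>D = U"
    using open_countable_Union_open_box[OF U(1)] by metis
  \<comment> \<open>Adding the empty interval makes the family nonempty, hence enumerable, even when
    U is empty.\<close>
  define D' where "D' = insert {} D"
  have D': "countable D'" "D' \<noteq> {}" "\<Union>D' = U" using D by (auto simp: D'_def)
  have Dbox: "\<exists>a b. X = {a<..<b::real}" if "X \<in> D'" for X
  proof (cases "X = {}")
    case True
    then have "X = {0<..<0::real}" by simp
    then show ?thesis by blast
  next
    case False
    then show ?thesis using that D(3)[of X] by (auto simp: D'_def box_real)
  qed
  define I where "I = from_nat_into D'"
  have I: "I i \<in> D'" "(\<Union>i. I i) = U" for i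
    using from_nat_into[OF D'(2)] range_from_nat_into[OF D'(2,1)] D'(3) by (auto simp: I_def)
  have "\<exists>b. smooth_fun b \<and> (\<forall>x. 0 \<le> b x \<and> b x \<le> 1 \<and> (0 < b x \<longleftrightarrow> x \<in> I i))" for i
  proof -
    obtain a c where ac: "I i = {a<..<c}" using Dbox[OF I(1)] by blast
    obtain b where "smooth_fun b" "\<And>x. 0 \<le> b x" "\<And>x. b x \<le> 1" "\<And>x. 0 < b x \<longleftrightarrow> a < x \<and> x < c"
      using smooth_bump[of a c] by metis
    then show ?thesis by (intro exI[of _ b]) (simp add: ac)
  qed
  then obtain \<beta> where \<beta>: "\<And>i. smooth_fun (\<beta> i)" "\<And>i x. 0 \<le> \<beta> i x" "\<And>i x. \<beta> i x \<le> 1" "\<And>i x. 0 < \<beta> i x \<longleftrightarrow> x \<in> I i"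
    by metis
  define P where "P n t = (\<Prod>i<n. (1 - \<beta> i t) ^ n)" for n :: nat and t
  have P01: "0 \<le> P n t" "P n t \<le> 1" for n t
    unfolding P_def using \<beta>(2,3) by (auto intro!: prod_nonneg prod_le_1 power_le_one)
  have Psm: "smooth_fun (P n)" for n
  proof -
    have "smooth_fun (\<lambda>t. \<Prod>i<k. (1 - \<beta> i t) ^ n)" for k
      by (induction k) (auto intro!: smooth_fun_const smooth_fun_mult smooth_fun_power smooth_fun_diff \<beta>)
    then show ?thesis by (simp add: P_def[abs_def])
  qed
  have PU: "P n t = 1" if "t \<notin> U" for n t
  proof -
    have "\<beta> i t = 0" for i
    proof -
      have "t \<notin> I i" using that I(2) by auto
      then show ?thesis using \<beta>(4)[of i t] \<beta>(2)[of i t] by (auto simp: less_le)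
    qed
    then show ?thesis by (simp add: P_def)
  qed
  show ?thesis
  proof
    show "time_bump l r (\<lambda>t. 1 - P n t)" for n
      unfolding time_bump_def
    proof (intro conjI allI impI)
      show "smooth_fun (\<lambda>t. 1 - P n t)" by (rule smooth_fun_diff[OF smooth_fun_const Psm])
      show "0 \<le> 1 - P n t" for t using P01(2)[of n t] by simp
      show "1 - P n t = 0" if "t \<notin> {l..r}" for t
      proof -
        have "t \<notin> U" using U(2) that by auto
        then show ?thesis using PU by simp
      qed
    qed (use lr in auto)
    show "1 - P n t \<le> 1" for n t using P01 by simp
    show "(\<lambda>n. 1 - P n t) \<longlonglongrightarrow> indicator U t" for t
    proof (cases "t \<in> U")
      case False then show ?thesis by (simp add: PU)
    next
      case True
      then obtain i where i: "t \<in> I i" using I(2) by auto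
      have "0 < \<beta> i t" using \<beta>(4) i by simp
      have "(\<lambda>n. (1 - \<beta> i t) ^ n) \<longlonglongrightarrow> 0"
        using \<beta>(3)[of i t] \<open>0 < \<beta> i t\<close> by (intro LIMSEQ_realpow_zero) auto
      moreover have "\<forall>\<^sub>F n in sequentially. P n t \<le> (1 - \<beta> i t) ^ n"
        using eventually_gt_at_top[of i]
      proof eventually_elim
        case (elim n)
        have "P n t = (1 - \<beta> i t) ^ n * (\<Prod>j\<in>{..<n} - {i}. (1 - \<beta> j t) ^ n)"
          unfolding P_def using elim by (intro prod.remove) auto
        also have "\<dots> \<le> (1 - \<beta> i t) ^ n * 1"
          using \<beta>(2,3) by (intro mult_left_mono prod_le_1) (auto intro!: power_le_one)
        finally show ?case by simp
      qed
      ultimately have "(\<lambda>n. P n t) \<longlonglongrightarrow> 0"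
        using P01(1) by (intro tendsto_sandwich[of "\<lambda>_. 0" "\<lambda>n. P n t" sequentially "\<lambda>n. (1 - \<beta> i t) ^ n" 0]) auto
      then have "(\<lambda>n. 1 - P n t) \<longlonglongrightarrow> 1 - 0" by (intro tendsto_intros)
      then show ?thesis using True by simp
    qed
  qed
qed

text \<open>Limits of bumps give the sign of the integral over open sets, outer regularity of
  Lebesgue measure passes to the set where g is positive, and a nonpositive integral of g over that
  set makes it null.\<close>

lemma AE_nonpos_by_bumps:
  fixes g :: "real \<Rightarrow> real"
  assumes gm: "g \<in> borel_measurable half_line" and gB: "\<And>t. 0 < t \<Longrightarrow> \<bar>g t\<bar> \<le> B"
    and le: "\<And>l r b. time_bump l r b \<Longrightarrow> (\<integral>t. g t * b t \<partial>half_line) \<le> 0"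
  shows "AE t in lborel. 0 < t \<longrightarrow> g t \<le> 0"
proof -
  define h where "h t = indicator {0<..} t * g t" for t
  have hm [measurable]: "h \<in> borel_measurable borel"
    using gm unfolding h_def by (subst (asm) borel_measurable_restrict_space_iff) auto
  have B: "0 \<le> B" using gB[of 1] by auto
  have hB: "\<bar>h t\<bar> \<le> B" for t using gB[of t] B by (auto simp: h_def indicator_def)
  have hle: "(\<integral>t. h t * b t \<partial>lborel) \<le> 0" if "time_bump l r b" for l r b
  proof -
    have "(\<integral>t. g t * b t \<partial>half_line) = (\<integral>t. indicator {0<..} t *\<^sub>R (g t * b t) \<partial>lborel)"
      by (rule integral_restrict_space) simp
    then show ?thesis using le[OF that] by (simp add: h_def mult.assoc)
  qed
  have hint: "integrable lborel (\<lambda>t. h t * indicator A t)" if "A \<in> sets borel" "A \<subseteq> {l..r}" for A l r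
  proof (rule Bochner_Integration.integrable_bound)
    show "integrable lborel (\<lambda>t. B * indicator {l..r} t)"
      by (intro integrable_mult_right integrable_real_indicator) (auto simp: emeasure_lborel_Icc_eq)
    show "(\<lambda>t. h t * indicator A t) \<in> borel_measurable lborel" using that by measurable
    show "AE t in lborel. norm (h t * indicator A t) \<le> norm (B * indicator {l..r} t)"
      using hB B that(2) by (intro AE_I2) (auto simp: indicator_def)
  qed
  have open_le: "(\<integral>t. h t * indicator U t \<partial>lborel) \<le> 0" if U: "open U" "U \<subseteq> {l<..<r}" and lr: "0 < l" "l < r" for U l r
  proof -
    obtain b where b: "\<And>n. time_bump l r (b n)" "\<And>n t. b n t \<le> 1" "\<And>t. (\<lambda>n. b n t) \<longlonglongrightarrow> indicator U t"
      using bump_indicator_limit[OF U lr] by metis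
    have bm [measurable]: "b n \<in> borel_measurable borel" for n
      using b(1)[of n] by (simp add: time_bump_def smooth_fun_measurable)
    have Um [measurable]: "U \<in> sets borel" using U(1) by simp
    have "(\<lambda>n. \<integral>t. h t * b n t \<partial>lborel) \<longlonglongrightarrow> (\<integral>t. h t * indicator U t \<partial>lborel)"
    proof (rule integral_dominated_convergence[where w = "\<lambda>t. B * indicator {l..r} t"])
      show "integrable lborel (\<lambda>t. B * indicator {l..r} t)"
        by (intro integrable_mult_right integrable_real_indicator) (auto simp: emeasure_lborel_Icc_eq)
      show "AE t in lborel. (\<lambda>n. h t * b n t) \<longlonglongrightarrow> h t * indicator U t"
        using b(3) by (intro AE_I2 tendsto_intros)
      show "AE t in lborel. norm (h t * b n t) \<le> B * indicator {l..r} t" for n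
      proof (rule AE_I2)
        fix t
        show "norm (h t * b n t) \<le> B * indicator {l..r} t"
        proof (cases "t \<in> {l..r}")
          case True
          have "\<bar>h t\<bar> * \<bar>b n t\<bar> \<le> B * 1"
            using hB b(1)[of n] b(2)[of n t] B by (intro mult_mono) (auto simp: time_bump_def)
          then show ?thesis using True by (simp add: abs_mult)
        next
          case False
          then have "b n t = 0" using b(1)[of n] by (simp add: time_bump_def)
          then show ?thesis using B by simp
        qed
      qed
    qed measurable
    then show ?thesis
      by (rule LIMSEQ_le_const2) (use hle[OF b(1)] in auto)
  qed
  have local: "AE t in lborel. t \<in> {l<..<r} \<longrightarrow> h t \<le> 0" if lr: "0 < l" "l < r" for l r
  proof -
    define A where "A = {t \<in> {l<..<r}. 0 < h t}"
    have Am [measurable]: "A \<in> sets borel" unfolding A_def by measurable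
    have Alr: "A \<subseteq> {l..r}" by (auto simp: A_def)
    have "(\<integral>t. h t * indicator A t \<partial>lborel) \<le> 0"
    proof (rule field_le_epsilon)
      fix e :: real assume e: "0 < e"
      \<comment> \<open>The integrand is at most B in absolute value, so an excess of measure e / (B
        + 1) costs at most e, also when B = 0.\<close>
      obtain U where U: "open U" "A \<subseteq> U" "emeasure lborel (U - A) < ennreal (e / (B + 1))"
        using outer_regular_lborel[OF Am, of "e / (B + 1)"] e B by auto
      define U' where "U' = U \<inter> {l<..<r}"
      have U': "open U'" "U' \<subseteq> {l<..<r}" "A \<subseteq> U'" "U' \<subseteq> {l..r}"
        using U by (auto simp: U'_def A_def)
      have U'm [measurable]: "U' \<in> sets borel" using U'(1) by simp
      have "emeasure lborel (U' - A) \<le> emeasure lborel (U - A)"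
        using U(1) by (intro emeasure_mono) (auto simp: U'_def)
      with U(3) have em: "emeasure lborel (U' - A) < ennreal (e / (B + 1))" by simp
      then have mm: "measure lborel (U' - A) \<le> e / (B + 1)"
        using e B unfolding measure_def by (intro enn2real_leI) auto
      have di: "integrable lborel (\<lambda>t. B * indicator (U' - A) t)"
      proof (intro integrable_mult_right integrable_real_indicator)
        show "emeasure lborel (U' - A) < \<infinity>" using less_trans[OF em ennreal_less_top] by simp
      qed measurable
      have "(\<integral>t. h t * indicator A t \<partial>lborel) \<le> (\<integral>t. h t * indicator U' t + B * indicator (U' - A) t \<partial>lborel)"
      proof (rule integral_mono)
        show "integrable lborel (\<lambda>t. h t * indicator A t)" by (rule hint[OF Am Alr])
        show "integrable lborel (\<lambda>t. h t * indicator U' t + B * indicator (U' - A) t)"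
          by (intro Bochner_Integration.integrable_add di hint[OF U'm U'(4)])
        show "h t * indicator A t \<le> h t * indicator U' t + B * indicator (U' - A) t" for t
          using hB[of t] U'(3) by (auto simp: indicator_def)
      qed
      also have "\<dots> = (\<integral>t. h t * indicator U' t \<partial>lborel) + B * measure lborel (U' - A)"
        using di hint[OF U'm U'(4)] by simp
      also have "\<dots> \<le> 0 + B * (e / (B + 1))"
        using open_le[OF U'(1,2) lr] mm B by (intro add_mono mult_left_mono) auto
      also have "\<dots> \<le> 0 + e" using B e by (simp add: field_simps)
      finally show "(\<integral>t. h t * indicator A t \<partial>lborel) \<le> 0 + e" .
    qed
    moreover have pos: "AE t in lborel. 0 \<le> h t * indicator A t"
      by (intro AE_I2) (auto simp: A_def indicator_def)
    moreover have "0 \<le> (\<integral>t. h t * indicator A t \<partial>lborel)"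
      by (intro integral_nonneg_AE pos)
    ultimately have "AE t in lborel. h t * indicator A t = 0"
      using integral_nonneg_eq_0_iff_AE[OF hint[OF Am Alr] pos] by simp
    then show ?thesis
      by eventually_elim (auto simp: A_def indicator_def)
  qed
  \<comment> \<open>These intervals exhaust (0, \<infinity>); the right end n + 2 keeps the first of
    them, (1, 2), nonempty.\<close>
  have "AE t in lborel. \<forall>n. t \<in> {1 / real (Suc n)<..<real (Suc (Suc n))} \<longrightarrow> h t \<le> 0"
    unfolding AE_all_countable
  proof
    fix n :: nat
    have "1 / real (Suc n) \<le> 1" "1 < real (Suc (Suc n))" by auto
    then have "1 / real (Suc n) < real (Suc (Suc n))" by linarith
    then show "AE t in lborel. t \<in> {1 / real (Suc n)<..<real (Suc (Suc n))} \<longrightarrow> h t \<le> 0"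
      by (intro local) auto
  qed
  then show ?thesis
  proof eventually_elim
    case (elim t)
    show ?case
    proof
      assume t: "0 < t"
      obtain n1 where n1: "1 / real (Suc n1) < t" using t nat_approx_posE by blast
      obtain n2 where n2: "t < real n2" using reals_Archimedean2 by blast
      let ?n = "max n1 n2"
      have "1 / real (Suc ?n) \<le> 1 / real (Suc n1)" by (simp add: frac_le)
      then have "t \<in> {1 / real (Suc ?n)<..<real (Suc (Suc ?n))}" using n1 n2 by auto
      then have "h t \<le> 0" using elim by blast
      then show "g t \<le> 0" using t by (simp add: h_def)
    qed
  qed
qed

subsection \<open>Comparison with the initial data\<close>

text \<open>The mass c of \<kappa> is left unnormalised, since it appears on both sides of the final
  estimate and is divided out. The half line is sure to see all of \<kappa>(s - t) when t > \<rho>,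
  whence the condition on c.\<close>

locale kernel_weight =
  fixes m :: "'d::finite bohr_pt measure" and S :: "(real^'d) set" and K :: "real^'d \<Rightarrow> complex"
    and \<kappa> :: "real \<Rightarrow> real" and \<rho> c :: real
  assumes haar: "haar_measure m" and S: "finite S" "0 \<in> S" "Re (K 0) = 1"
    and kern_nonneg: "\<And>x y. x \<in> bohr \<Longrightarrow> y \<in> bohr \<Longrightarrow> 0 \<le> kern S K x y"
    and \<kappa>: "smooth_fun \<kappa>" "\<And>t. 0 \<le> \<kappa> t" "\<And>t. t \<notin> {-\<rho>..\<rho>} \<Longrightarrow> \<kappa> t = 0"
    and \<rho>: "0 < \<rho>"
    and c: "\<And>t. \<rho> < t \<Longrightarrow> (\<integral>s. \<kappa> (s - t) \<partial>half_line) = c"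
begin

abbreviation "NN \<equiv> tG m \<Otimes>\<^sub>M tG m"

sublocale pair_sigma_finite "tG m" "tG m" by (rule tG_tG_pair[OF haar])

definition "wgt b z = b (fst (fst z)) * \<kappa> (fst (snd z) - fst (fst z)) * kern S K (snd (fst z)) (snd (snd z))"

lemmas coord_measurable [measurable] = tG_fst_measurable[OF haar] tG_snd_measurable[OF haar]
  tG_tG_measurable_coords[OF haar] tG_tG_measurable_kern[OF haar]

lemma \<kappa>_measurable [measurable]: "\<kappa> \<in> borel_measurable borel"
  by (rule smooth_fun_measurable[OF \<kappa>(1)])

lemma \<kappa>_bounded: obtains B where "0 \<le> B" "\<And>t. \<bar>\<kappa> t\<bar> \<le> B"
  using smooth_fun_compact_support_bounded[of \<kappa> "-\<rho>" \<rho>, OF \<kappa>(1,3)] by auto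

lemma time_bumpD:
  assumes "time_bump l r b"
  shows "b \<in> borel_measurable borel" "0 \<le> b t" "t \<notin> {l..r} \<Longrightarrow> b t = 0" "0 < l"
  using assms by (auto simp: time_bump_def smooth_fun_measurable)

lemma time_bump_bounded:
  assumes "time_bump l r b" obtains B where "0 \<le> B" "\<And>t. \<bar>b t\<bar> \<le> B"
  using smooth_fun_compact_support_bounded[of b l r] assms by (auto simp: time_bump_def)

lemma wgt_measurable: "time_bump l r b \<Longrightarrow> wgt b \<in> borel_measurable NN"
  using time_bumpD(1)[of l r b] unfolding wgt_def[abs_def] by measurable

lemma wgt_nonneg: "time_bump l r b \<Longrightarrow> z \<in> space NN \<Longrightarrow> 0 \<le> wgt b z"
  using time_bumpD(2)[of l r b] \<kappa>(2) kern_nonneg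
  by (auto simp: wgt_def space_pair_measure tG_space[OF haar])

lemma wgt_integrable:
  assumes P [measurable]: "P \<in> borel_measurable NN" and PB: "\<And>z. \<bar>P z\<bar> \<le> B" and b: "time_bump l r b"
  shows "integrable NN (\<lambda>z. P z * wgt b z)"
proof -
  have [measurable]: "wgt b \<in> borel_measurable NN" by (rule wgt_measurable[OF b])
  have B: "0 \<le> B" using PB[of undefined] by simp
  obtain Bk where Bk: "0 \<le> Bk" "\<And>t. \<bar>\<kappa> t\<bar> \<le> Bk" using \<kappa>_bounded by blast
  obtain Bb where Bb: "0 \<le> Bb" "\<And>t. \<bar>b t\<bar> \<le> Bb" using time_bump_bounded[OF b] by blast
  define I :: "real \<Rightarrow> real" where "I t = indicator {l - \<rho>..r + \<rho>} t" for t
  have Ii: "integrable (tG m) (\<lambda>X. d * I (fst X))" for d :: real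
    using tG_integrable_time[OF haar half_line_integrable[of I 1 "l - \<rho>" "r + \<rho>"]] by (auto simp: I_def[abs_def])
  let ?C = "\<Sum>\<xi>\<in>S. cmod (K \<xi>)"
  have C: "0 \<le> ?C" by (intro sum_nonneg) auto
  have bk: "\<bar>b t * \<kappa> (s - t)\<bar> \<le> (Bb * Bk) * (I t * I s)" for t s
  proof (cases "t \<in> {l..r} \<and> s - t \<in> {-\<rho>..\<rho>}")
    case True
    then have "I t = 1" "I s = 1" using \<rho> by (auto simp: I_def)
    then show ?thesis using Bb Bk by (auto simp: abs_mult intro!: mult_mono)
  next
    case False
    then have "\<bar>b t * \<kappa> (s - t)\<bar> = 0" using time_bumpD(3)[OF b, of t] \<kappa>(3)[of "s - t"] by auto
    moreover have "0 \<le> (Bb * Bk) * (I t * I s)" using Bb Bk by (intro mult_nonneg_nonneg) (auto simp: I_def)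
    ultimately show ?thesis by linarith
  qed
  show ?thesis
  proof (rule tG_tG_integrable_bound[OF haar _ Ii[of "B * (Bb * Bk) * ?C"] Ii[of 1]])
    fix X Y assume XY: "X \<in> space (tG m)" "Y \<in> space (tG m)"
    have k: "\<bar>kern S K (snd X) (snd Y)\<bar> \<le> ?C" using XY by (intro kern_bound) (auto simp: tG_space[OF haar])
    have "\<bar>P (X, Y) * wgt b (X, Y)\<bar> = \<bar>P (X, Y)\<bar> * (\<bar>b (fst X) * \<kappa> (fst Y - fst X)\<bar> * \<bar>kern S K (snd X) (snd Y)\<bar>)"
      by (simp add: wgt_def abs_mult mult.assoc)
    also have "\<dots> \<le> B * (((Bb * Bk) * (I (fst X) * I (fst Y))) * ?C)"
      using PB bk k B C by (intro mult_mono) (auto simp: Bb Bk I_def)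
    also have "\<dots> = B * (Bb * Bk) * ?C * I (fst X) * (1 * I (fst Y))" by (simp add: mult_ac)
    finally show "\<bar>P (X, Y) * wgt b (X, Y)\<bar> \<le> B * (Bb * Bk) * ?C * I (fst X) * (1 * I (fst Y))" .
  qed measurable
qed

lemma \<kappa>_shift_integrable: "integrable half_line (\<lambda>s. \<kappa> (s - t))" "integrable half_line (\<lambda>s. \<kappa> (t - s))"
proof -
  obtain Bk where Bk: "0 \<le> Bk" "\<And>t. \<bar>\<kappa> t\<bar> \<le> Bk" using \<kappa>_bounded by blast
  have "\<bar>\<kappa> (s - t)\<bar> \<le> Bk * indicator {t - \<rho>..t + \<rho>} s" "\<bar>\<kappa> (t - s)\<bar> \<le> Bk * indicator {t - \<rho>..t + \<rho>} s" for s
    using Bk(2)[of "s - t"] Bk(2)[of "t - s"] \<kappa>(3)[of "s - t"] \<kappa>(3)[of "t - s"] by (auto simp: indicator_def)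
  then show "integrable half_line (\<lambda>s. \<kappa> (s - t))" "integrable half_line (\<lambda>s. \<kappa> (t - s))"
    by (intro half_line_integrable; measurable)+
qed

lemma kern_sections:
  assumes "x \<in> bohr"
  shows "integrable m (\<lambda>y. kern S K x y)" "(\<integral>y. kern S K x y \<partial>m) = 1"
    "integrable m (\<lambda>y. kern S K y x)" "(\<integral>y. kern S K y x \<partial>m) = 1"
proof -
  show "integrable m (\<lambda>y. kern S K x y)" "integrable m (\<lambda>y. kern S K y x)"
    unfolding kern_eq_trig_snd[of S K x] kern_eq_trig_fst[of S K _ x] by (rule haar_integrable_trig[OF haar])+
  show "(\<integral>y. kern S K x y \<partial>m) = 1" "(\<integral>y. kern S K y x \<partial>m) = 1"
    unfolding haar_integral_kern[OF haar S(1) assms] using S(2,3) by simp_all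
qed

text \<open>For a function of X the second point is integrated out: it has mass c in time, as b
  vanishes for t \<le> \<rho>, and mean 1 in space.\<close>

lemma wgt_integral_fst:
  assumes g [measurable]: "g \<in> borel_measurable (tG m)" and gB: "\<And>X. \<bar>g X\<bar> \<le> B" and b: "time_bump l r b" and \<rho>l: "\<rho> < l"
  shows "(\<integral>z. g (fst z) * wgt b z \<partial>NN) = c * (\<integral>X. g X * b (fst X) \<partial>tG m)"
proof -
  have int: "integrable NN (\<lambda>z. g (fst z) * wgt b z)" by (rule wgt_integrable[OF _ gB b]) measurable
  have "(\<integral>z. g (fst z) * wgt b z \<partial>NN) = (\<integral>X. \<integral>Y. g X * wgt b (X, Y) \<partial>tG m \<partial>tG m)"
    using integral_fst'[OF int] by simp
  also have "\<dots> = (\<integral>X. c * (g X * b (fst X)) \<partial>tG m)"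
  proof (rule Bochner_Integration.integral_cong[OF refl])
    fix X assume "X \<in> space (tG m)"
    then have x: "snd X \<in> bohr" by (auto simp: tG_space[OF haar])
    have "(\<integral>Y. g X * wgt b (X, Y) \<partial>tG m) = (\<integral>Y. (g X * b (fst X)) * (\<kappa> (fst Y - fst X) * kern S K (snd X) (snd Y)) \<partial>tG m)"
      by (simp add: wgt_def mult.assoc)
    also have "\<dots> = (g X * b (fst X)) * ((\<integral>s. \<kappa> (s - fst X) \<partial>half_line) * 1)"
      using tG_product(2)[OF haar \<kappa>_shift_integrable(1) kern_sections(1)[OF x], of "fst X"] kern_sections(2)[OF x] by simp
    also have "\<dots> = c * (g X * b (fst X))"
    proof (cases "fst X \<in> {l..r}")
      case True then show ?thesis using c[of "fst X"] \<rho>l by simp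
    next
      case False then show ?thesis using time_bumpD(3)[OF b] by simp
    qed
    finally show "(\<integral>Y. g X * wgt b (X, Y) \<partial>tG m) = c * (g X * b (fst X))" .
  qed
  finally show ?thesis by simp
qed

text \<open>The convolution of b with \<kappa>, which remains when the first point is integrated
  out; its support is that of b widened by \<rho>.\<close>

definition "smear b s = (\<integral>t. b t * \<kappa> (s - t) \<partial>half_line)"

lemma wgt_integral_snd:
  assumes g [measurable]: "g \<in> borel_measurable (tG m)" and gB: "\<And>X. \<bar>g X\<bar> \<le> B" and b: "time_bump l r b"
  shows "(\<integral>z. g (snd z) * wgt b z \<partial>NN) = (\<integral>Y. g Y * smear b (fst Y) \<partial>tG m)"
proof -
  note [measurable] = time_bumpD(1)[OF b]
  obtain Bk where Bk: "0 \<le> Bk" "\<And>t. \<bar>\<kappa> t\<bar> \<le> Bk" using \<kappa>_bounded by blast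
  obtain Bb where Bb: "0 \<le> Bb" "\<And>t. \<bar>b t\<bar> \<le> Bb" using time_bump_bounded[OF b] by blast
  have bi: "integrable half_line (\<lambda>t. b t * \<kappa> (s - t))" for s
  proof (rule half_line_integrable)
    show "\<bar>b t * \<kappa> (s - t)\<bar> \<le> (Bb * Bk) * indicator {l..r} t" for t
      using Bb Bk time_bumpD(3)[OF b, of t] by (auto simp: indicator_def abs_mult intro!: mult_mono)
  qed measurable
  have int: "integrable NN (\<lambda>z. g (snd z) * wgt b z)" by (rule wgt_integrable[OF _ gB b]) measurable
  have "(\<integral>z. g (snd z) * wgt b z \<partial>NN) = (\<integral>Y. \<integral>X. g Y * wgt b (X, Y) \<partial>tG m \<partial>tG m)"
    using integral_snd[of "\<lambda>X Y. g Y * wgt b (X, Y)"] int by (simp add: case_prod_unfold)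
  also have "\<dots> = (\<integral>Y. g Y * smear b (fst Y) \<partial>tG m)"
  proof (rule Bochner_Integration.integral_cong[OF refl])
    fix Y assume "Y \<in> space (tG m)"
    then have y: "snd Y \<in> bohr" by (auto simp: tG_space[OF haar])
    show "(\<integral>X. g Y * wgt b (X, Y) \<partial>tG m) = g Y * smear b (fst Y)"
      using tG_product(2)[OF haar bi kern_sections(3)[OF y], of "fst Y"] kern_sections(4)[OF y]
      by (simp add: wgt_def smear_def)
  qed
  finally show ?thesis .
qed

text \<open>The mass of the convolution is read off by evaluating the total weight in both orders,
  that is, with g = 1 in \<open>wgt_integral_fst\<close> and
  \<open>wgt_integral_snd\<close>.\<close>

lemma smear_facts:
  assumes b: "time_bump l r b" and \<rho>l: "\<rho> < l"
  shows "0 \<le> smear b s" "s \<notin> {l - \<rho>..r + \<rho>} \<Longrightarrow> smear b s = 0" "integrable half_line (smear b)"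
    "(\<integral>s. smear b s \<partial>half_line) = c * (\<integral>t. b t \<partial>half_line)"
proof -
  note [measurable] = time_bumpD(1)[OF b]
  obtain Bk where Bk: "0 \<le> Bk" "\<And>t. \<bar>\<kappa> t\<bar> \<le> Bk" using \<kappa>_bounded by blast
  show nn: "0 \<le> smear b s" for s
    unfolding smear_def using time_bumpD(2)[OF b] \<kappa>(2) by (intro integral_nonneg_AE) auto
  show zero: "smear b s = 0" if "s \<notin> {l - \<rho>..r + \<rho>}" for s
  proof -
    have "b t * \<kappa> (s - t) = 0" for t
    proof -
      have "t \<notin> {l..r} \<or> s - t \<notin> {-\<rho>..\<rho>}" using that by auto
      then show ?thesis using time_bumpD(3)[OF b, of t] \<kappa>(3)[of "s - t"] by auto
    qed
    then show ?thesis unfolding smear_def by (simp only: Bochner_Integration.integral_zero)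
  qed
  have meas: "smear b \<in> borel_measurable borel"
    unfolding smear_def[abs_def]
  proof (rule sigma_finite_measure.borel_measurable_lebesgue_integral[OF sigma_finite_half_line])
    have [measurable]: "snd \<in> borel_measurable (borel \<Otimes>\<^sub>M half_line)"
      using measurable_compose[OF measurable_snd half_line_measurable[of "\<lambda>x. x"]] by simp
    show "(\<lambda>(s, t). b t * \<kappa> (s - t)) \<in> borel_measurable (borel \<Otimes>\<^sub>M half_line)"
      unfolding case_prod_unfold by measurable
  qed
  have "\<bar>smear b s\<bar> \<le> ((\<integral>t. b t \<partial>half_line) * Bk) * indicator {l - \<rho>..r + \<rho>} s" for s
  proof (cases "s \<in> {l - \<rho>..r + \<rho>}")
    case True
    have "smear b s \<le> (\<integral>t. b t * Bk \<partial>half_line)"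
      unfolding smear_def
    proof (rule integral_mono')
      show "integrable half_line (\<lambda>t. b t * Bk)" using time_bump_integrable[OF b] by simp
      show "b t * \<kappa> (s - t) \<le> b t * Bk" for t
        using Bk(2)[of "s - t"] time_bumpD(2)[OF b, of t] by (intro mult_left_mono) auto
      show "0 \<le> b t * Bk" for t using Bk(1) time_bumpD(2)[OF b, of t] by simp
    qed
    then show ?thesis using True nn[of s] by simp
  next
    case False then show ?thesis using zero by simp
  qed
  from half_line_integrable[OF meas this] show int: "integrable half_line (smear b)" .
  have one: "integrable m (\<lambda>_. 1::real)" "(\<integral>x. 1 \<partial>m) = (1::real)"
    using finite_measure.integrable_const[OF haar_prob_space(2)[OF haar]] haar_measure_space[OF haar] by auto
  have "(\<integral>s. smear b s \<partial>half_line) = (\<integral>Y. 1 * smear b (fst Y) \<partial>tG m)"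
    using tG_product(2)[OF haar int one(1)] one(2) by simp
  also have "\<dots> = (\<integral>z. 1 * wgt b z \<partial>NN)" by (rule wgt_integral_snd[where B = 1, symmetric, OF _ _ b]) auto
  also have "\<dots> = c * (\<integral>X. 1 * b (fst X) \<partial>tG m)" by (rule wgt_integral_fst[where B = 1, OF _ _ b \<rho>l]) auto
  also have "\<dots> = c * (\<integral>t. b t \<partial>half_line)"
    using tG_product(2)[OF haar time_bump_integrable[OF b] one(1)] one(2) by simp
  finally show "(\<integral>s. smear b s \<partial>half_line) = c * (\<integral>t. b t \<partial>half_line)" .
qed

text \<open>The initial condition enters here as an essential limit: smallness for almost every t
  below \<delta> is enough once it is integrated against a density that vanishes from \<delta>
  on.\<close>

lemma short_time_small:
  fixes h :: "real \<times> 'd bohr_pt \<Rightarrow> real" and p :: "real \<Rightarrow> real"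
  assumes h [measurable]: "h \<in> borel_measurable (tG m)" and hB: "\<And>X. \<bar>h X\<bar> \<le> B"
    and small: "AE t in half_line. t < \<delta> \<longrightarrow> (\<integral>x. \<bar>h (t, x)\<bar> \<partial>m) < \<epsilon>"
    and p: "integrable half_line p" "\<And>t. 0 \<le> p t" "\<And>t. \<delta> \<le> t \<Longrightarrow> p t = 0"
  shows "(\<integral>X. \<bar>h X\<bar> * p (fst X) \<partial>tG m) \<le> \<epsilon> * (\<integral>t. p t \<partial>half_line)"
proof -
  interpret TX: pair_sigma_finite half_line m by (rule tG_pair[OF haar])
  have pm: "integrable (tG m) (\<lambda>X. B * p (fst X))" using tG_integrable_time[OF haar p(1)] by simp
  have int: "integrable (half_line \<Otimes>\<^sub>M m) (\<lambda>X. \<bar>h X\<bar> * p (fst X))"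
  proof (fold tG_def, rule Bochner_Integration.integrable_bound[OF pm])
    show "(\<lambda>X. \<bar>h X\<bar> * p (fst X)) \<in> borel_measurable (tG m)"
      using tG_integrable_time[OF haar p(1)] by measurable
    show "AE X in tG m. norm (\<bar>h X\<bar> * p (fst X)) \<le> norm (B * p (fst X))"
      using hB p(2) by (intro AE_I2) (auto simp: abs_mult intro!: mult_right_mono order_trans[OF hB])
  qed
  have "(\<integral>X. \<bar>h X\<bar> * p (fst X) \<partial>tG m) = (\<integral>t. (\<integral>x. \<bar>h (t, x)\<bar> * p t \<partial>m) \<partial>half_line)"
    unfolding tG_def using TX.integral_fst'[OF int] by simp
  also have "\<dots> \<le> (\<integral>t. \<epsilon> * p t \<partial>half_line)"
  proof (rule integral_mono_AE)
    show "integrable half_line (\<lambda>t. \<integral>x. \<bar>h (t, x)\<bar> * p t \<partial>m)"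
      using TX.integrable_fst'[OF int] by simp
    show "integrable half_line (\<lambda>t. \<epsilon> * p t)" using p(1) by simp
    show "AE t in half_line. (\<integral>x. \<bar>h (t, x)\<bar> * p t \<partial>m) \<le> \<epsilon> * p t"
      using small
    proof eventually_elim
      case (elim t)
      show ?case
      proof (cases "t < \<delta>")
        case True
        then show ?thesis using elim p(2)[of t] by (auto intro!: mult_right_mono)
      next
        case False
        then show ?thesis using p(3)[of t] by simp
      qed
    qed
  qed
  also have "\<dots> = \<epsilon> * (\<integral>t. p t \<partial>half_line)" by simp
  finally show ?thesis .
qed

text \<open>r + \<rho> < \<delta> keeps even the smeared bump inside the times where smallness
  holds, so the second point is controlled like the first.\<close>

lemma wgt_short_time_small:
  fixes h :: "real \<times> 'd bohr_pt \<Rightarrow> real"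
  assumes h [measurable]: "h \<in> borel_measurable (tG m)" and hB: "\<And>X. \<bar>h X\<bar> \<le> B"
    and small: "AE t in half_line. t < \<delta> \<longrightarrow> (\<integral>x. \<bar>h (t, x)\<bar> \<partial>m) < \<epsilon>"
    and b: "time_bump l r b" and \<rho>l: "\<rho> < l" and r\<delta>: "r + \<rho> < \<delta>" and c0: "0 \<le> c"
  shows "(\<integral>z. \<bar>h (fst z)\<bar> * wgt b z \<partial>NN) \<le> c * (\<integral>t. b t \<partial>half_line) * \<epsilon>"
    "(\<integral>z. \<bar>h (snd z)\<bar> * wgt b z \<partial>NN) \<le> c * (\<integral>t. b t \<partial>half_line) * \<epsilon>"
proof -
  have hB': "\<bar>\<bar>h X\<bar>\<bar> \<le> B" for X using hB by simp
  have "(\<integral>z. \<bar>h (fst z)\<bar> * wgt b z \<partial>NN) = c * (\<integral>X. \<bar>h X\<bar> * b (fst X) \<partial>tG m)"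
    by (rule wgt_integral_fst[OF _ hB' b \<rho>l]) measurable
  also have "\<dots> \<le> c * (\<epsilon> * (\<integral>t. b t \<partial>half_line))"
    using time_bumpD[OF b] \<rho> r\<delta>
    by (intro mult_left_mono c0 short_time_small[OF h hB small] time_bump_integrable[OF b]) auto
  finally show "(\<integral>z. \<bar>h (fst z)\<bar> * wgt b z \<partial>NN) \<le> c * (\<integral>t. b t \<partial>half_line) * \<epsilon>" by (simp add: mult_ac)
  have "(\<integral>z. \<bar>h (snd z)\<bar> * wgt b z \<partial>NN) = (\<integral>Y. \<bar>h Y\<bar> * smear b (fst Y) \<partial>tG m)"
    by (rule wgt_integral_snd[OF _ hB' b]) measurable
  also have "\<dots> \<le> \<epsilon> * (\<integral>s. smear b s \<partial>half_line)"
    using smear_facts[OF b \<rho>l] r\<delta> by (intro short_time_small[OF h hB small]) auto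
  also have "\<dots> = c * (\<integral>t. b t \<partial>half_line) * \<epsilon>"
    using smear_facts(4)[OF b \<rho>l] by (simp add: mult_ac)
  finally show "(\<integral>z. \<bar>h (snd z)\<bar> * wgt b z \<partial>NN) \<le> c * (\<integral>t. b t \<partial>half_line) * \<epsilon>" .
qed

text \<open>Initial data do not depend on time, so the time factors integrate to c times the mass of
  b and the spatial double integral remains.\<close>

lemma wgt_initial:
  assumes [measurable]: "u0 \<in> borel_measurable m" "v0 \<in> borel_measurable m"
    and B: "\<And>x. \<bar>u0 x\<bar> \<le> B" "\<And>x. \<bar>v0 x\<bar> \<le> B" and b: "time_bump l r b" and \<rho>l: "\<rho> < l"
  shows "(\<integral>z. \<bar>u0 (snd (fst z)) - v0 (snd (snd z))\<bar> * wgt b z \<partial>NN) =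
    c * (\<integral>t. b t \<partial>half_line) * (\<integral>z. \<bar>u0 (fst z) - v0 (snd z)\<bar> * kern S K (fst z) (snd z) \<partial>(m \<Otimes>\<^sub>M m))"
proof -
  interpret XX: pair_sigma_finite m m by (rule haar_pair[OF haar])
  interpret finite_measure m by (rule haar_prob_space(2)[OF haar])
  have ui: "integrable m u0" "integrable m v0" using B by (auto intro!: integrable_const_bound[where B = B])
  have int: "integrable NN (\<lambda>z. \<bar>u0 (snd (fst z)) - v0 (snd (snd z))\<bar> * wgt b z)"
  proof (rule wgt_integrable[OF _ _ b])
    show "\<bar>\<bar>u0 (snd (fst z)) - v0 (snd (snd z))\<bar>\<bar> \<le> 2 * B" for z
      using B(1)[of "snd (fst z)"] B(2)[of "snd (snd z)"] by linarith
  qed measurable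
  have int2: "integrable (m \<Otimes>\<^sub>M m) (\<lambda>z. \<bar>u0 (fst z) - v0 (snd z)\<bar> * kern S K (fst z) (snd z))"
    by (rule haar_integrable_diff_kern[OF haar S(1) ui])
  define q where "q x = (\<integral>y. \<bar>u0 x - v0 y\<bar> * kern S K x y \<partial>m)" for x
  have qi: "integrable m q" "(\<integral>x. q x \<partial>m) = (\<integral>z. \<bar>u0 (fst z) - v0 (snd z)\<bar> * kern S K (fst z) (snd z) \<partial>(m \<Otimes>\<^sub>M m))"
    using XX.integrable_fst'[OF int2] XX.integral_fst'[OF int2] by (simp_all add: q_def[abs_def])
  have "(\<integral>z. \<bar>u0 (snd (fst z)) - v0 (snd (snd z))\<bar> * wgt b z \<partial>NN) =
      (\<integral>X. \<integral>Y. \<bar>u0 (snd X) - v0 (snd Y)\<bar> * wgt b (X, Y) \<partial>tG m \<partial>tG m)"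
    using integral_fst'[OF int] by simp
  also have "\<dots> = (\<integral>X. c * (b (fst X) * q (snd X)) \<partial>tG m)"
  proof (rule Bochner_Integration.integral_cong[OF refl])
    fix X assume "X \<in> space (tG m)"
    then have x: "snd X \<in> bohr" by (auto simp: tG_space[OF haar])
    have ki: "integrable m (\<lambda>y. \<bar>u0 (snd X) - v0 y\<bar> * kern S K (snd X) y)"
    proof (rule Bochner_Integration.integrable_bound[of m "\<lambda>y. 2 * B * kern S K (snd X) y"])
      show "integrable m (\<lambda>y. 2 * B * kern S K (snd X) y)" using kern_sections(1)[OF x] by simp
      show "(\<lambda>y. \<bar>u0 (snd X) - v0 y\<bar> * kern S K (snd X) y) \<in> borel_measurable m"
        using borel_measurable_integrable[OF kern_sections(1)[OF x]] by measurable
      show "AE y in m. norm (\<bar>u0 (snd X) - v0 y\<bar> * kern S K (snd X) y) \<le> norm (2 * B * kern S K (snd X) y)"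
      proof (rule AE_I2)
        fix y
        have "\<bar>u0 (snd X) - v0 y\<bar> \<le> \<bar>2 * B\<bar>" using B(1)[of "snd X"] B(2)[of y] by linarith
        then show "norm (\<bar>u0 (snd X) - v0 y\<bar> * kern S K (snd X) y) \<le> norm (2 * B * kern S K (snd X) y)"
          by (simp only: real_norm_def abs_mult abs_abs) (intro mult_right_mono, auto simp: abs_mult)
      qed
    qed
    have "(\<integral>Y. \<bar>u0 (snd X) - v0 (snd Y)\<bar> * wgt b (X, Y) \<partial>tG m) =
        (\<integral>Y. b (fst X) * (\<kappa> (fst Y - fst X) * (\<bar>u0 (snd X) - v0 (snd Y)\<bar> * kern S K (snd X) (snd Y))) \<partial>tG m)"
      by (simp add: wgt_def mult_ac)
    also have "\<dots> = b (fst X) * ((\<integral>s. \<kappa> (s - fst X) \<partial>half_line) * q (snd X))"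
      using tG_product(2)[OF haar \<kappa>_shift_integrable(1) ki, of "fst X"] by (simp add: q_def)
    also have "\<dots> = c * (b (fst X) * q (snd X))"
    proof (cases "fst X \<in> {l..r}")
      case True then show ?thesis using c[of "fst X"] \<rho>l by simp
    next
      case False then show ?thesis using time_bumpD(3)[OF b] by simp
    qed
    finally show "(\<integral>Y. \<bar>u0 (snd X) - v0 (snd Y)\<bar> * wgt b (X, Y) \<partial>tG m) = c * (b (fst X) * q (snd X))" .
  qed
  also have "\<dots> = c * (\<integral>t. b t \<partial>half_line) * (\<integral>x. q x \<partial>m)"
    using tG_product(2)[OF haar time_bump_integrable[OF b] qi(1)] by simp
  finally show ?thesis by (simp add: qi(2))
qed

end

section \<open>Representatives bounded at every point\<close>

lemma Linf_truncate:
  assumes "Linf M f"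
  obtains g C where "g \<in> borel_measurable M" "\<And>x. \<bar>g x\<bar> \<le> C" "AE x in M. g x = f x"
proof -
  obtain C where C: "AE x in M. \<bar>f x\<bar> \<le> C" and [measurable]: "f \<in> borel_measurable M"
    using assms by (auto simp: Linf_def)
  define g where "g x = (if \<bar>f x\<bar> \<le> C then f x else 0)" for x
  have "g \<in> borel_measurable M" unfolding g_def[abs_def] by measurable
  moreover have "\<bar>g x\<bar> \<le> \<bar>C\<bar>" for x by (auto simp: g_def)
  moreover have "AE x in M. g x = f x" using C by eventually_elim (simp add: g_def)
  ultimately show ?thesis using that by blast
qed

text \<open>Changing the solution on a null set leaves every integral in the conditions unchanged.
  General test functions and entropies are specialised here to separated products and to shifts of
  \<open>sabs\<close>, whose convexity comes from \<open>sabs'' \<ge> 0\<close>.\<close>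

lemma entropy_solution_truncate:
  fixes \<sigma> :: "real \<Rightarrow> real^'k::finite^'d::finite"
  assumes haar: "haar_measure m" and es: "entropy_solution m F a \<sigma> w w0"
    and F: "\<And>j. smooth_fun (\<lambda>s. F s $ j)" and \<sigma>: "\<And>i k. smooth_fun (\<lambda>s. \<sigma> s $ i $ k)"
    and a: "\<And>s i j. a s $ i $ j = (\<Sum>k\<in>UNIV. \<sigma> s $ i $ k * \<sigma> s $ j $ k)"
  obtains W C G where "W \<in> borel_measurable (tG m)" "\<And>X. \<bar>W X\<bar> \<le> C" "AE X in tG m. W X = w (fst X) (snd X)"
    "\<And>k. L2 (tG m) (G k)" "weak_chain_rule m (\<lambda>i k s. \<sigma> s $ i $ k) W G"
    "weak_entropy_ineq m (\<lambda>j. deriv (\<lambda>r. F r $ j)) (\<lambda>i j s. a s $ i $ j) W G"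
proof -
  have Lw: "Linf (tG m) (\<lambda>X. w (fst X) (snd X))"
    using es by (simp add: entropy_solution_def case_prod_unfold)
  then obtain W C where W [measurable]: "W \<in> borel_measurable (tG m)" and WC: "\<And>X. \<bar>W X\<bar> \<le> C"
    and Ww: "AE X in tG m. W X = w (fst X) (snd X)" using Linf_truncate by blast
  have wm [measurable]: "(\<lambda>X. w (fst X) (snd X)) \<in> borel_measurable (tG m)" using Lw by (simp add: Linf_def)
  obtain G :: "'k \<Rightarrow> real \<times> 'd bohr_pt \<Rightarrow> real" where GL: "\<And>k. L2 (tG m) (G k)"
    and chain: "\<And>\<psi> k \<phi>. continuous_on UNIV \<psi> \<Longrightarrow> test_fun \<phi> \<Longrightarrow>
       (\<integral>x. \<psi> (w (fst x) (snd x)) * G k x * \<phi> (fst x) (snd x) \<partial>tG m) =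
         - (\<integral>x. (\<Sum>i\<in>UNIV. prim (\<lambda>s. \<psi> s * \<sigma> s $ i $ k) (w (fst x) (snd x)) * Dop [Dx i] \<phi> (fst x) (snd x)) \<partial>tG m)"
    and ent: "\<And>\<eta> \<phi>. convex_on UNIV \<eta> \<Longrightarrow> C2_fun \<eta> \<Longrightarrow> test_fun \<phi> \<Longrightarrow> (\<forall>t. \<forall>\<omega>\<in>bohr. 0 \<le> \<phi> t \<omega>) \<Longrightarrow>
       (\<integral>x. deriv (deriv \<eta>) (w (fst x) (snd x)) * (\<Sum>k\<in>UNIV. (G k x)^2) * \<phi> (fst x) (snd x) \<partial>tG m)
         \<le> (\<integral>x. \<eta> (w (fst x) (snd x)) * Dop [Dt] \<phi> (fst x) (snd x)
              + (\<Sum>j\<in>UNIV. prim (\<lambda>s. deriv \<eta> s * deriv (\<lambda>r. F r $ j) s) (w (fst x) (snd x)) * Dop [Dx j] \<phi> (fst x) (snd x))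
              + (\<Sum>i\<in>UNIV. \<Sum>j\<in>UNIV. prim (\<lambda>s. deriv \<eta> s * a s $ i $ j) (w (fst x) (snd x)) * Dop [Dx i, Dx j] \<phi> (fst x) (snd x)) \<partial>tG m)"
  proof -
    \<comment> \<open>The existential over g is opened once, by choice, so that one and the same G
      serves in (i), (ii) and (iii).\<close>
    note ex = es[unfolded entropy_solution_def, THEN conjunct2, THEN conjunct1, THEN someI_ex]
    note 1 = ex[THEN conjunct1, rule_format]
    note 2 = ex[THEN conjunct2, THEN conjunct2, THEN conjunct1, rule_format, THEN conjunct2, rule_format]
    note 3 = ex[THEN conjunct2, THEN conjunct2, THEN conjunct2, rule_format, OF conjI conjI]
    show ?thesis by (rule that[OF 1 2 3])
  qed
  have [measurable]: "G k \<in> borel_measurable (tG m)" for k using GL by (simp add: L2_def)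
  have tm: "(\<lambda>X. q (fst X)) \<in> borel_measurable (tG m)" if "q \<in> borel_measurable borel" for q :: "real \<Rightarrow> real"
    by (rule measurable_compose[OF tG_fst_measurable[OF haar] that])
  have [measurable]: "(\<lambda>X. trig S c (snd X)) \<in> borel_measurable (tG m)" for S c
    by (rule measurable_compose[OF tG_snd_measurable[OF haar] trig_measurable[OF haar]])
  have pm: "prim g \<in> borel_measurable borel" if "continuous_on UNIV g" for g
    using prim_DERIV[OF that] by (intro borel_measurable_continuous_onI continuous_at_imp_continuous_on) (auto intro: DERIV_isCont)
  have chainW: "weak_chain_rule m (\<lambda>i k s. \<sigma> s $ i $ k) W G"
    unfolding weak_chain_rule_def
  proof (intro allI impI)
    fix \<psi> \<theta> :: "real \<Rightarrow> real" and k l r S and c :: "real^'d \<Rightarrow> complex"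
    assume \<psi>: "continuous_on UNIV \<psi>" and \<theta>: "smooth_fun \<theta>" "0 < (l::real)" "\<forall>t. t \<notin> {l..r} \<longrightarrow> \<theta> t = 0"
    have tf: "test_fun (\<lambda>t \<omega>. \<theta> t * trig S c \<omega>)" using test_fun_trig[OF \<theta>(1,2)] \<theta>(3) by blast
    have [measurable]: "\<psi> \<in> borel_measurable borel"
      using \<psi> by (rule borel_measurable_continuous_onI)
    note [measurable] = tm[OF smooth_fun_measurable[OF \<theta>(1)]]
    have [measurable]: "prim (\<lambda>s. \<psi> s * \<sigma> s $ i $ k) \<in> borel_measurable borel" for i
      by (intro pm continuous_on_mult \<psi> smooth_fun_continuous \<sigma>)
    let ?L = "\<lambda>W. \<integral>X. \<psi> (W X) * G k X * (\<theta> (fst X) * trig S c (snd X)) \<partial>tG m"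
    let ?R = "\<lambda>W. \<integral>X. (\<Sum>i\<in>UNIV. prim (\<lambda>s. \<psi> s * \<sigma> s $ i $ k) (W X)
               * (\<theta> (fst X) * trig S (\<lambda>\<xi>. c \<xi> * (\<i> * \<xi> $ i)) (snd X))) \<partial>tG m"
    let ?w = "\<lambda>X. w (fst X) (snd X)"
    have "?L W = ?L ?w"
      by (rule integral_cong_AE, measurable, measurable, rule eventually_mono[OF Ww], simp)
    also have "\<dots> = - ?R ?w"
      using chain[OF \<psi> tf, of k] by (simp only: Dop_Dx_trig[OF Dop.simps(1)])
    also have "?R ?w = ?R W"
      by (rule integral_cong_AE, measurable, measurable, rule eventually_mono[OF Ww], simp)
    finally show "?L W = - ?R W" .
  qed
  have entW: "weak_entropy_ineq m (\<lambda>j. deriv (\<lambda>r. F r $ j)) (\<lambda>i j s. a s $ i $ j) W G"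
    unfolding weak_entropy_ineq_def
  proof (intro allI impI)
    fix \<delta> z l r :: real and \<theta> :: "real \<Rightarrow> real" and S and c :: "real^'d \<Rightarrow> complex"
    assume \<delta>: "0 < \<delta>" and \<theta>: "smooth_fun \<theta>" "0 < l" "\<forall>t. t \<notin> {l..r} \<longrightarrow> \<theta> t = 0" "\<forall>t. 0 \<le> \<theta> t"
      and nn: "\<forall>\<omega>\<in>bohr. 0 \<le> trig S c \<omega>"
    let ?\<phi> = "\<lambda>t \<omega>. \<theta> t * trig S c \<omega>"
    let ?\<eta> = "\<lambda>s. sabs \<delta> (s - z)"
    have tf: "test_fun ?\<phi>" using test_fun_trig[OF \<theta>(1,2)] \<theta>(3) by blast
    have d1: "(?\<eta> has_real_derivative sabs' \<delta> (s - z)) (at s)" for s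
      by (rule DERIV_cong[OF DERIV_chain2[where f = "sabs \<delta>", OF sabs_DERIV[OF \<delta>]]]) (auto intro!: derivative_eq_intros)
    have d2: "((\<lambda>s. sabs' \<delta> (s - z)) has_real_derivative sabs'' \<delta> (s - z)) (at s)" for s
      by (rule sabs'_diff_DERIV(1)[OF \<delta>])
    have D1: "deriv ?\<eta> = (\<lambda>s. sabs' \<delta> (s - z))" by (intro ext DERIV_imp_deriv d1)
    have D2: "deriv (deriv ?\<eta>) = (\<lambda>s. sabs'' \<delta> (s - z))" unfolding D1 by (intro ext DERIV_imp_deriv d2)
    have conv: "convex_on UNIV ?\<eta>"
      using d1 d2 sabs''_nonneg[OF \<delta>] by (intro f''_ge0_imp_convex[where f' = "\<lambda>s. sabs' \<delta> (s - z)" and f'' = "\<lambda>s. sabs'' \<delta> (s - z)"]) auto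
    have c0: "continuous_on UNIV ?\<eta>" "continuous_on UNIV (\<lambda>s. sabs' \<delta> (s - z))" "continuous_on UNIV (\<lambda>s. sabs'' \<delta> (s - z))"
      using d1 d2 by (auto intro!: continuous_at_imp_continuous_on intro: DERIV_isCont)[2]
        (intro continuous_on_sabs''_diff[OF \<delta>] continuous_intros)
    have C2: "C2_fun ?\<eta>"
      unfolding C2_fun_def D2 using d1 d2 c0(3) unfolding D1 by (auto simp: real_differentiable_def)
    have [measurable]: "?\<eta> \<in> borel_measurable borel" "(\<lambda>s. sabs'' \<delta> (s - z)) \<in> borel_measurable borel"
      using c0 by (auto intro!: borel_measurable_continuous_onI)
    note [measurable] = tm[OF smooth_fun_measurable[OF \<theta>(1)]] tm[OF smooth_fun_measurable[OF smooth_fun_deriv[OF \<theta>(1)]]]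
    have [measurable]: "prim (\<lambda>s. sabs' \<delta> (s - z) * deriv (\<lambda>r. F r $ j) s) \<in> borel_measurable borel" for j
      by (intro pm continuous_on_mult c0 smooth_fun_continuous smooth_fun_deriv F)
    have [measurable]: "prim (\<lambda>s. sabs' \<delta> (s - z) * a s $ i $ j) \<in> borel_measurable borel" for i j
      unfolding a by (intro pm continuous_on_mult c0 continuous_on_sum smooth_fun_continuous \<sigma>)
    have etam [measurable]: "(\<lambda>X. sabs \<delta> (W X - z)) \<in> borel_measurable (tG m)" "(\<lambda>X. sabs'' \<delta> (W X - z)) \<in> borel_measurable (tG m)"
      "(\<lambda>X. sabs \<delta> (w (fst X) (snd X) - z)) \<in> borel_measurable (tG m)" "(\<lambda>X. sabs'' \<delta> (w (fst X) (snd X) - z)) \<in> borel_measurable (tG m)"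
      using measurable_compose[OF W, of ?\<eta>] measurable_compose[OF W, of "\<lambda>s. sabs'' \<delta> (s - z)"]
        measurable_compose[OF wm, of ?\<eta>] measurable_compose[OF wm, of "\<lambda>s. sabs'' \<delta> (s - z)"] by auto
    let ?L = "\<lambda>W. \<integral>X. sabs'' \<delta> (W X - z) * (\<Sum>k\<in>UNIV. (G k X)\<^sup>2) * (\<theta> (fst X) * trig S c (snd X)) \<partial>tG m"
    let ?R = "\<lambda>W. \<integral>X. sabs \<delta> (W X - z) * (deriv \<theta> (fst X) * trig S c (snd X))
          + (\<Sum>j\<in>UNIV. prim (\<lambda>s. sabs' \<delta> (s - z) * deriv (\<lambda>r. F r $ j) s) (W X)
               * (\<theta> (fst X) * trig S (\<lambda>\<xi>. c \<xi> * (\<i> * \<xi> $ j)) (snd X)))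
          + (\<Sum>i\<in>UNIV. \<Sum>j\<in>UNIV. prim (\<lambda>s. sabs' \<delta> (s - z) * a s $ i $ j) (W X)
               * (\<theta> (fst X) * trig S (\<lambda>\<xi>. c \<xi> * (\<i> * \<xi> $ j) * (\<i> * \<xi> $ i)) (snd X))) \<partial>tG m"
    let ?w = "\<lambda>X. w (fst X) (snd X)"
    have "?L W = ?L ?w"
      by (rule integral_cong_AE, measurable, measurable, rule eventually_mono[OF Ww], simp)
    also have "\<dots> \<le> ?R ?w"
    proof -
      have "\<forall>t. \<forall>\<omega>\<in>bohr. 0 \<le> ?\<phi> t \<omega>" using \<theta>(4) nn by simp
      from ent[OF conv C2 tf this]
      show ?thesis
        unfolding D2 unfolding D1 Dop_Dx_trig[OF Dop_Dx_trig[OF Dop.simps(1)]] Dop_Dx_trig[OF Dop.simps(1)]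
          Dop_Dt_trig[OF Dop.simps(1) \<theta>(1)] .
    qed
    also have "?R ?w = ?R W"
      by (rule integral_cong_AE, measurable, measurable, rule eventually_mono[OF Ww], simp)
    finally show "?L W \<le> ?R W" .
  qed
  show ?thesis by (rule that[OF W WC Ww GL chainW entW])
qed

text \<open>The derivative b0 - b is prescribed. Equal masses bring the function back to 0 after r;
  since b0 has ended before b starts, it rises, stays level and falls, and so is
  nonnegative.\<close>

lemma time_cutoff:
  assumes b0: "time_bump l0 r0 b0" and b: "time_bump l r b" and rl: "r0 \<le> l" and eq: "prim b0 r0 = prim b r"
  shows "smooth_fun (\<lambda>t. prim b0 t - prim b t)" "0 \<le> prim b0 t - prim b t"
    "t \<notin> {l0..r} \<Longrightarrow> prim b0 t - prim b t = 0" "deriv (\<lambda>t. prim b0 t - prim b t) t = b0 t - b t"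
proof -
  note p0 = time_bump_prim[OF b0] and p = time_bump_prim[OF b]
  have lr: "l0 \<le> r0" "l \<le> r" "smooth_fun b0" "smooth_fun b" using b0 b by (auto simp: time_bump_def)
  have D: "((\<lambda>t. prim b0 t - prim b t) has_real_derivative b0 t - b t) (at t)" for t
    by (intro DERIV_diff p0(4) p(4))
  then show "deriv (\<lambda>t. prim b0 t - prim b t) t = b0 t - b t" by (rule DERIV_imp_deriv)
  show "smooth_fun (\<lambda>t. prim b0 t - prim b t)"
    by (rule smooth_fun_antideriv[OF D]) (intro smooth_fun_diff lr)
  show "prim b0 t - prim b t = 0" if "t \<notin> {l0..r}"
    using that p0(2,3)[of t] p(2,3)[of t] lr rl eq by (cases "t < l0") auto
  show "0 \<le> prim b0 t - prim b t"
  proof (cases "t \<le> l")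
    case True
    have "0 \<le> prim b0 t" using p0(2)[of t] p0(2)[of l0] monoD[OF p0(1), of l0 t] by (cases "t \<le> l0") auto
    then show ?thesis using p(2)[OF True] by simp
  next
    case False
    have "prim b t \<le> prim b r" using monoD[OF p(1), of t r] p(3)[of t] by (cases "t \<le> r") auto
    then show ?thesis using p0(3)[of t] False rl eq by auto
  qed
qed

text \<open>A bump on [\<rho>, 3\<rho>] is shifted by 2\<rho> to be centred at 0. For t > \<rho> its
  translate to t lives on s \<ge> t - \<rho> > 0, so the half line integral is the full
  mass.\<close>

lemma mollifier_exists:
  assumes "0 < \<rho>"
  obtains \<kappa> c where "smooth_fun \<kappa>" "\<And>t. 0 \<le> \<kappa> t" "\<And>t. t \<notin> {-\<rho>..\<rho>} \<Longrightarrow> \<kappa> t = 0" "0 < c"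
    "\<And>t. \<rho> < t \<Longrightarrow> (\<integral>s. \<kappa> (s - t) \<partial>half_line) = c"
proof -
  obtain b where b: "time_bump \<rho> (3 * \<rho>) b" "0 < prim b (3 * \<rho>)"
    using time_bump_exists[of \<rho> "3 * \<rho>"] assms by auto
  have b': "smooth_fun b" "\<And>t. 0 \<le> b t" "\<And>t. t \<notin> {\<rho>..3 * \<rho>} \<Longrightarrow> b t = 0"
    using b(1) by (auto simp: time_bump_def)
  show ?thesis
  proof
    show "smooth_fun (\<lambda>t. b (t + 2 * \<rho>))" using smooth_fun_affine[OF b'(1), of 1 "2 * \<rho>"] by simp
    show "0 \<le> b (t + 2 * \<rho>)" for t by (rule b')
    show "b (t + 2 * \<rho>) = 0" if "t \<notin> {-\<rho>..\<rho>}" for t using that by (intro b'(3)) auto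
    show "0 < prim b (3 * \<rho>)" by (rule b)
    fix t assume t: "\<rho> < t"
    have "(\<integral>s. b (s - t + 2 * \<rho>) \<partial>half_line) = (\<integral>s. b (s - t + 2 * \<rho>) \<partial>lborel)"
      using t by (intro half_line_integral b'(3)) auto
    also have "\<dots> = (\<integral>s. b s \<partial>lborel)"
      using lborel_integral_real_affine[of 1 b "2 * \<rho> - t"] by (simp add: algebra_simps)
    also have "\<dots> = (\<integral>s. b s \<partial>half_line)"
      using assms by (intro half_line_integral[symmetric] b'(3)) auto
    also have "\<dots> = prim b (3 * \<rho>)" by (rule time_bump_integral[OF b(1)])
    finally show "(\<integral>s. b (s - t + 2 * \<rho>) \<partial>half_line) = prim b (3 * \<rho>)" .
  qed
qed

text \<open>The contraction averaged over time by an arbitrary bump b. Kernel, mollifier and initial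
  bump are picked for each \<epsilon> and no limit is taken in them. K has to concentrate for v0
  only, because u0(x) - v0(y) is (u0 - v0)(x) plus v0(x) - v0(y).\<close>

lemma weighted_contraction:
  fixes m :: "'d::finite bohr_pt measure" and \<sigma> :: "'d \<Rightarrow> 'k::finite \<Rightarrow> real \<Rightarrow> real"
  assumes haar: "haar_measure m"
    and f: "\<And>j. smooth_fun (f j)" and \<sigma>: "\<And>i k. smooth_fun (\<sigma> i k)"
    and a: "\<And>i j s. a i j s = (\<Sum>k\<in>UNIV. \<sigma> i k s * \<sigma> j k s)"
    and U: "U \<in> borel_measurable (tG m)" "\<And>X. \<bar>U X\<bar> \<le> M" and V: "V \<in> borel_measurable (tG m)" "\<And>X. \<bar>V X\<bar> \<le> M"
    and GH: "\<And>k. L2 (tG m) (G k)" "\<And>k. L2 (tG m) (H k)"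
    and chain: "weak_chain_rule m \<sigma> U G" "weak_chain_rule m \<sigma> V H"
    and entropy: "weak_entropy_ineq m f a U G" "weak_entropy_ineq m f a V H"
    and u0: "u0 \<in> borel_measurable m" "\<And>x. \<bar>u0 x\<bar> \<le> M" and v0: "v0 \<in> borel_measurable m" "\<And>x. \<bar>v0 x\<bar> \<le> M"
    and init_U: "\<And>\<epsilon>. 0 < \<epsilon> \<Longrightarrow> \<exists>\<delta>>0. AE t in half_line. t < \<delta> \<longrightarrow> (\<integral>x. \<bar>U (t, x) - u0 x\<bar> \<partial>m) < \<epsilon>"
    and init_V: "\<And>\<epsilon>. 0 < \<epsilon> \<Longrightarrow> \<exists>\<delta>>0. AE t in half_line. t < \<delta> \<longrightarrow> (\<integral>x. \<bar>V (t, x) - v0 x\<bar> \<partial>m) < \<epsilon>"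
    and b: "time_bump l r b"
  shows "(\<integral>X. \<bar>U X - V X\<bar> * b (fst X) \<partial>tG m) \<le> (\<integral>x. \<bar>u0 x - v0 x\<bar> \<partial>m) * (\<integral>t. b t \<partial>half_line)"
proof -
  define I0 where "I0 = (\<integral>x. \<bar>u0 x - v0 x\<bar> \<partial>m)"
  define B where "B = (\<integral>t. b t \<partial>half_line)"
  interpret fm: finite_measure m by (rule haar_prob_space(2)[OF haar])
  have u0i: "integrable m u0" "integrable m v0"
    using u0 v0 by (auto intro!: fm.integrable_const_bound[where B = M])
  have bl: "0 < l" "l \<le> r" using b by (auto simp: time_bump_def)
  have B: "B = prim b r" "0 \<le> B"
    using time_bump_integral[OF b] monoD[OF time_bump_prim(1)[OF b], of 0 r] bl by (auto simp: B_def)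
  \<comment> \<open>Six errors: each of the pairs (u, v) and (v, v) contributes two from the initial
    layers and one from the kernel.\<close>
  have main: "(\<integral>X. \<bar>U X - V X\<bar> * b (fst X) \<partial>tG m) \<le> B * (I0 + 6 * \<epsilon>)" if \<epsilon>: "0 < \<epsilon>" for \<epsilon>
  proof -
    obtain \<delta>u where \<delta>u: "0 < \<delta>u" "AE t in half_line. t < \<delta>u \<longrightarrow> (\<integral>x. \<bar>U (t, x) - u0 x\<bar> \<partial>m) < \<epsilon>"
      using init_U[OF \<epsilon>] by blast
    obtain \<delta>v where \<delta>v: "0 < \<delta>v" "AE t in half_line. t < \<delta>v \<longrightarrow> (\<integral>x. \<bar>V (t, x) - v0 x\<bar> \<partial>m) < \<epsilon>"
      using init_V[OF \<epsilon>] by blast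
    define d where "d = min l (min \<delta>u \<delta>v)"
    \<comment> \<open>The initial bump lives on [d/3, 2d/3]. Widened by d/6 it stays in positive
      times, before l, and inside the ranges where both initial conditions give smallness.\<close>
    define \<rho> where "\<rho> = d / 6"
    have d: "0 < d" "d \<le> l" "d \<le> \<delta>u" "d \<le> \<delta>v" using bl \<delta>u \<delta>v by (auto simp: d_def)
    have \<rho>_bounds: "0 < \<rho>" "\<rho> < d / 3" "\<rho> < l" "2 * d / 3 + \<rho> < \<delta>u" "2 * d / 3 + \<rho> < \<delta>v" using d by (auto simp: \<rho>_def)
    obtain S K where K: "finite S" "0 \<in> S" "Re (K 0) = 1" "\<And>x y. x \<in> bohr \<Longrightarrow> y \<in> bohr \<Longrightarrow> 0 \<le> kern S K x y"
      "(\<integral>z. \<bar>v0 (fst z) - v0 (snd z)\<bar> * kern S K (fst z) (snd z) \<partial>(m \<Otimes>\<^sub>M m)) < \<epsilon>"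
      using haar_kernel_exists[OF haar u0i(2) \<epsilon>] by blast
    obtain \<kappa> c where \<kappa>: "smooth_fun \<kappa>" "\<And>t. 0 \<le> \<kappa> t" "\<And>t. t \<notin> {-\<rho>..\<rho>} \<Longrightarrow> \<kappa> t = 0"
      and c_mass: "0 < c" "\<And>t. \<rho> < t \<Longrightarrow> (\<integral>s. \<kappa> (s - t) \<partial>half_line) = c"
      using mollifier_exists[OF \<rho>_bounds(1)] by metis
    obtain b' where b': "time_bump (d / 3) (2 * d / 3) b'" "0 < prim b' (2 * d / 3)"
      using time_bump_exists[of "d / 3" "2 * d / 3"] d by auto
    \<comment> \<open>Scales the initial bump to the mass B of b, as \<open>time_cutoff\<close>
      demands; for B = 0 it becomes the zero function.\<close>
    define q where "q = B / prim b' (2 * d / 3)"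
    define b0 where "b0 t = q * b' t" for t
    have q: "0 \<le> q" "q * prim b' (2 * d / 3) = B" using B b'(2) by (auto simp: q_def)
    have b0: "time_bump (d / 3) (2 * d / 3) b0"
      using b'(1) q(1) unfolding time_bump_def b0_def by (auto intro!: smooth_fun_mult smooth_fun_const)
    have pb0: "prim b0 (2 * d / 3) = prim b r"
      unfolding b0_def using prim_cmult[OF smooth_fun_continuous, of b' q "2 * d / 3"] b'(1) q(2) B(1)
      by (simp add: time_bump_def)
    then have B0: "(\<integral>t. b0 t \<partial>half_line) = B" using time_bump_integral[OF b0] B(1) by simp
    define \<theta> where "\<theta> t = prim b0 t - prim b t" for t
    have "2 * d / 3 \<le> l" using d by simp
    note cut = time_cutoff[OF b0 b this pb0, folded \<theta>_def]
    interpret kernel_weight m S K \<kappa> \<rho> c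
      by (unfold_locales; (rule haar K \<kappa> \<rho>_bounds c_mass; assumption?)?)
    \<comment> \<open>Both instances share the cut-off, the mollifier and the kernel, so both
      inequalities carry the same weight \<open>wgt b0 - wgt b\<close>.\<close>
    interpret D1: doubling m f \<sigma> a U V G H M "d / 3" r \<rho> \<theta> \<kappa> S K
      by (unfold_locales; (rule haar f \<sigma> a U V GH chain entropy cut \<kappa> \<rho>_bounds K; assumption?)?)
    interpret D2: doubling m f \<sigma> a V V H H M "d / 3" r \<rho> \<theta> \<kappa> S K
      by (unfold_locales; (rule haar f \<sigma> a U V GH chain entropy cut \<kappa> \<rho>_bounds K; assumption?)?)
    have wt: "D1.wt z = wgt b0 z - wgt b z" "D2.wt z = wgt b0 z - wgt b z" for z
      unfolding D1.wt_def D2.wt_def D1.\<Theta>t_def D2.\<Theta>t_def wgt_def cut(4) by (simp_all add: left_diff_distrib)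
    note [measurable] = U(1) V(1) u0(1) v0(1)
    have UV: "\<bar>\<bar>P - Q\<bar>\<bar> \<le> 2 * M" if "\<bar>P\<bar> \<le> M" "\<bar>Q\<bar> \<le> M" for P Q :: real using that by linarith
    let ?UV = "\<lambda>z. \<bar>U (fst z) - V (snd z)\<bar>"
    let ?VV = "\<lambda>z. \<bar>V (fst z) - V (snd z)\<bar>"
    let ?Uu = "\<lambda>z. \<bar>U (fst z) - u0 (snd (fst z))\<bar>"
    let ?Vv = "\<lambda>z. \<bar>V (fst z) - v0 (snd (fst z))\<bar>"
    let ?Vv' = "\<lambda>z. \<bar>V (snd z) - v0 (snd (snd z))\<bar>"
    let ?uv = "\<lambda>z. \<bar>u0 (snd (fst z)) - v0 (snd (snd z))\<bar>"
    let ?vv = "\<lambda>z. \<bar>v0 (snd (fst z)) - v0 (snd (snd z))\<bar>"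
    let ?XX = "\<lambda>z. \<bar>U (fst z) - V (fst z)\<bar>"
    let ?J = "\<lambda>\<beta> P. \<integral>z. P z * wgt \<beta> z \<partial>NN"
    have iUV: "integrable NN (\<lambda>z. ?UV z * wgt \<beta> z)"
      and iVV: "integrable NN (\<lambda>z. ?VV z * wgt \<beta> z)"
      and iUu: "integrable NN (\<lambda>z. ?Uu z * wgt \<beta> z)"
      and iVv: "integrable NN (\<lambda>z. ?Vv z * wgt \<beta> z)"
      and iVv': "integrable NN (\<lambda>z. ?Vv' z * wgt \<beta> z)"
      and iuv: "integrable NN (\<lambda>z. ?uv z * wgt \<beta> z)"
      and ivv: "integrable NN (\<lambda>z. ?vv z * wgt \<beta> z)"
      and iXX: "integrable NN (\<lambda>z. ?XX z * wgt \<beta> z)"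
      if "time_bump l' r' \<beta>" for l' r' \<beta>
      by (rule wgt_integrable[OF _ UV that]; (rule U(2) V(2) u0(2) v0(2))?; measurable)+
    have k1: "?J b ?UV \<le> ?J b0 ?UV"
      using D1.kato_inequality iUV[OF b] iUV[OF b0] by (simp add: wt right_diff_distrib)
    have k2: "?J b ?VV \<le> ?J b0 ?VV"
      using D2.kato_inequality iVV[OF b] iVV[OF b0] by (simp add: wt right_diff_distrib)
    have hm: "(\<lambda>X. U X - u0 (snd X)) \<in> borel_measurable (tG m)" "(\<lambda>X. V X - v0 (snd X)) \<in> borel_measurable (tG m)"
      by measurable
    have hb: "\<bar>U X - u0 (snd X)\<bar> \<le> 2 * M" "\<bar>V X - v0 (snd X)\<bar> \<le> 2 * M" for X
      using U(2)[of X] V(2)[of X] u0(2)[of "snd X"] v0(2)[of "snd X"] by linarith+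
    have c0: "0 \<le> c" using c_mass by simp
    have sU: "?J b0 ?Uu \<le> c * B * \<epsilon>"
      using wgt_short_time_small(1)[OF hm(1) hb(1) _ b0 \<rho>_bounds(2,4) c0, of \<epsilon>] \<delta>u(2) by (simp add: B0)
    have sV: "?J b0 ?Vv \<le> c * B * \<epsilon>"
      "?J b0 ?Vv' \<le> c * B * \<epsilon>"
      using wgt_short_time_small[OF hm(2) hb(2) _ b0 \<rho>_bounds(2,5) c0, of \<epsilon>] \<delta>v(2) by (simp_all add: B0)
    let ?k = "\<lambda>z. kern S K (fst z) (snd z)"
    have K1: "(if 0 \<in> S then Re (K 0) else 0) = 1" using K by simp
    note ki = haar_kern_integral[OF haar K(1), where k = K, unfolded K1]
    have uv0i: "integrable m (\<lambda>x. \<bar>u0 x - v0 x\<bar>)" using u0i by auto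
    have "(\<integral>z. \<bar>u0 (fst z) - v0 (snd z)\<bar> * ?k z \<partial>(m \<Otimes>\<^sub>M m)) \<le>
        (\<integral>z. \<bar>u0 (fst z) - v0 (fst z)\<bar> * ?k z + \<bar>v0 (fst z) - v0 (snd z)\<bar> * ?k z \<partial>(m \<Otimes>\<^sub>M m))"
    proof (rule integral_mono)
      show "integrable (m \<Otimes>\<^sub>M m) (\<lambda>z. \<bar>u0 (fst z) - v0 (snd z)\<bar> * ?k z)"
        by (rule haar_integrable_diff_kern[OF haar K(1) u0i])
      show "integrable (m \<Otimes>\<^sub>M m) (\<lambda>z. \<bar>u0 (fst z) - v0 (fst z)\<bar> * ?k z + \<bar>v0 (fst z) - v0 (snd z)\<bar> * ?k z)"
        by (intro Bochner_Integration.integrable_add ki(1)[OF uv0i] haar_integrable_diff_kern[OF haar K(1) u0i(2) u0i(2)])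
      fix z assume "z \<in> space (m \<Otimes>\<^sub>M m)"
      then have "0 \<le> kern S K (fst z) (snd z)" by (intro K(4)) (auto simp: space_pair_measure haar_space[OF haar])
      then show "\<bar>u0 (fst z) - v0 (snd z)\<bar> * ?k z \<le>
          \<bar>u0 (fst z) - v0 (fst z)\<bar> * ?k z + \<bar>v0 (fst z) - v0 (snd z)\<bar> * ?k z"
        unfolding distrib_right[symmetric] by (intro mult_right_mono) auto
    qed
    also have "\<dots> = I0 + (\<integral>z. \<bar>v0 (fst z) - v0 (snd z)\<bar> * ?k z \<partial>(m \<Otimes>\<^sub>M m))"
      using ki(1,3)[OF uv0i] haar_integrable_diff_kern[OF haar K(1) u0i(2) u0i(2), of K] by (simp add: I0_def)
    finally have i0: "(\<integral>z. \<bar>u0 (fst z) - v0 (snd z)\<bar> * ?k z \<partial>(m \<Otimes>\<^sub>M m)) \<le> I0 + \<epsilon>"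
      using K(5) by simp
    have cB: "0 \<le> c * B" using c0 B by simp
    have suv: "?J b0 ?uv \<le> c * B * (I0 + \<epsilon>)"
      using mult_left_mono[OF i0 cB] wgt_initial[OF u0(1) v0(1) u0(2) v0(2) b0 \<rho>_bounds(2)] by (simp add: B0)
    have svv: "?J b0 ?vv \<le> c * B * \<epsilon>"
      using mult_left_mono[OF less_imp_le[OF K(5)] cB] wgt_initial[OF v0(1) v0(1) v0(2) v0(2) b0 \<rho>_bounds(2)] by (simp add: B0)
    have e1: "?J b0 ?UV \<le>
        (\<integral>z. ?Uu z * wgt b0 z + ?Vv' z * wgt b0 z
          + ?uv z * wgt b0 z \<partial>NN)"
    proof (rule integral_mono[OF iUV[OF b0]])
      show "integrable NN (\<lambda>z. ?Uu z * wgt b0 z + ?Vv' z * wgt b0 z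
          + ?uv z * wgt b0 z)"
        by (intro Bochner_Integration.integrable_add iUu[OF b0] iVv'[OF b0] iuv[OF b0])
      fix z assume "z \<in> space NN"
      from wgt_nonneg[OF b0 this]
      show "?UV z * wgt b0 z \<le> ?Uu z * wgt b0 z + ?Vv' z * wgt b0 z
          + ?uv z * wgt b0 z"
        unfolding distrib_right[symmetric] by (intro mult_right_mono) auto
    qed
    have e2: "?J b0 ?VV \<le>
        (\<integral>z. ?Vv z * wgt b0 z + ?Vv' z * wgt b0 z
          + ?vv z * wgt b0 z \<partial>NN)"
    proof (rule integral_mono[OF iVV[OF b0]])
      show "integrable NN (\<lambda>z. ?Vv z * wgt b0 z + ?Vv' z * wgt b0 z
          + ?vv z * wgt b0 z)"
        by (intro Bochner_Integration.integrable_add iVv[OF b0] iVv'[OF b0] ivv[OF b0])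
      fix z assume "z \<in> space NN"
      from wgt_nonneg[OF b0 this]
      show "?VV z * wgt b0 z \<le> ?Vv z * wgt b0 z + ?Vv' z * wgt b0 z
          + ?vv z * wgt b0 z"
        unfolding distrib_right[symmetric] by (intro mult_right_mono) auto
    qed
    \<comment> \<open>The left integrand depends on X alone, so its weight can be integrated out
      exactly; the triangle inequality goes through V(Y), which needs the estimate for (v, v) and no
      regularity of V in time.\<close>
    have e3: "?J b ?XX \<le>
        (\<integral>z. ?UV z * wgt b z + ?VV z * wgt b z \<partial>NN)"
    proof (rule integral_mono[OF iXX[OF b]])
      show "integrable NN (\<lambda>z. ?UV z * wgt b z + ?VV z * wgt b z)"
        by (intro Bochner_Integration.integrable_add iUV[OF b] iVV[OF b])
      fix z assume "z \<in> space NN"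
      from wgt_nonneg[OF b this]
      show "?XX z * wgt b z \<le> ?UV z * wgt b z + ?VV z * wgt b z"
        unfolding distrib_right[symmetric] by (intro mult_right_mono) auto
    qed
    have x: "?J b ?XX = c * (\<integral>X. \<bar>U X - V X\<bar> * b (fst X) \<partial>tG m)"
      by (rule wgt_integral_fst[where g = "\<lambda>X. \<bar>U X - V X\<bar>", OF _ UV[OF U(2) V(2)] b \<rho>_bounds(3)]) measurable
    have e1': "?J b0 ?UV \<le> c * B * \<epsilon> + c * B * \<epsilon> + c * B * (I0 + \<epsilon>)"
    proof -
      have "(\<integral>z. ?Uu z * wgt b0 z + ?Vv' z * wgt b0 z
          + ?uv z * wgt b0 z \<partial>NN) =
          ?J b0 ?Uu + ?J b0 ?Vv'
          + ?J b0 ?uv"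
        using iUu[OF b0] iVv'[OF b0] iuv[OF b0] by simp
      with e1 sU sV(2) suv show ?thesis by linarith
    qed
    have e2': "?J b0 ?VV \<le> c * B * \<epsilon> + c * B * \<epsilon> + c * B * \<epsilon>"
    proof -
      have "(\<integral>z. ?Vv z * wgt b0 z + ?Vv' z * wgt b0 z
          + ?vv z * wgt b0 z \<partial>NN) =
          ?J b0 ?Vv + ?J b0 ?Vv'
          + ?J b0 ?vv"
        using iVv[OF b0] iVv'[OF b0] ivv[OF b0] by simp
      with e2 sV svv show ?thesis by linarith
    qed
    have "c * (\<integral>X. \<bar>U X - V X\<bar> * b (fst X) \<partial>tG m) \<le>
        (c * B * \<epsilon> + c * B * \<epsilon> + c * B * (I0 + \<epsilon>)) + (c * B * \<epsilon> + c * B * \<epsilon> + c * B * \<epsilon>)"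
    proof -
      have "(\<integral>z. ?UV z * wgt b z + ?VV z * wgt b z \<partial>NN) =
          ?J b ?UV + ?J b ?VV"
        using iUV[OF b] iVV[OF b] by simp
      with e3 k1 k2 e1' e2' x show ?thesis by linarith
    qed
    also have "\<dots> = c * (B * (I0 + 6 * \<epsilon>))" by (simp add: algebra_simps)
    finally show ?thesis using c_mass(1) by simp
  qed
  have "(\<integral>X. \<bar>U X - V X\<bar> * b (fst X) \<partial>tG m) \<le> I0 * B + e" if e: "0 < e" for e
  proof -
    \<comment> \<open>B + 1 in place of B keeps this choice of \<epsilon> meaningful when b has mass
      0.\<close>
    have "(\<integral>X. \<bar>U X - V X\<bar> * b (fst X) \<partial>tG m) \<le> B * (I0 + 6 * (e / (6 * (B + 1))))"
      using e B by (intro main) auto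
    also have "\<dots> = I0 * B + e * (B / (B + 1))" using B by (simp add: field_simps)
    also have "\<dots> \<le> I0 * B + e * 1" using B e by (intro add_left_mono mult_left_mono) auto
    finally show ?thesis by simp
  qed
  then show ?thesis unfolding I0_def[symmetric] B_def[symmetric] by (rule field_le_epsilon)
qed

section \<open>Almost every time section\<close>

lemma half_line_AE_section:
  assumes haar: "haar_measure m" and ae: "AE X in tG m. P X"
  shows "AE t in half_line. AE x in m. P (t, x)"
proof -
  interpret pair_sigma_finite half_line m by (rule tG_pair[OF haar])
  show ?thesis using ae unfolding tG_def by (rule AE_pair)
qed

lemma tG_section_measurable:
  assumes "W \<in> borel_measurable (tG m)" "0 < t"
  shows "(\<lambda>x. W (t, x)) \<in> borel_measurable m"
  using measurable_Pair2[OF assms(1)[unfolded tG_def], of t] assms(2) by (simp add: space_restrict_space)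

text \<open>By Fubini for null sets the sections of W and w agree almost everywhere for almost every
  t, so condition (iv) carries over to the bounded representatives.\<close>

lemma entropy_solution_initial:
  assumes haar: "haar_measure m" and es: "entropy_solution m F a \<sigma> w w0"
    and W: "W \<in> borel_measurable (tG m)" "AE X in tG m. W X = w (fst X) (snd X)"
    and g: "g \<in> borel_measurable m" "AE x in m. g x = w0 x" and w0: "w0 \<in> borel_measurable m" and \<epsilon>: "0 < \<epsilon>"
  shows "\<exists>\<delta>>0. AE t in half_line. t < \<delta> \<longrightarrow> (\<integral>x. \<bar>W (t, x) - g x\<bar> \<partial>m) < \<epsilon>"
proof -
  have wm: "(\<lambda>X. w (fst X) (snd X)) \<in> borel_measurable (tG m)"
    using es by (simp add: entropy_solution_def Linf_def case_prod_unfold)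
  obtain \<delta> where \<delta>: "0 < \<delta>" "AE t in lborel. 0 < t \<and> t < \<delta> \<longrightarrow> (\<integral>\<omega>. \<bar>w t \<omega> - w0 \<omega>\<bar> \<partial>m) < \<epsilon>"
    using es \<epsilon> by (auto simp: entropy_solution_def)
  from \<delta>(2) have "AE t in half_line. 0 < t \<longrightarrow> t < \<delta> \<longrightarrow> (\<integral>\<omega>. \<bar>w t \<omega> - w0 \<omega>\<bar> \<partial>m) < \<epsilon>"
    by (subst AE_restrict_space_iff) (auto elim!: eventually_mono)
  moreover have "AE t in half_line. 0 < t" by (rule AE_I2) (simp add: space_restrict_space)
  ultimately have "AE t in half_line. t < \<delta> \<longrightarrow> (\<integral>x. \<bar>W (t, x) - g x\<bar> \<partial>m) < \<epsilon>"
    using half_line_AE_section[OF haar W(2)]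
  proof eventually_elim
    case (elim t)
    note [measurable] = tG_section_measurable[OF W(1) elim(2)] tG_section_measurable[OF wm elim(2), simplified] g(1) w0
    have "(\<integral>x. \<bar>W (t, x) - g x\<bar> \<partial>m) = (\<integral>x. \<bar>w t x - w0 x\<bar> \<partial>m)"
    proof (rule integral_cong_AE)
      show "AE x in m. \<bar>W (t, x) - g x\<bar> = \<bar>w t x - w0 x\<bar>" using elim(3) g(2) by eventually_elim simp
    qed measurable
    then show ?case using elim(1,2) by simp
  qed
  then show ?thesis using \<delta>(1) by blast
qed

theorem theorem3p2:
  fixes F :: "real \<Rightarrow> real^'d::finite"
    and AA :: "real \<Rightarrow> real^'d^'d"
    and a :: "real \<Rightarrow> real^'d^'d"
    and \<sigma> :: "real \<Rightarrow> real^'k::finite^'d"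
    and m :: "'d bohr_pt measure"
    and u v :: "real \<Rightarrow> 'd bohr_pt \<Rightarrow> real"
    and u0 v0 :: "'d bohr_pt \<Rightarrow> real"
  assumes "\<forall>j. smooth_fun (\<lambda>s. F s $ j)"
    and "\<forall>i j. smooth_fun (\<lambda>s. AA s $ i $ j)"
    and "\<forall>s i j. AA s $ i $ j = AA s $ j $ i"
    and "\<forall>s i j. ((\<lambda>r. AA r $ i $ j) has_real_derivative a s $ i $ j) (at s)"
    and "\<forall>s \<xi>. 0 \<le> (\<Sum>i\<in>UNIV. \<Sum>j\<in>UNIV. a s $ i $ j * \<xi> $ i * \<xi> $ j)"
    and "\<forall>i k. smooth_fun (\<lambda>s. \<sigma> s $ i $ k)"
    and "\<forall>s i j. a s $ i $ j = (\<Sum>k\<in>UNIV. \<sigma> s $ i $ k * \<sigma> s $ j $ k)"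
    and "haar_measure m"
    and "Linf m u0" and "Linf m v0"
    and "entropy_solution m F a \<sigma> u u0"
    and "entropy_solution m F a \<sigma> v v0"
  shows "AE t in lborel. 0 < t \<longrightarrow>
           (\<integral>\<omega>. \<bar>u t \<omega> - v t \<omega>\<bar> \<partial>m) \<le> (\<integral>\<omega>. \<bar>u0 \<omega> - v0 \<omega>\<bar> \<partial>m)"
proof -
  note haar = assms(8)
  interpret fm: finite_measure m by (rule haar_prob_space(2)[OF haar])
  interpret TX: pair_sigma_finite half_line m by (rule tG_pair[OF haar])
  have F_smooth: "smooth_fun (\<lambda>s. F s $ j)" and \<sigma>_smooth: "smooth_fun (\<lambda>s. \<sigma> s $ i $ k)"
    and a_eq: "a s $ i $ j = (\<Sum>k\<in>UNIV. \<sigma> s $ i $ k * \<sigma> s $ j $ k)" for s i j k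
    using assms(1,6,7) by simp_all
  obtain U CU G where U: "U \<in> borel_measurable (tG m)" "\<And>X. \<bar>U X\<bar> \<le> CU" "AE X in tG m. U X = u (fst X) (snd X)"
    and G: "\<And>k. L2 (tG m) (G k)" "weak_chain_rule m (\<lambda>i k s. \<sigma> s $ i $ k) U G"
    "weak_entropy_ineq m (\<lambda>j. deriv (\<lambda>r. F r $ j)) (\<lambda>i j s. a s $ i $ j) U G"
    by (rule entropy_solution_truncate[OF haar assms(11) F_smooth \<sigma>_smooth a_eq]) (rule that)
  obtain V CV H where V: "V \<in> borel_measurable (tG m)" "\<And>X. \<bar>V X\<bar> \<le> CV" "AE X in tG m. V X = v (fst X) (snd X)"
    and H: "\<And>k. L2 (tG m) (H k)" "weak_chain_rule m (\<lambda>i k s. \<sigma> s $ i $ k) V H"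
    "weak_entropy_ineq m (\<lambda>j. deriv (\<lambda>r. F r $ j)) (\<lambda>i j s. a s $ i $ j) V H"
    by (rule entropy_solution_truncate[OF haar assms(12) F_smooth \<sigma>_smooth a_eq]) (rule that)
  obtain p Cp where p: "p \<in> borel_measurable m" "\<And>x. \<bar>p x\<bar> \<le> Cp" "AE x in m. p x = u0 x"
    by (rule Linf_truncate[OF assms(9)]) (rule that)
  obtain q Cq where q: "q \<in> borel_measurable m" "\<And>x. \<bar>q x\<bar> \<le> Cq" "AE x in m. q x = v0 x"
    by (rule Linf_truncate[OF assms(10)]) (rule that)
  have um: "u0 \<in> borel_measurable m" "v0 \<in> borel_measurable m" using assms(9,10) by (auto simp: Linf_def)
  define M where "M = \<bar>CU\<bar> + \<bar>CV\<bar> + \<bar>Cp\<bar> + \<bar>Cq\<bar>"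
  have M: "\<bar>U X\<bar> \<le> M" "\<bar>V X\<bar> \<le> M" "\<bar>p x\<bar> \<le> M" "\<bar>q x\<bar> \<le> M" for X x
    using U(2)[of X] V(2)[of X] p(2)[of x] q(2)[of x] by (auto simp: M_def)
  define I0 where "I0 = (\<integral>\<omega>. \<bar>u0 \<omega> - v0 \<omega>\<bar> \<partial>m)"
  have I0: "I0 = (\<integral>x. \<bar>p x - q x\<bar> \<partial>m)"
    unfolding I0_def
  proof (rule integral_cong_AE)
    show "AE x in m. \<bar>u0 x - v0 x\<bar> = \<bar>p x - q x\<bar>" using p(3) q(3) by eventually_elim simp
  qed (use um p(1) q(1) in measurable)
  \<comment> \<open>Formed from the bounded representatives, g is measurable in t and bounded at
    every t > 0, as \<open>AE_nonpos_by_bumps\<close> asks.\<close>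
  define g where "g t = (\<integral>x. \<bar>U (t, x) - V (t, x)\<bar> \<partial>m) - I0" for t
  note [measurable] = U(1) V(1)
  have meas: "(\<lambda>X. \<bar>U X - V X\<bar>) \<in> borel_measurable (half_line \<Otimes>\<^sub>M m)"
    unfolding tG_def[symmetric] by measurable
  have "AE t in lborel. 0 < t \<longrightarrow> g t \<le> 0"
  proof (rule AE_nonpos_by_bumps)
    have "(\<lambda>t. \<integral>x. \<bar>U (t, x) - V (t, x)\<bar> \<partial>m) \<in> borel_measurable half_line"
      by (rule sigma_finite_measure.borel_measurable_lebesgue_integral[OF haar_prob_space(3)[OF haar]]) (use meas in simp)
    then show "g \<in> borel_measurable half_line" unfolding g_def[abs_def] by measurable
    show "\<bar>g t\<bar> \<le> 2 * M + \<bar>I0\<bar>" if t: "0 < t" for t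
    proof -
      have sec: "(\<lambda>x. \<bar>U (t, x) - V (t, x)\<bar>) \<in> borel_measurable m"
        using tG_section_measurable[OF U(1) t] tG_section_measurable[OF V(1) t] by measurable
      have bd: "\<bar>U (t, x) - V (t, x)\<bar> \<le> 2 * M" for x using M(1,2)[of "(t, x)"] by linarith
      have "(\<integral>x. \<bar>U (t, x) - V (t, x)\<bar> \<partial>m) \<le> (\<integral>x. 2 * M \<partial>m)"
        using bd sec abs_ge_zero[THEN order_trans, OF M(1)] by (intro integral_mono fm.integrable_const_bound[where B = "2 * M"]) auto
      then have "(\<integral>x. \<bar>U (t, x) - V (t, x)\<bar> \<partial>m) \<le> 2 * M"
        using haar_measure_space[OF haar] by simp
      moreover have "0 \<le> (\<integral>x. \<bar>U (t, x) - V (t, x)\<bar> \<partial>m)" by (intro integral_nonneg_AE) auto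
      ultimately show ?thesis unfolding g_def by linarith
    qed
    fix l r b assume b: "time_bump l r b"
    have bi: "integrable half_line b" by (rule time_bump_integrable[OF b])
    have int: "integrable (half_line \<Otimes>\<^sub>M m) (\<lambda>X. \<bar>U X - V X\<bar> * b (fst X))"
    proof (fold tG_def, rule Bochner_Integration.integrable_bound)
      show "integrable (tG m) (\<lambda>X. 2 * M * b (fst X))" using tG_integrable_time[OF haar bi] by simp
      show "(\<lambda>X. \<bar>U X - V X\<bar> * b (fst X)) \<in> borel_measurable (tG m)"
        using borel_measurable_integrable[OF tG_integrable_time[OF haar bi]] by measurable
      show "AE X in tG m. norm (\<bar>U X - V X\<bar> * b (fst X)) \<le> norm (2 * M * b (fst X))"
      proof (rule AE_I2)
        fix X
        have "\<bar>U X - V X\<bar> \<le> \<bar>2 * M\<bar>" using M(1,2)[of X] by linarith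
        from mult_right_mono[OF this abs_ge_zero[of "b (fst X)"]]
        show "norm (\<bar>U X - V X\<bar> * b (fst X)) \<le> norm (2 * M * b (fst X))" by (simp add: abs_mult)
      qed
    qed
    have gi: "integrable half_line (\<lambda>t. (\<integral>x. \<bar>U (t, x) - V (t, x)\<bar> \<partial>m) * b t)"
      using TX.integrable_fst'[OF int] by simp
    have "(\<integral>t. g t * b t \<partial>half_line) = (\<integral>t. (\<integral>x. \<bar>U (t, x) - V (t, x)\<bar> \<partial>m) * b t \<partial>half_line) - I0 * (\<integral>t. b t \<partial>half_line)"
      unfolding g_def using gi bi by (simp add: left_diff_distrib)
    also have "(\<integral>t. (\<integral>x. \<bar>U (t, x) - V (t, x)\<bar> \<partial>m) * b t \<partial>half_line) = (\<integral>X. \<bar>U X - V X\<bar> * b (fst X) \<partial>tG m)"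
      using TX.integral_fst'[OF int] by (simp add: tG_def)
    also have "\<dots> \<le> I0 * (\<integral>t. b t \<partial>half_line)"
      unfolding I0
    proof (rule weighted_contraction[OF haar smooth_fun_deriv[OF F_smooth] \<sigma>_smooth a_eq U(1) M(1) V(1) M(2) G(1) H(1) G(2) H(2) G(3) H(3) p(1) M(3) q(1) M(4) _ _ b])
      show "\<exists>\<delta>>0. AE t in half_line. t < \<delta> \<longrightarrow> (\<integral>x. \<bar>U (t, x) - p x\<bar> \<partial>m) < \<epsilon>" if "0 < \<epsilon>" for \<epsilon>
        by (rule entropy_solution_initial[OF haar assms(11) U(1,3) p(1,3) um(1) that])
      show "\<exists>\<delta>>0. AE t in half_line. t < \<delta> \<longrightarrow> (\<integral>x. \<bar>V (t, x) - q x\<bar> \<partial>m) < \<epsilon>" if "0 < \<epsilon>" for \<epsilon>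
        by (rule entropy_solution_initial[OF haar assms(12) V(1,3) q(1,3) um(2) that])
    qed
    finally show "(\<integral>t. g t * b t \<partial>half_line) \<le> 0" by simp
  qed
  \<comment> \<open>Return to u and v: for almost every t their sections agree almost everywhere
    with those of U and V.\<close>
  moreover have "AE t in lborel. 0 < t \<longrightarrow> (AE x in m. U (t, x) = u t x)" "AE t in lborel. 0 < t \<longrightarrow> (AE x in m. V (t, x) = v t x)"
    using half_line_AE_section[OF haar U(3)] half_line_AE_section[OF haar V(3)]
    by (simp_all add: AE_restrict_space_iff)
  ultimately show ?thesis
  proof eventually_elim
    case (elim t)
    show ?case
    proof
      assume t: "0 < t"
      have wm: "(\<lambda>X. u (fst X) (snd X)) \<in> borel_measurable (tG m)" "(\<lambda>X. v (fst X) (snd X)) \<in> borel_measurable (tG m)"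
        using assms(11,12) by (simp_all add: entropy_solution_def Linf_def case_prod_unfold)
      note [measurable] = tG_section_measurable[OF U(1) t] tG_section_measurable[OF V(1) t]
        tG_section_measurable[OF wm(1) t, simplified] tG_section_measurable[OF wm(2) t, simplified]
      have ae: "AE x in m. U (t, x) = u t x" "AE x in m. V (t, x) = v t x" using elim(2,3) t by auto
      have "(\<integral>\<omega>. \<bar>u t \<omega> - v t \<omega>\<bar> \<partial>m) = (\<integral>x. \<bar>U (t, x) - V (t, x)\<bar> \<partial>m)"
      proof (rule integral_cong_AE)
        show "AE x in m. \<bar>u t x - v t x\<bar> = \<bar>U (t, x) - V (t, x)\<bar>" using ae by eventually_elim simp
      qed measurable
      also have "\<dots> \<le> I0" using elim(1) t by (simp add: g_def)
      finally show "(\<integral>\<omega>. \<bar>u t \<omega> - v t \<omega>\<bar> \<partial>m) \<le> (\<integral>\<omega>. \<bar>u0 \<omega> - v0 \<omega>\<bar> \<partial>m)" by (simp add: I0_def)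
    qed
  qed
qed

end
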